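(* The following three statements hold. 1) Let $\gamma$ be a smooth plane curve without $2$-extactic points, all of whose osculating conics are non-degenerate and are ellipses. Then the osculating ellipses of $\gamma$ at distinct points of $\gamma$ are pairwise disjoint. 2) Let $\gamma$ be a smooth plane curve without $3$-extactic points, all of whose osculating cubic curves are non-degenerate and have two components, an oval and a branch going to infinity, and such that at each point of $\gamma$ it is the oval, not the infinite branch, of the osculating cubic that osculates $\gamma$. Then the ovals of the osculating cubic curves of $\gamma$ at distinct points of $\gamma$ are pairwise disjoint. 3) Let $f$ be a smooth real function of one real variable with nowhere vanishing derivative, let $I$ be an interval such that for every $t\in I$ the osculating hyperbola of $f$ at $t$ does not hyper-osculate, and let $\gamma$ be the graph of $f$ over $I$. Then the osculating hyperbolas of $\gamma$ at distinct points $t\in I$ are pairwise disjoint.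
   Context: For $d\ge1$, the space of plane algebraic curves of degree $d$ has dimension $n(d)=d(d+3)/2$ (so $n(2)=5$, $n(3)=9$). The osculating algebraic curve of degree $d$ of a smooth plane curve $\gamma$ at a point of $\gamma$ is the algebraic curve of degree $d$ that approximates $\gamma$ to order $n(d)-1$ at that point (informally, it passes through $n(d)$ infinitesimally close points of $\gamma$); i.e. if $\gamma(s)$ is a smooth regular parameterization and the osculating curve at $\gamma(s_0)$ has equation $p=0$ with $p$ of degree $d$, then $s\mapsto p(\gamma(s))$ has vanishing derivatives of orders $0,\dots,n(d)-1$ at $s=s_0$. A point of $\gamma$ is a $d$-extactic point if the osculating algebraic curve of degree $d$ hyper-osculates there, i.e. approximates $\gamma$ to order $n(d)$. Osculating conics and osculating cubics are the cases $d=2$ and $d=3$. "Non-degenerate" means that the curve is nonsingular. For a smooth function $f$ with nowhere vanishing derivative and $t\in\mathbb{R}$, the osculating fractional-linear transformation $g_t$ of $f$ at $t$ is the fractional-linear transformation whose value and first two derivatives at $t$ coincide with those of $f$. It hyper-osculates at $t$ if the third derivatives of $g_t$ and $f$ at $t$ coincide as well; equivalently, if the Schwarzian derivative $\frac{f'''}{f'}-\frac32\left(\frac{f''}{f'}\right)^2$ vanishes at $t$. The graph of $g_t$ is a hyperbola with vertical and horizontal asymptotes (or a straight line), and is called the osculating hyperbola at $t$.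
   Formalization: In 3), whole osculating hyperbolas can meet (e.g. f = exp on R), so it is proved instead that the branches through the contact points are pairwise disjoint, and likewise the remaining branches; a contact branch may meet a remote branch of another hyperbola. *)

theory Defs
  imports "HOL-Analysis.Analysis"
begin

section \<open>Smooth plane curves\<close>

text \<open>Derivatives are taken within the parameter interval, hence one-sided at an end point that
  belongs to it.\<close>

definition nderiv_on :: "real set \<Rightarrow> nat \<Rightarrow> (real \<Rightarrow> 'a::real_normed_vector) \<Rightarrow> real \<Rightarrow> 'a" where
  "nderiv_on I k f = ((\<lambda>g t. vector_derivative g (at t within I)) ^^ k) f"

definition smooth_regular_curve :: "real set \<Rightarrow> (real \<Rightarrow> real \<times> real) \<Rightarrow> bool" where
  "smooth_regular_curve I \<gamma> \<longleftrightarrow>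
     is_interval I \<and>
     (\<forall>k. \<forall>t\<in>I. nderiv_on I k \<gamma> differentiable (at t within I)) \<and>
     (\<forall>t\<in>I. nderiv_on I 1 \<gamma> t \<noteq> 0)"


section \<open>Plane algebraic curves\<close>

text \<open>A polynomial in two variables of degree at most \<open>d\<close> is given by its coefficients: \<open>a i j\<close> is
  the coefficient of \<open>x ^ i * y ^ j\<close> for \<open>i + j \<le> d\<close>, and the other values of \<open>a\<close> are ignored.\<close>

definition poly2 :: "nat \<Rightarrow> (nat \<Rightarrow> nat \<Rightarrow> real) \<Rightarrow> real \<times> real \<Rightarrow> real" where
  "poly2 d a z = (\<Sum>i\<le>d. \<Sum>j\<le>d - i. a i j * fst z ^ i * snd z ^ j)"

definition poly2_nonzero :: "nat \<Rightarrow> (nat \<Rightarrow> nat \<Rightarrow> real) \<Rightarrow> bool" where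
  "poly2_nonzero d a \<longleftrightarrow> (\<exists>i j. i + j \<le> d \<and> a i j \<noteq> 0)"

definition alg_curve :: "nat \<Rightarrow> (nat \<Rightarrow> nat \<Rightarrow> real) \<Rightarrow> (real \<times> real) set" where
  "alg_curve d a = {z. poly2 d a z = 0}"

text \<open>Nonsingularity refers to the complex projective curve. For \<open>d \<ge> 2\<close> it forces the degree to be
  exactly \<open>d\<close>, since otherwise the line at infinity would be a component.\<close>

definition homogenization ::
    "nat \<Rightarrow> (nat \<Rightarrow> nat \<Rightarrow> real) \<Rightarrow> complex \<Rightarrow> complex \<Rightarrow> complex \<Rightarrow> complex" where
  "homogenization d a x y z =
     (\<Sum>i\<le>d. \<Sum>j\<le>d - i. complex_of_real (a i j) * x ^ i * y ^ j * z ^ (d - i - j))"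

definition nonsingular_curve :: "nat \<Rightarrow> (nat \<Rightarrow> nat \<Rightarrow> real) \<Rightarrow> bool" where
  "nonsingular_curve d a \<longleftrightarrow>
     (\<forall>x y z. (x, y, z) \<noteq> (0, 0, 0) \<and> homogenization d a x y z = 0 \<longrightarrow>
        \<not> (deriv (\<lambda>u. homogenization d a u y z) x = 0 \<and>
           deriv (\<lambda>u. homogenization d a x u z) y = 0 \<and>
           deriv (\<lambda>u. homogenization d a x y u) z = 0))"

definition is_ellipse :: "(real \<times> real) set \<Rightarrow> bool" where
  "is_ellipse E \<longleftrightarrow>
     (\<exists>(L :: real \<times> real \<Rightarrow> real \<times> real) b. linear L \<and> bij L \<and> E = (\<lambda>z. L z + b) ` sphere 0 1)"

definition is_oval :: "(real \<times> real) set \<Rightarrow> bool" where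
  "is_oval C \<longleftrightarrow> (\<exists>g. simple_path g \<and> pathfinish g = pathstart g \<and> path_image g = C)"


section \<open>Osculating algebraic curves and extactic points\<close>

definition curve_space_dim :: "nat \<Rightarrow> nat" where
  "curve_space_dim d = d * (d + 3) div 2"

definition osculates ::
    "nat \<Rightarrow> real set \<Rightarrow> (real \<Rightarrow> real \<times> real) \<Rightarrow> real \<Rightarrow> (nat \<Rightarrow> nat \<Rightarrow> real) \<Rightarrow> bool" where
  "osculates d I \<gamma> t a \<longleftrightarrow>
     poly2_nonzero d a \<and> (\<forall>k<curve_space_dim d. nderiv_on I k (\<lambda>s. poly2 d a (\<gamma> s)) t = 0)"

definition hyper_osculates ::
    "nat \<Rightarrow> real set \<Rightarrow> (real \<Rightarrow> real \<times> real) \<Rightarrow> real \<Rightarrow> (nat \<Rightarrow> nat \<Rightarrow> real) \<Rightarrow> bool" where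
  "hyper_osculates d I \<gamma> t a \<longleftrightarrow>
     osculates d I \<gamma> t a \<and> nderiv_on I (curve_space_dim d) (\<lambda>s. poly2 d a (\<gamma> s)) t = 0"

text \<open>At a point that is not extactic, the osculating curve is unique: a pencil of osculating curves
  would have a hyper-osculating member.\<close>

definition extactic :: "nat \<Rightarrow> real set \<Rightarrow> (real \<Rightarrow> real \<times> real) \<Rightarrow> real \<Rightarrow> bool" where
  "extactic d I \<gamma> t \<longleftrightarrow> (\<exists>a. hyper_osculates d I \<gamma> t a)"


section \<open>Osculating fractional-linear transformations\<close>

definition smooth_fun :: "(real \<Rightarrow> real) \<Rightarrow> bool" where
  "smooth_fun f \<longleftrightarrow> (\<forall>k t. (deriv ^^ k) f field_differentiable (at t))"

definition frac_linear :: "real \<Rightarrow> real \<Rightarrow> real \<Rightarrow> real \<Rightarrow> real \<Rightarrow> real" where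
  "frac_linear a b c d x = (a * x + b) / (c * x + d)"

definition osculating_frac_linear ::
    "(real \<Rightarrow> real) \<Rightarrow> real \<Rightarrow> real \<Rightarrow> real \<Rightarrow> real \<Rightarrow> real \<Rightarrow> bool" where
  "osculating_frac_linear f t a b c d \<longleftrightarrow>
     a * d - b * c \<noteq> 0 \<and> c * t + d \<noteq> 0 \<and>
     (\<forall>k\<le>2. (deriv ^^ k) (frac_linear a b c d) t = (deriv ^^ k) f t)"

definition hyperbola_hyper_osculates :: "(real \<Rightarrow> real) \<Rightarrow> real \<Rightarrow> bool" where
  "hyperbola_hyper_osculates f t \<longleftrightarrow>
     (\<exists>a b c d. osculating_frac_linear f t a b c d \<and>
        (deriv ^^ 3) (frac_linear a b c d) t = (deriv ^^ 3) f t)"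

definition osculating_hyperbola :: "(real \<Rightarrow> real) \<Rightarrow> real \<Rightarrow> (real \<times> real) set \<Rightarrow> bool" where
  "osculating_hyperbola f t H \<longleftrightarrow>
     (\<exists>a b c d. osculating_frac_linear f t a b c d \<and>
        H = {(x, frac_linear a b c d x) | x. c * x + d \<noteq> 0})"

text \<open>The vertical asymptote cuts a hyperbola into two branches, and only one of them passes through
  the contact point. The two have to be kept apart: for \<open>f x = (x / (1 + x\<^sup>2) + arctan x) / 2\<close>,
  whose Schwarzian derivative \<open>- 4 / (1 + x\<^sup>2)\<close> vanishes nowhere, the osculating hyperbolas
  at some \<open>s < - 1\<close> and some \<open>0 < t < 1\<close> meet at a point on the line \<open>x = 0\<close>, on the remote
  branch of the first and the contact branch of the second.\<close>

definition contact_branch :: "(real \<Rightarrow> real) \<Rightarrow> real \<Rightarrow> (real \<times> real) set \<Rightarrow> (real \<times> real) set" where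
  "contact_branch f t H = connected_component_set H (t, f t)"

definition remote_branch :: "(real \<Rightarrow> real) \<Rightarrow> real \<Rightarrow> (real \<times> real) set \<Rightarrow> (real \<times> real) set" where
  "remote_branch f t H = H - contact_branch f t H"

end

theory Submission
  imports Defs
begin

text \<open>
  Let \<open>p\<^sub>u\<close> be the equation of the osculating curve of degree \<open>d\<close> at \<open>\<gamma> u\<close>, and let \<open>n = d * (d + 3) / 2\<close>.
  As there are no extactic points, \<open>p\<^sub>u\<close> can be normalised by requiring that the \<open>n\<close>-th derivative of
  \<open>s \<mapsto> p\<^sub>u (\<gamma> s)\<close> at \<open>s = u\<close> is 1. It then depends differentiably on \<open>u\<close>, and its derivative \<open>q\<^sub>u\<close> with respect
  to \<open>u\<close> vanishes along \<open>\<gamma>\<close> to order exactly \<open>n - 1\<close> at \<open>u\<close> (\<open>osculating_family_exists\<close>). This order is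
  4 for conics and 8 for cubics. By Bezout's theorem there is no further intersection of \<open>q\<^sub>u\<close> with the osculating
  conic, and at most one with the osculating cubic; as a closed curve is met an even number of times, that
  one is not on the oval. So \<open>q\<^sub>u\<close> has a constant sign, independent of \<open>u\<close>, on the osculating ellipse or oval
  away from the contact point (\<open>conic_contact_sign\<close>, \<open>oval_contact_sign\<close>).

  Now fix a point \<open>x\<close> and let \<open>u\<close> vary. For conics, \<open>u \<mapsto> p\<^sub>u x\<close> crosses zero in the same direction at each of its
  zeros: if \<open>x \<noteq> \<gamma> u\<close>, by the sign of \<open>q\<^sub>u x\<close>; if \<open>x = \<gamma> u\<close>, because \<open>p\<^sub>r (\<gamma> u)\<close> behaves like
  \<open>(u - r) ^ n / fact n\<close>, with \<open>n\<close> odd. Hence it has at most one zero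
  (\<open>unique_zero_of_one_way_crossing\<close>), which says that no two of the ellipses meet. For cubics the zeros
  at which \<open>x\<close> lies on the infinite branch must be discarded. Project the cubic from its contact point
  \<open>z\<close>: with \<open>L\<close>, \<open>Q\<close>, \<open>C\<close> the homogeneous parts of its equation at \<open>z\<close>, and for a suitable sign of it,
  the discriminant \<open>Q\<^sup>2 - 4 * L * C\<close> is positive in every direction, the oval is contained in the zero set of \<open>2 * L + Q + sqrt (Q\<^sup>2 - 4 * L * C)\<close>, and the rest
  of the cubic belongs to the other sign of the square root (locale \<open>positive_cubic_oval\<close>). Using this
  function instead of \<open>p\<^sub>u x\<close>, the argument goes through. Bezout's theorem and the parity
  argument are carried out by hand in the same projection (locale \<open>cubic_contact\<close>).

  For the hyperbolas, let \<open>g\<^sub>t\<close> be the osculating transformation. For fixed \<open>x\<close>, the derivative of \<open>g\<^sub>t x\<close> with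
  respect to \<open>t\<close> is the Schwarzian derivative times a factor of constant sign that vanishes
  only for \<open>t = x\<close>, so \<open>g\<^sub>t x\<close> is strictly monotone as long as \<open>x\<close> is not the pole of \<open>g\<^sub>t\<close>. If the Schwarzian derivative is positive and \<open>x\<close> lies on the same side of the
  pole for two parameters, contact or remote, then it does so for all parameters in between. If it is
  negative, the inverse transformations have this property. This gives the disjointness of branches of
  the same kind.
\<close>

section \<open>Zeros and signs of continuous functions\<close>

text \<open>The statements on conics and on cubics both end here: a continuous function that
  crosses zero in the same direction at each of its zeros has at most one zero. The factor \<open>\<eta>\<close>
  only matters through its sign, which is the direction of the crossing.\<close>

lemma unique_zero_of_one_way_crossing:
  fixes F :: "real \<Rightarrow> real"
  assumes I: "is_interval I" and cont: "continuous_on I F"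
    and cross: "\<And>u. u \<in> I \<Longrightarrow> F u = 0 \<Longrightarrow> eventually (\<lambda>r. \<eta> * F r * (r - u) > 0) (at u within I)"
    and zeros: "s \<in> I" "t \<in> I" "F s = 0" "F t = 0"
  shows "s = t"
proof -
  have False if st: "s \<in> I" "t \<in> I" "F s = 0" "F t = 0" "s < t" for s t
  proof -
    define G where "G = (\<lambda>r. \<eta> * F r)"
    have sub: "{s..t} \<subseteq> I"
      using mem_is_interval_1_I[OF I st(1,2)] by auto
    obtain d where d: "d > 0" "\<And>r. r \<in> I \<Longrightarrow> r \<noteq> s \<Longrightarrow> dist r s < d \<Longrightarrow> G r * (r - s) > 0"
      using cross[OF st(1,3)] by (auto simp: eventually_at G_def)
    define s1 where "s1 = min (s + d / 2) ((s + t) / 2)"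
    have s1: "s < s1" "s1 < t" "dist s1 s < d"
      using d(1) st(5) by (auto simp: s1_def dist_real_def min_def)
    have "s1 \<in> I" using sub s1 by auto
    hence Gs1: "G s1 > 0"
      using d(2)[of s1] s1 by (auto simp: zero_less_mult_iff)
    hence eta: "\<eta> \<noteq> 0" by (auto simp: G_def)
    have contG: "continuous_on {s1..t} G"
      unfolding G_def using cont sub s1
      by (intro continuous_intros continuous_on_subset[OF cont]) auto
    \<comment> \<open>The function \<open>G\<close> is positive just after \<open>s\<close>; its first zero after that would have to be crossed
      downwards.\<close>
    define A where "A = {u \<in> {s1..t}. G u \<le> 0}"
    have "closed A"
      unfolding A_def by (intro continuous_on_closed_Collect_le contG continuous_intros)
    moreover have "bounded A" by (rule bounded_subset[of "{s1..t}"]) (auto simp: A_def)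
    moreover have "t \<in> A" using st s1 by (auto simp: A_def G_def)
    ultimately obtain u where u: "u \<in> A" "\<And>r. r \<in> A \<Longrightarrow> u \<le> r"
      using compact_attains_inf[of A] compact_eq_bounded_closed by blast
    have us1: "s1 < u" "u \<le> t" using u(1) Gs1 by (auto simp: A_def less_le)
    obtain x where x: "s1 \<le> x" "x \<le> u" "G x = 0"
      using IVT2'[of G u 0 s1] u(1) Gs1 us1 continuous_on_subset[OF contG, of "{s1..u}"]
      by (auto simp: A_def)
    hence "x \<in> A" using us1 by (auto simp: A_def)
    hence "G u = 0" using u(2) x by fastforce
    hence "F u = 0" using eta by (simp add: G_def)
    have "u \<in> I" using sub us1 s1 by auto
    obtain e where e: "e > 0" "\<And>r. r \<in> I \<Longrightarrow> r \<noteq> u \<Longrightarrow> dist r u < e \<Longrightarrow> G r * (r - u) > 0"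
      using cross[OF \<open>u \<in> I\<close> \<open>F u = 0\<close>] by (auto simp: eventually_at G_def)
    define r where "r = max s1 (u - e / 2)"
    have r: "s1 \<le> r" "r < u" "dist r u < e"
      using e(1) us1 by (auto simp: r_def dist_real_def max_def)
    have "r \<in> I" using sub r us1 s1 by auto
    hence "G r * (r - u) > 0" using e(2)[of r] r by auto
    hence "G r < 0" using r by (auto simp: zero_less_mult_iff)
    hence "r \<in> A" using r us1 by (auto simp: A_def)
    thus False using u(2)[of r] r by simp
  qed
  thus ?thesis using zeros by (metis linorder_neqE)
qed

lemma continuous_nonvanishing_same_sign:
  fixes h :: "real \<Rightarrow> real"
  assumes "is_interval I" "continuous_on I h" "\<And>t. t \<in> I \<Longrightarrow> h t \<noteq> 0"
  obtains \<epsilon> :: real where "\<epsilon> = 1 \<or> \<epsilon> = - 1" "\<And>t. t \<in> I \<Longrightarrow> \<epsilon> * h t > 0"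
proof -
  have "is_interval (h ` I)"
    using connected_continuous_image[OF assms(2)] assms(1) by (simp add: is_interval_connected_1)
  moreover have "0 \<notin> h ` I" using assms(3) by auto
  ultimately have "h s > 0 \<longleftrightarrow> h t > 0" if "s \<in> I" "t \<in> I" for s t
    using that mem_is_interval_1_I[of "h ` I" "h s" "h t" 0] mem_is_interval_1_I[of "h ` I" "h t" "h s" 0]
    by (meson imageI linorder_le_less_linear order_less_imp_le)
  hence "(\<forall>t\<in>I. h t > 0) \<or> (\<forall>t\<in>I. h t < 0)"
    using assms(3) by (meson linorder_neqE)
  thus thesis
  proof
    assume "\<forall>t\<in>I. h t > 0" thus thesis using that[of 1] by simp
  next
    assume "\<forall>t\<in>I. h t < 0" thus thesis using that[of "- 1"] by simp
  qed
qed

lemma crossing_from_derivative: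
  fixes f :: "real \<Rightarrow> real"
  assumes "(f has_real_derivative D) (at u within I)" "f u = 0" "c * D > 0"
  shows "eventually (\<lambda>r. c * f r * (r - u) > 0) (at u within I)"
proof -
  have "((\<lambda>r. c * ((f r - f u) / (r - u))) \<longlongrightarrow> c * D) (at u within I)"
    using assms(1) unfolding has_field_derivative_iff by (intro tendsto_mult tendsto_const)
  hence "eventually (\<lambda>r. c * ((f r - f u) / (r - u)) > 0) (at u within I)"
    using assms(3) by (rule order_tendstoD)
  thus ?thesis
  proof (eventually_elim)
    case (elim r)
    have "r - u \<noteq> 0" using elim by auto
    hence "c * f r * (r - u) = c * ((f r - f u) / (r - u)) * (r - u)\<^sup>2"
      using assms(2) by (simp add: power2_eq_square)
    also have "\<dots> > 0" by (rule mult_pos_pos[OF elim]) (use \<open>r - u \<noteq> 0\<close> in simp)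
    finally show ?case .
  qed
qed

lemma crossing_from_odd_order:
  fixes f :: "real \<Rightarrow> real"
  assumes "((\<lambda>r. f r / (u - r) ^ n) \<longlongrightarrow> c) (at u within I)" "odd n" "c > 0"
  shows "eventually (\<lambda>r. - 1 * f r * (r - u) > 0) (at u within I)"
  using order_tendstoD(1)[OF assms(1,3)]
proof eventually_elim
  case (elim r)
  have "n \<noteq> 0" using assms(2) by (cases n) auto
  hence "u - r \<noteq> 0" using elim by (auto simp: power_0_left)
  have ev: "even (Suc n)" using assms(2) by simp
  have "0 < f r / (u - r) ^ n * (u - r) ^ Suc n"
    by (rule mult_pos_pos[OF elim]) (use \<open>u - r \<noteq> 0\<close> ev in \<open>simp only: zero_less_power_eq simp_thms\<close>)
  also have "\<dots> = - 1 * f r * (r - u)"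
    using \<open>u - r \<noteq> 0\<close> by (simp add: algebra_simps)
  finally show ?case .
qed

section \<open>Derivative sequences and Taylor estimates\<close>

text \<open>Smoothness is recorded by a sequence of functions in which each member has the next one as its
  derivative within \<open>I\<close>. Such a sequence makes sense for every set \<open>I\<close>, and its members are the
  iterated derivatives as soon as derivatives within \<open>I\<close> are unique.\<close>

definition deriv_seq :: "real set \<Rightarrow> (nat \<Rightarrow> real \<Rightarrow> real) \<Rightarrow> bool" where
  "deriv_seq I D \<longleftrightarrow> (\<forall>k. \<forall>t\<in>I. (D k has_real_derivative D (Suc k) t) (at t within I))"

lemma interval_at_within_nontrivial:
  fixes t :: real
  assumes "is_interval I" "s0 \<in> I" "t0 \<in> I" "s0 \<noteq> t0" "t \<in> I"
  shows "at t within I \<noteq> bot"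
proof -
  obtain r where r: "r \<in> I" "r \<noteq> t" using assms by blast
  hence "closed_segment t r \<subseteq> I"
    using assms by (simp add: closed_segment_subset is_interval_convex)
  moreover have "t islimpt closed_segment t r"
    using r(2) by (metis connected_imp_perfect connected_segment(1) ends_in_segment(1,2) singletonD)
  ultimately show ?thesis
    using islimpt_subset trivial_limit_within by blast
qed

lemma nderiv_on_Suc: "nderiv_on I (Suc k) f = (\<lambda>t. vector_derivative (nderiv_on I k f) (at t within I))"
  by (simp add: nderiv_on_def)

lemma nderiv_on_eq_deriv_seq:
  assumes nt: "\<And>t. t \<in> I \<Longrightarrow> at t within I \<noteq> bot"
    and D: "deriv_seq I D" and f: "\<And>t. t \<in> I \<Longrightarrow> f t = D 0 t" and t: "t \<in> I"
  shows "nderiv_on I k f t = D k t"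
  using t
proof (induction k arbitrary: t)
  case 0 thus ?case by (simp add: nderiv_on_def f)
next
  case (Suc k)
  have "(D k has_vector_derivative D (Suc k) t) (at t within I)"
    using D Suc.prems by (simp add: deriv_seq_def has_real_derivative_iff_has_vector_derivative)
  hence "(nderiv_on I k f has_vector_derivative D (Suc k) t) (at t within I)"
    by (rule has_vector_derivative_transform[rotated 2]) (use Suc in auto)
  thus ?case
    unfolding nderiv_on_Suc by (rule vector_derivative_within[OF nt[OF Suc.prems]])
qed

lemma deriv_seq_mult:
  assumes "deriv_seq I A" "deriv_seq I B"
  shows "deriv_seq I (\<lambda>k t. \<Sum>i\<le>k. real (k choose i) * (A i t * B (k - i) t))"
  unfolding deriv_seq_def
proof (intro allI ballI)
  fix k t assume t: "t \<in> I"
  have A: "(A i has_real_derivative A (Suc i) t) (at t within I)"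
    and B: "(B i has_real_derivative B (Suc i) t) (at t within I)" for i
    using assms t by (auto simp: deriv_seq_def)
  have "((\<lambda>t. \<Sum>i\<le>k. real (k choose i) * (A i t * B (k - i) t)) has_real_derivative
      (\<Sum>i\<le>k. real (k choose i) * (A (Suc i) t * B (k - i) t + A i t * B (Suc (k - i)) t)))
      (at t within I)"
    by (rule derivative_eq_intros refl A B DERIV_sum DERIV_cmult DERIV_mult)+
       (simp add: algebra_simps)
  also have "(\<Sum>i\<le>k. real (k choose i) * (A (Suc i) t * B (k - i) t + A i t * B (Suc (k - i)) t))
      = (\<Sum>i\<le>k. real (k choose i) * (A (Suc i) t * B (k - i) t))
      + (\<Sum>i\<le>k. real (k choose i) * (A i t * B (Suc k - i) t))"
    by (auto simp: sum.distrib[symmetric] algebra_simps Suc_diff_le intro!: sum.cong)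
  also have "(\<Sum>i\<le>k. real (k choose i) * (A i t * B (Suc k - i) t))
      = A 0 t * B (Suc k) t + (\<Sum>i\<le>k. real (k choose Suc i) * (A (Suc i) t * B (k - i) t))"
  proof -
    have "(\<Sum>i\<le>k. real (k choose i) * (A i t * B (Suc k - i) t))
        = (\<Sum>i\<le>Suc k. real (k choose i) * (A i t * B (Suc k - i) t))"
      by simp
    also have "\<dots> = A 0 t * B (Suc k) t
        + (\<Sum>i\<le>k. real (k choose Suc i) * (A (Suc i) t * B (k - i) t))"
      by (subst sum.atMost_Suc_shift) simp
    finally show ?thesis .
  qed
  also have "(\<Sum>i\<le>k. real (k choose i) * (A (Suc i) t * B (k - i) t)) + (A 0 t * B (Suc k) t
        + (\<Sum>i\<le>k. real (k choose Suc i) * (A (Suc i) t * B (k - i) t)))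
      = A 0 t * B (Suc k) t
        + (\<Sum>i\<le>k. real (Suc k choose Suc i) * (A (Suc i) t * B (k - i) t))"
    by (simp add: sum.distrib algebra_simps)
  also have "\<dots> = (\<Sum>i\<le>Suc k. real (Suc k choose i) * (A i t * B (Suc k - i) t))"
    by (subst sum.atMost_Suc_shift) simp
  finally show "((\<lambda>t. \<Sum>i\<le>k. real (k choose i) * (A i t * B (k - i) t)) has_real_derivative
      (\<Sum>i\<le>Suc k. real (Suc k choose i) * (A i t * B (Suc k - i) t))) (at t within I)" .
qed

lemma deriv_seq_const: "deriv_seq I (\<lambda>k t. if k = 0 then c else 0)"
  by (auto simp: deriv_seq_def)

lemma deriv_seq_power:
  assumes "deriv_seq I A"
  shows "\<exists>D. deriv_seq I D \<and> (\<forall>t. D 0 t = A 0 t ^ n)"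
proof (induction n)
  case 0
  show ?case using deriv_seq_const[of I 1] by auto
next
  case (Suc n)
  then obtain D where "deriv_seq I D" "\<forall>t. D 0 t = A 0 t ^ n" by blast
  thus ?case using deriv_seq_mult[OF assms, of D] by fastforce
qed

lemma deriv_seq_sum:
  assumes "\<And>x. x \<in> X \<Longrightarrow> deriv_seq I (D x)"
  shows "deriv_seq I (\<lambda>k t. \<Sum>x\<in>X. c x * D x k t)"
  unfolding deriv_seq_def
proof (intro allI ballI)
  fix k t assume "t \<in> I"
  thus "((\<lambda>t. \<Sum>x\<in>X. c x * D x k t) has_real_derivative (\<Sum>x\<in>X. c x * D x (Suc k) t)) (at t within I)"
    using assms by (intro DERIV_sum DERIV_cmult) (auto simp: deriv_seq_def)
qed

text \<open>Taylor's formula with the remainder bounded by the deviation of the \<open>n\<close>-th derivative from a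
  constant \<open>c\<close>, which need not be its value at \<open>u\<close>. This makes the estimate uniform in the base
  point \<open>u\<close>, as is needed when the base point tends to a fixed \<open>s\<close>.\<close>

lemma taylor_estimate:
  assumes I: "is_interval I" and D: "deriv_seq I D" and u: "u \<in> I" and s: "s \<in> I"
    and z: "\<And>k. k < n \<Longrightarrow> D k u = 0"
    and e: "\<And>x. x \<in> closed_segment u s \<Longrightarrow> \<bar>D n x - c\<bar> \<le> e"
  shows "\<bar>D 0 s - c * (s - u) ^ n / fact n\<bar> \<le> e * \<bar>s - u\<bar> ^ n"
  using D s z e
proof (induction n arbitrary: D s)
  case 0
  thus ?case by simp
next
  case (Suc n)
  have e0: "e \<ge> 0" using Suc.prems(4)[of u] by fastforce
  have sub: "closed_segment u s \<subseteq> I"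
    using I u Suc.prems by (simp add: closed_segment_subset is_interval_convex)
  have bd: "\<bar>D (Suc 0) x - c * (x - u) ^ n / fact n\<bar> \<le> e * \<bar>s - u\<bar> ^ n"
    if x: "x \<in> closed_segment u s" for x
  proof -
    have seg: "closed_segment u x \<subseteq> closed_segment u s"
      using x by (simp add: subset_closed_segment)
    have "\<bar>D (Suc 0) x - c * (x - u) ^ n / fact n\<bar> \<le> e * \<bar>x - u\<bar> ^ n"
    proof (rule Suc.IH[of "\<lambda>k. D (Suc k)" x])
      show "deriv_seq I (\<lambda>k. D (Suc k))" using Suc.prems(1) by (simp add: deriv_seq_def)
      show "x \<in> I" using x sub by blast
      show "D (Suc k) u = 0" if "k < n" for k using Suc.prems(3) that by simp
      show "\<bar>D (Suc n) y - c\<bar> \<le> e" if "y \<in> closed_segment u x" for y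
        using Suc.prems(4) that seg by blast
    qed
    also have "\<dots> \<le> e * \<bar>s - u\<bar> ^ n"
      using x e0 by (intro mult_left_mono power_mono) (auto simp: closed_segment_eq_real_ivl split: if_splits)
    finally show ?thesis .
  qed
  define g where "g = (\<lambda>x. D 0 x - c * (x - u) ^ Suc n / fact (Suc n))"
  have "(g has_real_derivative D (Suc 0) x - c * (x - u) ^ n / fact n) (at x within closed_segment u s)"
    if x: "x \<in> closed_segment u s" for x
  proof -
    have "(D 0 has_real_derivative D (Suc 0) x) (at x within closed_segment u s)"
      using Suc.prems(1) x sub DERIV_subset unfolding deriv_seq_def by blast
    moreover have "((\<lambda>x. c * (x - u) ^ Suc n / fact (Suc n)) has_real_derivative
        c * (x - u) ^ n / fact n) (at x within closed_segment u s)"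
    proof -
      have "((\<lambda>x. (x - u) ^ Suc n) has_real_derivative real (Suc n) * (x - u) ^ n)
          (at x within closed_segment u s)"
        using DERIV_power[OF DERIV_diff[OF DERIV_ident DERIV_const], where n = "Suc n"] by simp
      from DERIV_cdivide[OF DERIV_cmult[OF this, of c], of "fact (Suc n)"] show ?thesis
        by (simp add: field_simps del: of_nat_Suc power_Suc)
    qed
    ultimately show ?thesis unfolding g_def by (rule DERIV_diff)
  qed
  hence "norm (g s - g u) \<le> e * \<bar>s - u\<bar> ^ n * norm (s - u)"
    using bd by (intro field_differentiable_bound[of "closed_segment u s"]) auto
  moreover have "g u = 0" using Suc.prems(3)[of 0] by (simp add: g_def)
  ultimately show ?case by (simp add: g_def mult_ac)
qed

lemma taylor_limit:
  assumes I: "is_interval I" and D: "deriv_seq I D" and u: "u \<in> I"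
    and z: "\<And>k. k < n \<Longrightarrow> D k u = 0"
  shows "((\<lambda>s. D 0 s / (s - u) ^ n) \<longlongrightarrow> D n u / fact n) (at u within I)"
proof (rule tendstoI)
  fix e :: real assume e: "e > 0"
  have "continuous (at u within I) (D n)"
    using D u by (auto simp: deriv_seq_def intro: DERIV_continuous)
  then obtain d where d: "d > 0" "\<And>x. x \<in> I \<Longrightarrow> dist x u < d \<Longrightarrow> dist (D n x) (D n u) < e / 2"
    unfolding continuous_within_eps_delta using e by (meson half_gt_zero)
  have "dist (D 0 s / (s - u) ^ n) (D n u / fact n) < e"
    if s: "s \<in> I" "s \<noteq> u" "dist s u < d" for s
  proof -
    have "\<bar>D 0 s - D n u * (s - u) ^ n / fact n\<bar> \<le> e / 2 * \<bar>s - u\<bar> ^ n"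
    proof (rule taylor_estimate[OF I D u s(1) z])
      fix x assume x: "x \<in> closed_segment u s"
      hence "x \<in> I" using I u s by (meson closed_segment_subset is_interval_convex subsetD)
      moreover have "dist x u < d"
        using x s(3) by (auto simp: closed_segment_eq_real_ivl dist_real_def split: if_splits)
      ultimately show "\<bar>D n x - D n u\<bar> \<le> e / 2" using d(2)[of x] by (simp add: dist_real_def)
    qed
    moreover have "D 0 s / (s - u) ^ n - D n u / fact n
        = (D 0 s - D n u * (s - u) ^ n / fact n) / (s - u) ^ n"
      using s(2) by (simp add: field_simps)
    ultimately have "\<bar>D 0 s / (s - u) ^ n - D n u / fact n\<bar> \<le> e / 2"
      using s(2) by (simp add: power_abs abs_divide divide_le_eq)
    thus ?thesis using e by (simp add: dist_real_def)
  qed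
  thus "\<forall>\<^sub>F s in at u within I. dist (D 0 s / (s - u) ^ n) (D n u / fact n) < e"
    using d(1) by (auto simp: eventually_at)
qed

section \<open>The normalised family of osculating curves\<close>

lemma differentiable_prod:
  fixes f :: "'i \<Rightarrow> real \<Rightarrow> real"
  assumes "finite X" "\<And>i. i \<in> X \<Longrightarrow> f i differentiable (at u within I)"
  shows "(\<lambda>u. \<Prod>i\<in>X. f i u) differentiable (at u within I)"
  using assms by (induction X rule: finite_induct) auto

lemma differentiable_det:
  fixes B :: "real \<Rightarrow> real^'n^'n"
  assumes "\<And>i j. (\<lambda>u. B u $ i $ j) differentiable (at u within I)"
  shows "(\<lambda>u. det (B u)) differentiable (at u within I)"
  unfolding det_def using assms
  by (intro differentiable_sum differentiable_mult differentiable_const ballI differentiable_prod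
      finite_permutations) auto

text \<open>The vectors of derivatives \<open>(D j k u)\<^sub>j\<close> for \<open>k \<le> n\<close> form an invertible matrix, and \<open>p u\<close> is the
  vector dual to the last of them. Cramer's rule shows that it depends differentiably on \<open>u\<close>;
  differentiating the relations that define \<open>p u\<close> gives those satisfied by its derivative
  \<open>q u\<close>.\<close>

lemma dual_family:
  fixes D :: "'n::finite \<Rightarrow> nat \<Rightarrow> real \<Rightarrow> real"
  assumes nt: "\<And>t. t \<in> I \<Longrightarrow> at t within I \<noteq> bot"
    and der: "\<And>j. deriv_seq I (D j)"
    and N: "CARD('n) = Suc n"
    and ker: "\<And>u c j. u \<in> I \<Longrightarrow> (\<And>k. k \<le> n \<Longrightarrow> (\<Sum>j\<in>UNIV. c j * D j k u) = 0) \<Longrightarrow> c j = 0"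
  obtains p q :: "real \<Rightarrow> 'n \<Rightarrow> real" where
    "\<And>u j. u \<in> I \<Longrightarrow> ((\<lambda>u. p u j) has_real_derivative q u j) (at u within I)"
    "\<And>u k. u \<in> I \<Longrightarrow> k \<le> n \<Longrightarrow> (\<Sum>j\<in>UNIV. p u j * D j k u) = (if k = n then 1 else 0)"
    "\<And>u k. u \<in> I \<Longrightarrow> k < n \<Longrightarrow> (\<Sum>j\<in>UNIV. q u j * D j k u) = (if Suc k = n then - 1 else 0)"
proof -
  obtain r :: "'n \<Rightarrow> nat" where r: "bij_betw r UNIV {..n}"
    using ex_bij_betw_finite_nat[of "UNIV :: 'n set"] N
    by (auto simp: atLeast0LessThan lessThan_Suc_atMost)
  have r_le: "r i \<le> n" for i using bij_betwE[OF r] by auto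
  have r_onto: "\<exists>i. r i = k" if "k \<le> n" for k
    using that bij_betw_imp_surj_on[OF r] by (metis atMost_iff image_iff)
  define A where "A = (\<lambda>u. (\<chi> i j. D j (r i) u) :: real^'n^'n)"
  define e :: "real^'n" where "e = (\<chi> i. if r i = n then 1 else 0)"
  define p where "p = (\<lambda>u j. det (\<chi> i l. if l = j then e $ i else A u $ i $ l) / det (A u))"
  define q where "q = (\<lambda>u j. SOME d. ((\<lambda>u. p u j) has_real_derivative d) (at u within I))"
  have det: "det (A u) \<noteq> 0" if "u \<in> I" for u
  proof -
    have "x = 0" if x: "A u *v x = 0" for x
    proof -
      have "x $ j = 0" for j
      proof (rule ker[OF \<open>u \<in> I\<close>, of "\<lambda>j. x $ j"])
        fix k assume "k \<le> n"
        then obtain i where "r i = k" using r_onto by blast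
        moreover have "(A u *v x) $ i = 0" using x by simp
        ultimately show "(\<Sum>j\<in>UNIV. x $ j * D j k u) = 0"
          by (simp add: matrix_vector_mult_def A_def mult.commute)
      qed
      thus ?thesis by (simp add: vec_eq_iff)
    qed
    thus ?thesis
      by (metis invertible_det_nz invertible_left_inverse matrix_left_invertible_ker)
  qed
  have Dd: "D j k differentiable (at u within I)" if "u \<in> I" for j k u
    using der[of j] that by (auto simp: deriv_seq_def real_differentiable_def)
  have pd: "((\<lambda>u. p u j) has_real_derivative q u j) (at u within I)" if u: "u \<in> I" for u j
  proof -
    have "(\<lambda>u. (\<chi> i l. if l = j then e $ i else A u $ i $ l) $ i $ l) differentiable (at u within I)" for i l
      using Dd[OF u] by (cases "l = j") (auto simp: A_def)
    moreover have "(\<lambda>u. A u $ i $ l) differentiable (at u within I)" for i l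
      using Dd[OF u] by (auto simp: A_def)
    ultimately have "(\<lambda>u. p u j) differentiable (at u within I)"
      unfolding p_def using det[OF u] by (intro differentiable_divide differentiable_det) auto
    hence "\<exists>d. ((\<lambda>u. p u j) has_real_derivative d) (at u within I)"
      by (simp add: real_differentiable_def)
    thus ?thesis unfolding q_def by (rule someI_ex)
  qed
  have sol: "(\<Sum>j\<in>UNIV. p u j * D j k u) = (if k = n then 1 else 0)" if u: "u \<in> I" and k: "k \<le> n" for u k
  proof -
    obtain i where i: "r i = k" using r_onto k by blast
    have "A u *v (\<chi> j. p u j) = e"
      using cramer[OF det[OF u], of "\<chi> j. p u j" e] by (simp add: p_def)
    hence "(A u *v (\<chi> j. p u j)) $ i = e $ i" by simp
    thus ?thesis by (simp add: matrix_vector_mult_def A_def e_def i mult.commute)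
  qed
  have "(\<Sum>j\<in>UNIV. q u j * D j k u) = (if Suc k = n then - 1 else 0)" if u: "u \<in> I" and k: "k < n" for u k
  proof -
    have "((\<lambda>u. \<Sum>j\<in>UNIV. p u j * D j k u) has_real_derivative
        (\<Sum>j\<in>UNIV. p u j * D j (Suc k) u + q u j * D j k u)) (at u within I)"
      using der u by (intro DERIV_sum DERIV_mult' pd) (auto simp: deriv_seq_def)
    moreover have "((\<lambda>u. \<Sum>j\<in>UNIV. p u j * D j k u) has_vector_derivative 0) (at u within I)"
      by (rule has_vector_derivative_transform[where f = "\<lambda>_. 0"]) (use u k in \<open>auto simp: sol\<close>)
    ultimately have "(\<Sum>j\<in>UNIV. p u j * D j (Suc k) u + q u j * D j k u) = 0"
      using vector_derivative_unique_within[OF nt[OF u]]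
      by (auto simp: has_real_derivative_iff_has_vector_derivative)
    thus ?thesis using sol[OF u, of "Suc k"] k by (auto simp: sum.distrib split: if_splits)
  qed
  thus thesis using that pd sol by blast
qed

text \<open>A normalised family of osculating curves \<open>a u\<close> together with its derivative \<open>b u\<close> in \<open>u\<close>. With
  \<open>n = curve_space_dim d\<close>, the polynomial \<open>a u\<close> is scaled such that the \<open>n\<close>-th derivative of its
  restriction to \<open>\<gamma>\<close> at \<open>u\<close> is 1, which is possible at a point that is not extactic. The conditions
  say in turn: \<open>b\<close> is the derivative of \<open>a\<close>; \<open>a u\<close> is an osculating curve, and the only one up to
  the choice of an equation; along \<open>\<gamma>\<close>, \<open>a u\<close> vanishes to order \<open>n\<close> at \<open>u\<close>, and \<open>b u\<close> only to order
  \<open>n - 1\<close>; and the point \<open>\<gamma> u\<close> being fixed, the value of \<open>a s\<close> at it behaves like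
  \<open>(u - s) ^ n / fact n\<close> as \<open>s\<close> tends to \<open>u\<close>.\<close>

definition osculating_family ::
    "nat \<Rightarrow> real set \<Rightarrow> (real \<Rightarrow> real \<times> real) \<Rightarrow> (real \<Rightarrow> nat \<Rightarrow> nat \<Rightarrow> real) \<Rightarrow>
     (real \<Rightarrow> nat \<Rightarrow> nat \<Rightarrow> real) \<Rightarrow> bool" where
  "osculating_family d I \<gamma> a b \<longleftrightarrow> (\<forall>u\<in>I.
     (\<forall>i j. ((\<lambda>u. a u i j) has_real_derivative b u i j) (at u within I)) \<and>
     osculates d I \<gamma> u (a u) \<and>
     (\<forall>c. osculates d I \<gamma> u c \<longrightarrow> alg_curve d c = alg_curve d (a u)) \<and>
     ((\<lambda>s. poly2 d (a u) (\<gamma> s) / (s - u) ^ curve_space_dim d)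
        \<longlongrightarrow> 1 / fact (curve_space_dim d)) (at u within I) \<and>
     ((\<lambda>s. poly2 d (b u) (\<gamma> s) / (s - u) ^ (curve_space_dim d - 1))
        \<longlongrightarrow> - 1 / fact (curve_space_dim d - 1)) (at u within I) \<and>
     ((\<lambda>s. poly2 d (a s) (\<gamma> u) / (u - s) ^ curve_space_dim d)
        \<longlongrightarrow> 1 / fact (curve_space_dim d)) (at u within I))"

lemma poly2_eq_sum_monomials:
  fixes \<beta> :: "'n::finite \<Rightarrow> nat \<times> nat"
  assumes "bij_betw \<beta> UNIV {(i, j). i + j \<le> d}"
  shows "poly2 d a z =
    (\<Sum>k\<in>UNIV. a (fst (\<beta> k)) (snd (\<beta> k)) * (fst z ^ fst (\<beta> k) * snd z ^ snd (\<beta> k)))"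
proof -
  have "(SIGMA i:{..d}. {..d - i}) = {(i, j). i + j \<le> d}" by auto
  hence "poly2 d a z = (\<Sum>(i, j)\<in>{(i, j). i + j \<le> d}. a i j * (fst z ^ i * snd z ^ j))"
    by (simp add: poly2_def sum.Sigma mult.assoc)
  also have "\<dots> = (\<Sum>k\<in>UNIV. case \<beta> k of (i, j) \<Rightarrow> a i j * (fst z ^ i * snd z ^ j))"
    by (rule sum.reindex_bij_betw[OF assms, symmetric])
  finally show ?thesis by (simp add: case_prod_unfold)
qed

lemma smooth_curve_deriv_seqs:
  assumes "smooth_regular_curve I \<gamma>" and nt: "\<And>t. t \<in> I \<Longrightarrow> at t within I \<noteq> bot"
  shows "deriv_seq I (\<lambda>k t. fst (nderiv_on I k \<gamma> t))" "deriv_seq I (\<lambda>k t. snd (nderiv_on I k \<gamma> t))"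
proof -
  have *: "(nderiv_on I k \<gamma> has_vector_derivative nderiv_on I (Suc k) \<gamma> t) (at t within I)"
    if "t \<in> I" for k t
    using assms that by (simp add: smooth_regular_curve_def nderiv_on_Suc vector_derivative_works[symmetric])
  show "deriv_seq I (\<lambda>k t. fst (nderiv_on I k \<gamma> t))" "deriv_seq I (\<lambda>k t. snd (nderiv_on I k \<gamma> t))"
    unfolding deriv_seq_def has_real_derivative_iff_has_vector_derivative
    using * bounded_linear.has_vector_derivative[OF bounded_linear_fst]
      bounded_linear.has_vector_derivative[OF bounded_linear_snd] by blast+
qed

theorem osculating_family_exists:
  fixes \<beta> :: "'n::finite \<Rightarrow> nat \<times> nat"
  assumes \<gamma>: "smooth_regular_curve I \<gamma>" and pts: "s0 \<in> I" "t0 \<in> I" "s0 \<noteq> t0"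
    and ext: "\<And>t. t \<in> I \<Longrightarrow> \<not> extactic d I \<gamma> t"
    and \<beta>: "bij_betw \<beta> UNIV {(i, j). i + j \<le> d}"
    and N: "CARD('n) = Suc (curve_space_dim d)" and d: "curve_space_dim d > 0"
  shows "\<exists>a b. osculating_family d I \<gamma> a b"
proof -
  define n where "n = curve_space_dim d"
  have I: "is_interval I" using \<gamma> by (simp add: smooth_regular_curve_def)
  have nt: "at t within I \<noteq> bot" if "t \<in> I" for t
    using interval_at_within_nontrivial[OF I pts that] .
  have \<beta>_le: "fst (\<beta> k) + snd (\<beta> k) \<le> d" for k
    using bij_betwE[OF \<beta>] by (auto simp: case_prod_unfold)
  have \<beta>_onto: "\<exists>k. \<beta> k = (i, j)" if "i + j \<le> d" for i j
    using bij_betw_imp_surj_on[OF \<beta>] that by (metis (mono_tags, lifting) case_prodI image_iff mem_Collect_eq)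
  have \<beta>_inj: "inj \<beta>" using \<beta> by (simp add: bij_betw_def)
  have "\<exists>D. deriv_seq I D \<and> (\<forall>t. D 0 t = fst (\<gamma> t) ^ fst (\<beta> k) * snd (\<gamma> t) ^ snd (\<beta> k))" for k
  proof -
    note x = deriv_seq_power[OF smooth_curve_deriv_seqs(1)[OF \<gamma> nt], of "fst (\<beta> k)"]
    note y = deriv_seq_power[OF smooth_curve_deriv_seqs(2)[OF \<gamma> nt], of "snd (\<beta> k)"]
    obtain X Y where "deriv_seq I X" "\<forall>t. X 0 t = fst (\<gamma> t) ^ fst (\<beta> k)"
      "deriv_seq I Y" "\<forall>t. Y 0 t = snd (\<gamma> t) ^ snd (\<beta> k)"
      using x y by (auto simp: nderiv_on_def)
    thus ?thesis using deriv_seq_mult[of I X Y] by fastforce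
  qed
  then obtain D where D: "\<And>k. deriv_seq I (D k)"
    and D0: "\<And>k t. D k 0 t = fst (\<gamma> t) ^ fst (\<beta> k) * snd (\<gamma> t) ^ snd (\<beta> k)"
    by metis
  define E where "E = (\<lambda>c k t. \<Sum>j\<in>UNIV. c (\<beta> j) * D j k t)"
  have E: "deriv_seq I (E c)" for c
    unfolding E_def by (rule deriv_seq_sum) (rule D)
  have E0: "poly2 d a (\<gamma> t) = E (\<lambda>(i, j). a i j) 0 t" for a t
    by (simp add: poly2_eq_sum_monomials[OF \<beta>] E_def D0 case_prod_unfold)
  have nd: "nderiv_on I k (\<lambda>s. poly2 d a (\<gamma> s)) t = E (\<lambda>(i, j). a i j) k t" if "t \<in> I" for a k t
    by (rule nderiv_on_eq_deriv_seq[OF nt E E0 that])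
  define coef where "coef = (\<lambda>c i j. if i + j \<le> d then c (inv \<beta> (i, j)) else 0 :: real)"
  have coef: "coef c (fst (\<beta> k)) (snd (\<beta> k)) = c k" for c k
    using \<beta>_le[of k] \<beta>_inj by (simp add: coef_def)
  have E_coef: "E (\<lambda>(i, j). coef c i j) k t = (\<Sum>j\<in>UNIV. c j * D j k t)" for c k t
    by (simp add: E_def coef case_prod_unfold)
  have ker: "c j = 0" if u: "u \<in> I" and z: "\<And>k. k \<le> n \<Longrightarrow> (\<Sum>j\<in>UNIV. c j * D j k u) = 0" for u c j
  proof (rule ccontr)
    assume "c j \<noteq> 0"
    hence "poly2_nonzero d (coef c)"
      unfolding poly2_nonzero_def using coef[of c j] \<beta>_le[of j] by metis
    hence "hyper_osculates d I \<gamma> u (coef c)"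
      using z u by (simp add: hyper_osculates_def osculates_def nd E_coef n_def)
    thus False using ext u by (auto simp: extactic_def)
  qed
  obtain p q where pq: "\<And>u j. u \<in> I \<Longrightarrow> ((\<lambda>u. p u j) has_real_derivative q u j) (at u within I)"
    and p: "\<And>u k. u \<in> I \<Longrightarrow> k \<le> n \<Longrightarrow> (\<Sum>j\<in>UNIV. p u j * D j k u) = (if k = n then 1 else 0)"
    and q: "\<And>u k. u \<in> I \<Longrightarrow> k < n \<Longrightarrow> (\<Sum>j\<in>UNIV. q u j * D j k u) = (if Suc k = n then - 1 else 0)"
    using dual_family[of I D n, OF nt D N[folded n_def]] ker by blast
  define a where "a = (\<lambda>u. coef (p u))"
  define b where "b = (\<lambda>u. coef (q u))"
  have Ea: "E (\<lambda>(i, j). a u i j) k t = (\<Sum>j\<in>UNIV. p u j * D j k t)" for u k t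
    unfolding a_def by (rule E_coef)
  have Eb: "E (\<lambda>(i, j). b u i j) k t = (\<Sum>j\<in>UNIV. q u j * D j k t)" for u k t
    unfolding b_def by (rule E_coef)
  have osc: "osculates d I \<gamma> u (a u)" if u: "u \<in> I" for u
  proof -
    have "\<exists>j. p u j \<noteq> 0" using p[OF u, of n] by (metis (no_types, lifting) mult_zero_left order_refl sum.neutral zero_neq_one)
    then obtain j where "p u j \<noteq> 0" ..
    hence "poly2_nonzero d (a u)"
      unfolding poly2_nonzero_def a_def using coef[of "p u" j] \<beta>_le[of j] by metis
    thus ?thesis using p u by (simp add: osculates_def nd Ea n_def)
  qed
  have uniq: "alg_curve d c = alg_curve d (a u)" if u: "u \<in> I" and c: "osculates d I \<gamma> u c" for u c
  proof -
    define c' where "c' = (\<lambda>j. c (fst (\<beta> j)) (snd (\<beta> j)))"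
    define \<kappa> where "\<kappa> = (\<Sum>j\<in>UNIV. c' j * D j n u)"
    have Ec: "E (\<lambda>(i, j). c i j) k t = (\<Sum>j\<in>UNIV. c' j * D j k t)" for k t
      by (simp add: E_def c'_def case_prod_unfold)
    have diff: "c' j - \<kappa> * p u j = 0" for j
    proof (rule ker[OF u, of "\<lambda>j. c' j - \<kappa> * p u j"])
      fix k assume k: "k \<le> n"
      have "(\<Sum>j\<in>UNIV. c' j * D j k u) = (if k = n then \<kappa> else 0)"
        using c k u by (auto simp: \<kappa>_def osculates_def nd Ec n_def)
      moreover have "(\<Sum>j\<in>UNIV. (c' j - \<kappa> * p u j) * D j k u)
          = (\<Sum>j\<in>UNIV. c' j * D j k u) - \<kappa> * (\<Sum>j\<in>UNIV. p u j * D j k u)"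
        by (simp add: sum_subtractf sum_distrib_left algebra_simps)
      ultimately show "(\<Sum>j\<in>UNIV. (c' j - \<kappa> * p u j) * D j k u) = 0"
        using p[OF u k] by simp
    qed
    have c': "c' j = \<kappa> * p u j" for j using diff[of j] by simp
    have "poly2 d c z = \<kappa> * poly2 d (a u) z" for z
      unfolding poly2_eq_sum_monomials[OF \<beta>] a_def coef c'_def[symmetric]
      using c' by (simp add: c'_def sum_distrib_left mult.assoc)
    moreover have "\<kappa> \<noteq> 0"
    proof
      assume "\<kappa> = 0"
      obtain i j where ij: "i + j \<le> d" "c i j \<noteq> 0"
        using c by (auto simp: osculates_def poly2_nonzero_def)
      then obtain k where "\<beta> k = (i, j)" using \<beta>_onto by blast
      thus False using c'[of k] ij \<open>\<kappa> = 0\<close> by (simp add: c'_def)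
    qed
    ultimately show ?thesis by (simp add: alg_curve_def)
  qed
  have lim_a: "((\<lambda>s. poly2 d (a u) (\<gamma> s) / (s - u) ^ n) \<longlongrightarrow> 1 / fact n) (at u within I)"
    if u: "u \<in> I" for u
    using taylor_limit[OF I E u, of n "\<lambda>(i, j). a u i j"] p[OF u] by (simp add: E0 Ea)
  have lim_b: "((\<lambda>s. poly2 d (b u) (\<gamma> s) / (s - u) ^ (n - 1)) \<longlongrightarrow> - 1 / fact (n - 1)) (at u within I)"
    if u: "u \<in> I" for u
    using taylor_limit[OF I E u, of "n - 1" "\<lambda>(i, j). b u i j"] q[OF u] d by (simp add: E0 Eb n_def)
  have lim_c: "((\<lambda>u. poly2 d (a u) (\<gamma> s) / (s - u) ^ n) \<longlongrightarrow> 1 / fact n) (at s within I)"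
    if s: "s \<in> I" for s
  proof (rule tendstoI)
    fix e :: real assume e: "e > 0"
    have "continuous_on I (\<lambda>u. p u j)" for j
      unfolding continuous_on_eq_continuous_within using pq DERIV_continuous by blast
    moreover have "continuous_on I (D j n)" for j
      unfolding continuous_on_eq_continuous_within
      using D[of j] DERIV_continuous unfolding deriv_seq_def by blast
    ultimately have "continuous_on (I \<times> I) (\<lambda>z. p (fst z) j * D j n (snd z))" for j
      by (intro continuous_on_mult
          continuous_on_compose2[OF _ continuous_on_fst[OF continuous_on_id]]
          continuous_on_compose2[OF _ continuous_on_snd[OF continuous_on_id]]) auto
    hence "continuous_on (I \<times> I) (\<lambda>z. \<Sum>j\<in>UNIV. p (fst z) j * D j n (snd z))"
      by (intro continuous_on_sum)
    from continuous_on_iff[THEN iffD1, rule_format, OF this, of "(s, s)" "e / 2"]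
    obtain \<delta> where \<delta>: "\<delta> > 0" "\<And>z. z \<in> I \<times> I \<Longrightarrow> dist z (s, s) < \<delta> \<Longrightarrow>
        dist (\<Sum>j\<in>UNIV. p (fst z) j * D j n (snd z)) (\<Sum>j\<in>UNIV. p s j * D j n s) < e / 2"
      using s e by auto
    have "dist (poly2 d (a u) (\<gamma> s) / (s - u) ^ n) (1 / fact n) < e"
      if u: "u \<in> I" "u \<noteq> s" "dist u s < \<delta> / 2" for u
    proof -
      have "\<bar>E (\<lambda>(i, j). a u i j) 0 s - 1 * (s - u) ^ n / fact n\<bar> \<le> e / 2 * \<bar>s - u\<bar> ^ n"
      proof (rule taylor_estimate[OF I E u(1) s])
        show "E (\<lambda>(i, j). a u i j) k u = 0" if "k < n" for k
          using p[OF u(1), of k] that by (simp add: Ea)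
        fix x assume x: "x \<in> closed_segment u s"
        have "x \<in> I" using x I u s by (meson closed_segment_subset is_interval_convex subsetD)
        have "dist x s \<le> dist u s"
          using x by (auto simp: closed_segment_eq_real_ivl dist_real_def split: if_splits)
        hence "dist (u, x) (s, s) < \<delta>"
          using sqrt_sum_squares_le_sum[of "dist u s" "dist x s"] u(3) by (simp add: dist_Pair_Pair)
        from \<delta>(2)[OF _ this] show "\<bar>E (\<lambda>(i, j). a u i j) n x - 1\<bar> \<le> e / 2"
          using \<open>x \<in> I\<close> u(1) p[OF s, of n] by (simp add: Ea dist_real_def)
      qed
      moreover have "poly2 d (a u) (\<gamma> s) / (s - u) ^ n - 1 / fact n
          = (E (\<lambda>(i, j). a u i j) 0 s - 1 * (s - u) ^ n / fact n) / (s - u) ^ n"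
        using u(2) by (simp add: E0 field_simps)
      ultimately have "\<bar>poly2 d (a u) (\<gamma> s) / (s - u) ^ n - 1 / fact n\<bar> \<le> e / 2"
        using u(2) by (simp only: abs_divide) (simp add: power_abs divide_le_eq)
      thus ?thesis using e by (simp add: dist_real_def)
    qed
    thus "\<forall>\<^sub>F u in at s within I. dist (poly2 d (a u) (\<gamma> s) / (s - u) ^ n) (1 / fact n) < e"
      using \<delta>(1) by (auto simp: eventually_at intro!: exI[of _ "\<delta> / 2"])
  qed
  have der: "((\<lambda>u. a u i j) has_real_derivative b u i j) (at u within I)" if "u \<in> I" for u i j
    using pq[OF that] by (auto simp: a_def b_def coef_def)
  show ?thesis
    unfolding osculating_family_def n_def[symmetric]
    by (intro exI[of _ a] exI[of _ b] ballI conjI allI impI der osc uniq lim_a lim_b lim_c)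
qed

section \<open>Binary forms along a curve\<close>

text \<open>Binary forms of degree \<open>k\<close>, as functions of two real variables.\<close>

definition hform :: "nat \<Rightarrow> (real \<Rightarrow> real \<Rightarrow> real) \<Rightarrow> bool" where
  "hform k f \<longleftrightarrow> (\<exists>\<rho>. \<forall>X Y. f X Y = (\<Sum>i\<le>k. \<rho> i * X ^ (k - i) * Y ^ i))"

lemma hform_monomial:
  assumes "a + b = k"
  shows "hform k (\<lambda>X Y. c * (X ^ a * Y ^ b))"
proof -
  have "(\<Sum>i\<le>k. (if i = b then c else 0) * X ^ (k - i) * Y ^ i) = c * (X ^ a * Y ^ b)" for X Y :: real
  proof -
    have "(\<Sum>i\<le>k. (if i = b then c else 0) * X ^ (k - i) * Y ^ i)
        = (\<Sum>i\<le>k. if i = b then c * X ^ (k - b) * Y ^ b else 0)"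
      by (rule sum.cong) auto
    thus ?thesis using assms by auto
  qed
  thus ?thesis unfolding hform_def by (intro exI[of _ "\<lambda>i. if i = b then c else 0"]) auto
qed

lemma hform_sum:
  assumes "\<And>x. x \<in> A \<Longrightarrow> hform k (f x)"
  shows "hform k (\<lambda>X Y. \<Sum>x\<in>A. f x X Y)"
proof -
  obtain \<rho> where "\<And>x X Y. x \<in> A \<Longrightarrow> f x X Y = (\<Sum>i\<le>k. \<rho> x i * X ^ (k - i) * Y ^ i)"
    using assms unfolding hform_def by metis
  hence "(\<Sum>x\<in>A. f x X Y) = (\<Sum>i\<le>k. (\<Sum>x\<in>A. \<rho> x i) * X ^ (k - i) * Y ^ i)" for X Y
    by (simp add: sum_distrib_right sum.swap[of _ A])
  thus ?thesis unfolding hform_def by (intro exI[of _ "\<lambda>i. \<Sum>x\<in>A. \<rho> x i"]) auto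
qed

lemma hform_mult:
  assumes "hform k f" "hform l g" "m = k + l"
  shows "hform m (\<lambda>X Y. f X Y * g X Y)"
proof -
  obtain \<rho> \<sigma> where "\<And>X Y. f X Y = (\<Sum>i\<le>k. \<rho> i * X ^ (k - i) * Y ^ i)"
    "\<And>X Y. g X Y = (\<Sum>j\<le>l. \<sigma> j * X ^ (l - j) * Y ^ j)"
    using assms unfolding hform_def by metis
  moreover have "\<rho> i * X ^ (k - i) * Y ^ i * (\<sigma> j * X ^ (l - j) * Y ^ j)
      = (\<rho> i * \<sigma> j) * (X ^ (k - i + (l - j)) * Y ^ (i + j))" for i j and X Y :: real
    by (simp only: power_add mult_ac)
  ultimately have "(\<lambda>X Y. f X Y * g X Y)
      = (\<lambda>X Y. \<Sum>i\<le>k. \<Sum>j\<le>l. (\<rho> i * \<sigma> j) * (X ^ (k - i + (l - j)) * Y ^ (i + j)))"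
    by (simp only: sum_product)
  moreover have "hform m (\<lambda>X Y. \<Sum>i\<le>k. \<Sum>j\<le>l. (\<rho> i * \<sigma> j) * (X ^ (k - i + (l - j)) * Y ^ (i + j)))"
    by (intro hform_sum hform_monomial) (use assms(3) in auto)
  ultimately show ?thesis by simp
qed

lemma hform_cmult:
  assumes "hform k f"
  shows "hform k (\<lambda>X Y. c * f X Y)"
  using hform_mult[OF hform_monomial[of 0 0 0 c] assms] by simp

lemma hform_add:
  assumes "hform k f" "hform k g"
  shows "hform k (\<lambda>X Y. f X Y + g X Y)"
  using hform_sum[of "UNIV :: bool set" k "\<lambda>b. if b then f else g"] assms by (simp add: UNIV_bool add.commute)

lemma hform_diff:
  assumes "hform k f" "hform k g"
  shows "hform k (\<lambda>X Y. f X Y - g X Y)"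
  using hform_add[OF assms(1) hform_cmult[OF assms(2), of "- 1"]] by simp

lemma hform_explicit:
  "hform 1 (\<lambda>X Y. c * Y)"
  "hform 2 (\<lambda>X Y. c0 * X\<^sup>2 + c1 * X * Y + c2 * Y\<^sup>2)"
  "hform 3 (\<lambda>X Y. c0 * X ^ 3 + c1 * X\<^sup>2 * Y + c2 * X * Y\<^sup>2 + c3 * Y ^ 3)"
  using hform_monomial[of 0 1 1 c]
    hform_add[OF hform_add[OF hform_monomial[of 2 0 2 c0] hform_monomial[of 1 1 2 c1]] hform_monomial[of 0 2 2 c2]]
    hform_add[OF hform_add[OF hform_add[OF hform_monomial[of 3 0 3 c0] hform_monomial[of 2 1 3 c1]]
      hform_monomial[of 1 2 3 c2]] hform_monomial[of 0 3 3 c3]]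
  by (simp_all add: mult.assoc)

lemma vanishing_order_mono:
  fixes g \<tau> :: "'a \<Rightarrow> real"
  assumes "((\<lambda>s. g s / \<tau> s ^ n) \<longlongrightarrow> c) F" "m < n" "(\<tau> \<longlongrightarrow> 0) F" "eventually (\<lambda>s. \<tau> s \<noteq> 0) F"
  shows "((\<lambda>s. g s / \<tau> s ^ m) \<longlongrightarrow> 0) F"
proof -
  have "((\<lambda>s. g s / \<tau> s ^ n * \<tau> s ^ (n - m)) \<longlongrightarrow> c * 0 ^ (n - m)) F"
    by (intro tendsto_mult tendsto_power assms)
  moreover have "c * 0 ^ (n - m) = 0" using assms(2) by simp
  ultimately have "((\<lambda>s. g s / \<tau> s ^ n * \<tau> s ^ (n - m)) \<longlongrightarrow> 0) F" by metis
  moreover have "eventually (\<lambda>s. g s / \<tau> s ^ n * \<tau> s ^ (n - m) = g s / \<tau> s ^ m) F"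
    using assms(4) by eventually_elim (use assms(2) in \<open>simp add: power_diff\<close>)
  ultimately show ?thesis by (rule Lim_transform_eventually)
qed

text \<open>Along a curve with \<open>X\<close> of order 1 and \<open>Y\<close> of exact order 2 in \<open>\<tau>\<close>, the monomial \<open>X ^ (k - i) * Y ^ i\<close>
  has order \<open>k + i\<close>. Distinct monomials of a form thus have distinct orders and cannot cancel, so
  the order of vanishing of the form bounds the indices of its nonzero coefficients.\<close>

lemma low_coefficients_vanish:
  fixes X Y \<tau> :: "'a \<Rightarrow> real"
  assumes F: "F \<noteq> bot" and \<tau>: "(\<tau> \<longlongrightarrow> 0) F" "eventually (\<lambda>s. \<tau> s \<noteq> 0) F"
    and x: "((\<lambda>s. X s / \<tau> s) \<longlongrightarrow> x0) F" "x0 \<noteq> 0"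
    and y: "((\<lambda>s. Y s / (\<tau> s)\<^sup>2) \<longlongrightarrow> y0) F" "y0 \<noteq> 0"
    and f: "((\<lambda>s. (\<Sum>i\<le>k. \<rho> i * X s ^ (k - i) * Y s ^ i) / \<tau> s ^ m) \<longlongrightarrow> 0) F"
    and i: "i \<le> k" "k + i \<le> m"
  shows "\<rho> i = (0::real)"
  using i
proof (induction i rule: less_induct)
  case (less i)
  define g where "g = (\<lambda>s. \<Sum>j\<le>k. if j < i then 0
      else \<rho> j * (X s / \<tau> s) ^ (k - j) * (Y s / (\<tau> s)\<^sup>2) ^ j * \<tau> s ^ (j - i))"
  have "(g \<longlongrightarrow> (\<Sum>j\<le>k. if j < i then 0 else \<rho> j * x0 ^ (k - j) * y0 ^ j * 0 ^ (j - i))) F"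
    unfolding g_def
  proof (intro tendsto_sum)
    fix j show "((\<lambda>s. if j < i then 0
      else \<rho> j * (X s / \<tau> s) ^ (k - j) * (Y s / (\<tau> s)\<^sup>2) ^ j * \<tau> s ^ (j - i))
      \<longlongrightarrow> (if j < i then 0 else \<rho> j * x0 ^ (k - j) * y0 ^ j * 0 ^ (j - i))) F"
      by (cases "j < i") (auto intro!: tendsto_intros x y \<tau>)
  qed
  also have "(\<Sum>j\<le>k. if j < i then 0 else \<rho> j * x0 ^ (k - j) * y0 ^ j * 0 ^ (j - i))
      = (\<Sum>j\<le>k. if j = i then \<rho> i * x0 ^ (k - i) * y0 ^ i else 0)"
    by (rule sum.cong) auto
  also have "\<dots> = \<rho> i * x0 ^ (k - i) * y0 ^ i" using less.prems by simp
  finally have lim: "(g \<longlongrightarrow> \<rho> i * x0 ^ (k - i) * y0 ^ i) F" .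
  have "((\<lambda>s. (\<Sum>j\<le>k. \<rho> j * X s ^ (k - j) * Y s ^ j) / \<tau> s ^ m * \<tau> s ^ (m - (k + i)))
      \<longlongrightarrow> 0 * 0 ^ (m - (k + i))) F"
    by (intro tendsto_mult f tendsto_power \<tau>)
  hence "((\<lambda>s. (\<Sum>j\<le>k. \<rho> j * X s ^ (k - j) * Y s ^ j) / \<tau> s ^ m * \<tau> s ^ (m - (k + i)))
      \<longlongrightarrow> 0) F" by simp
  moreover have "eventually (\<lambda>s. (\<Sum>j\<le>k. \<rho> j * X s ^ (k - j) * Y s ^ j) / \<tau> s ^ m * \<tau> s ^ (m - (k + i))
      = g s) F"
    using \<tau>(2)
  proof eventually_elim
    case (elim s)
    have "\<tau> s ^ m = \<tau> s ^ (k + i) * \<tau> s ^ (m - (k + i))"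
      using less.prems by (simp flip: power_add)
    hence "(\<Sum>j\<le>k. \<rho> j * X s ^ (k - j) * Y s ^ j) / \<tau> s ^ m * \<tau> s ^ (m - (k + i))
        = (\<Sum>j\<le>k. \<rho> j * X s ^ (k - j) * Y s ^ j) / \<tau> s ^ (k + i)"
      using elim by simp
    also have "\<dots> = g s"
      unfolding g_def sum_divide_distrib
    proof (rule sum.cong)
      fix j assume "j \<in> {..k}"
      show "\<rho> j * X s ^ (k - j) * Y s ^ j / \<tau> s ^ (k + i) = (if j < i then 0
          else \<rho> j * (X s / \<tau> s) ^ (k - j) * (Y s / (\<tau> s)\<^sup>2) ^ j * \<tau> s ^ (j - i))"
      proof (cases "j < i")
        case True
        thus ?thesis using less.IH[of j] less.prems by simp
      next
        case False
        have "\<tau> s ^ (k - j) * ((\<tau> s)\<^sup>2) ^ j = \<tau> s ^ (k + i) * \<tau> s ^ (j - i)"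
          using False \<open>j \<in> {..k}\<close> by (simp add: add.commute flip: power_add power_mult)
        hence "\<rho> j * X s ^ (k - j) * Y s ^ j / \<tau> s ^ (k + i)
            = \<rho> j * X s ^ (k - j) * Y s ^ j * \<tau> s ^ (j - i) / (\<tau> s ^ (k - j) * ((\<tau> s)\<^sup>2) ^ j)"
          using elim by (simp add: field_simps)
        thus ?thesis using False by (simp add: power_divide)
      qed
    qed simp
    finally show ?case .
  qed
  ultimately have "(g \<longlongrightarrow> 0) F" by (rule Lim_transform_eventually)
  with lim have "\<rho> i * x0 ^ (k - i) * y0 ^ i = 0" using tendsto_unique[OF F] by blast
  thus ?case using x(2) y(2) by simp
qed

section \<open>Two cubics with contact of order eight\<close>

lemma same_sign_if_nonvanishing:
  fixes g :: "real \<Rightarrow> real"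
  assumes "continuous_on {0..1} g" "\<And>t. t \<in> {0..1} \<Longrightarrow> g t \<noteq> 0"
  shows "g 0 * g 1 > 0"
proof (rule ccontr)
  assume neg: "\<not> g 0 * g 1 > 0"
  have "g 0 \<noteq> 0" "g 1 \<noteq> 0" using assms(2) by auto
  with neg consider "g 0 \<le> 0" "0 \<le> g 1" | "g 1 \<le> 0" "0 \<le> g 0"
    by (cases "g 0 > 0"; cases "g 1 > 0") (auto simp: not_less zero_less_mult_iff)
  then obtain t where "t \<in> {0..1}" "g t = 0"
    by cases (use IVT'[of g 0 0 1] IVT2'[of g 1 0 0] assms(1) in auto)
  thus False using assms(2) by blast
qed

text \<open>In coordinates centred at the contact point, with the tangent as the \<open>X\<close>-axis, the osculating
  cubic is \<open>L + Q + C\<close>, split by degree, and its derivative in the family is \<open>Q' + C'\<close>, a multiple of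
  the osculating cubic having been subtracted to remove the linear part. Along the curve \<open>(X, Y)\<close>
  the first vanishes to order more than 8 and the second to order exactly 8.

  A line through the origin in direction \<open>(A, B)\<close> meets the cubic again at the roots \<open>r\<close> of
  \<open>L + r * Q + r\<^sup>2 * C\<close>. The root \<open>r = - 2 * L / S\<close>, with \<open>S\<close> as defined below, lies on the branch
  through the origin, and at that point \<open>Q' + C'\<close> has the sign of \<open>G\<close>. The form \<open>R\<close> of
  degree 7 is, up to a factor, the resultant in \<open>r\<close> of the two cubics divided by \<open>r\<close> and \<open>r\<^sup>2\<close>;
  it equals \<open>G * E / (2 * S)\<close>, where \<open>E\<close> accounts for the intersections with the other branch.
  The contact forces \<open>R = Y ^ 6 * (\<alpha> * X + \<beta> * Y)\<close>, so that only one intersection is left. If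
  \<open>\<alpha> = 0\<close>, it lies on the tangent. Otherwise \<open>E\<close>, which is odd, takes opposite nonzero values at the two ends
  of the tangent, and the remaining intersection is a zero of \<open>E\<close>, not of \<open>G\<close>. Hence \<open>G\<close> has constant
  sign off the tangent.\<close>

locale cubic_contact =
  fixes L Q C Q' C' S G E R :: "real \<Rightarrow> real \<Rightarrow> real"
    and l a0 a1 a2 c0 c1 c2 c3 a0' a1' a2' c0' c1' c2' c3' \<theta> :: real
    and X Y \<tau> :: "real \<Rightarrow> real" and F :: "real filter"
  assumes L: "\<And>X Y. L X Y = l * Y"
    and Q: "\<And>X Y. Q X Y = a0 * X\<^sup>2 + a1 * X * Y + a2 * Y\<^sup>2"
    and C: "\<And>X Y. C X Y = c0 * X ^ 3 + c1 * X\<^sup>2 * Y + c2 * X * Y\<^sup>2 + c3 * Y ^ 3"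
    and Q': "\<And>X Y. Q' X Y = a0' * X\<^sup>2 + a1' * X * Y + a2' * Y\<^sup>2"
    and C': "\<And>X Y. C' X Y = c0' * X ^ 3 + c1' * X\<^sup>2 * Y + c2' * X * Y\<^sup>2 + c3' * Y ^ 3"
    and S_def: "S = (\<lambda>X Y. Q X Y + sqrt ((Q X Y)\<^sup>2 - 4 * L X Y * C X Y))"
    and G_def: "G = (\<lambda>X Y. S X Y * Q' X Y - 2 * L X Y * C' X Y)"
    and E_def: "E = (\<lambda>X Y. 2 * C X Y * Q' X Y - S X Y * C' X Y)"
    and R_def: "R = (\<lambda>X Y. C X Y * (Q' X Y)\<^sup>2 - Q X Y * Q' X Y * C' X Y + L X Y * (C' X Y)\<^sup>2)"
    and l: "l \<noteq> 0" and a0: "a0 > 0" and \<theta>: "\<theta> \<noteq> 0"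
    and disc: "\<And>X Y. (X, Y) \<noteq> (0, 0) \<Longrightarrow> (Q X Y)\<^sup>2 - 4 * L X Y * C X Y > 0"
    and S_pos: "\<And>X Y. (X, Y) \<noteq> (0, 0) \<Longrightarrow> S X Y > 0"
    and F: "F \<noteq> bot" and \<tau>: "(\<tau> \<longlongrightarrow> 0) F" "eventually (\<lambda>s. \<tau> s \<noteq> 0) F"
    and x: "((\<lambda>s. X s / \<tau> s) \<longlongrightarrow> 1) F" and y: "((\<lambda>s. Y s / \<tau> s) \<longlongrightarrow> 0) F"
    and p: "((\<lambda>s. (L (X s) (Y s) + Q (X s) (Y s) + C (X s) (Y s)) / \<tau> s ^ 8) \<longlongrightarrow> 0) F"
    and q: "((\<lambda>s. (Q' (X s) (Y s) + C' (X s) (Y s)) / \<tau> s ^ 8) \<longlongrightarrow> \<theta>) F"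
begin

text \<open>The forms along the curve.\<close>

abbreviation "Lc s \<equiv> L (X s) (Y s)"
abbreviation "Qc s \<equiv> Q (X s) (Y s)"
abbreviation "Cc s \<equiv> C (X s) (Y s)"
abbreviation "Qc' s \<equiv> Q' (X s) (Y s)"
abbreviation "Cc' s \<equiv> C' (X s) (Y s)"
abbreviation "Sc s \<equiv> S (X s) (Y s)"
abbreviation "Gc s \<equiv> G (X s) (Y s)"
abbreviation "Ec s \<equiv> E (X s) (Y s)"
abbreviation "Rc s \<equiv> R (X s) (Y s)"

lemma S_sq: "(A, B) \<noteq> (0, 0) \<Longrightarrow> (S A B)\<^sup>2 = 2 * Q A B * S A B - 4 * L A B * C A B"
  using disc[of A B] unfolding S_def by (simp add: power2_eq_square algebra_simps)

lemma GE:
  assumes "(A, B) \<noteq> (0, 0)"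
  shows "G A B * E A B = 2 * R A B * S A B"
  using S_sq[OF assms] unfolding G_def E_def R_def by algebra

lemma Q_scale: "Q (k * A) (k * B) = k\<^sup>2 * Q A B"
  and L_scale: "L (k * A) (k * B) = k * L A B"
  and C_scale: "C (k * A) (k * B) = k ^ 3 * C A B"
  and Q'_scale: "Q' (k * A) (k * B) = k\<^sup>2 * Q' A B"
  and C'_scale: "C' (k * A) (k * B) = k ^ 3 * C' A B"
  by (simp_all add: Q L C Q' C' algebra_simps power2_eq_square power3_eq_cube)

lemma S_scale: "S (k * A) (k * B) = k\<^sup>2 * S A B"
proof -
  have "(Q (k * A) (k * B))\<^sup>2 - 4 * L (k * A) (k * B) * C (k * A) (k * B)
      = (k\<^sup>2)\<^sup>2 * ((Q A B)\<^sup>2 - 4 * L A B * C A B)"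
    unfolding Q_scale L_scale C_scale by (simp add: algebra_simps power2_eq_square power3_eq_cube)
  hence "sqrt ((Q (k * A) (k * B))\<^sup>2 - 4 * L (k * A) (k * B) * C (k * A) (k * B))
      = k\<^sup>2 * sqrt ((Q A B)\<^sup>2 - 4 * L A B * C A B)"
    by (simp only: real_sqrt_mult real_sqrt_abs abs_power2)
  thus ?thesis unfolding S_def Q_scale by (simp add: algebra_simps)
qed

lemma G_scale: "G (k * A) (k * B) = k ^ 4 * G A B"
  unfolding G_def S_scale Q'_scale L_scale C'_scale by (simp add: algebra_simps eval_nat_numeral)

lemma E_scale: "E (k * A) (k * B) = k ^ 5 * E A B"
  unfolding E_def S_scale Q'_scale C_scale C'_scale by (simp add: algebra_simps eval_nat_numeral)

lemma Q_lim: "((\<lambda>s. Qc s / (\<tau> s)\<^sup>2) \<longlongrightarrow> a0) F"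
  and Q'_lim: "((\<lambda>s. Qc' s / (\<tau> s)\<^sup>2) \<longlongrightarrow> a0') F"
  and C_lim3: "((\<lambda>s. Cc s / (\<tau> s) ^ 3) \<longlongrightarrow> c0) F"
  and C'_lim3: "((\<lambda>s. Cc' s / (\<tau> s) ^ 3) \<longlongrightarrow> c0') F"
proof -
  have quad: "((\<lambda>s. (b0 * (X s)\<^sup>2 + b1 * X s * Y s + b2 * (Y s)\<^sup>2) / (\<tau> s)\<^sup>2) \<longlongrightarrow> b0) F" for b0 b1 b2
  proof -
    have "((\<lambda>s. b0 * (X s / \<tau> s)\<^sup>2 + b1 * (X s / \<tau> s) * (Y s / \<tau> s) + b2 * (Y s / \<tau> s)\<^sup>2)
        \<longlongrightarrow> b0 * 1\<^sup>2 + b1 * 1 * 0 + b2 * 0\<^sup>2) F"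
      by (intro tendsto_intros x y)
    thus ?thesis by (simp add: add_divide_distrib power_divide power2_eq_square)
  qed
  have cub: "((\<lambda>s. (b0 * X s ^ 3 + b1 * (X s)\<^sup>2 * Y s + b2 * X s * (Y s)\<^sup>2 + b3 * Y s ^ 3) / (\<tau> s) ^ 3) \<longlongrightarrow> b0) F"
    for b0 b1 b2 b3
  proof -
    have "((\<lambda>s. b0 * (X s / \<tau> s) ^ 3 + b1 * (X s / \<tau> s)\<^sup>2 * (Y s / \<tau> s) + b2 * (X s / \<tau> s) * (Y s / \<tau> s)\<^sup>2
        + b3 * (Y s / \<tau> s) ^ 3) \<longlongrightarrow> b0 * 1 ^ 3 + b1 * 1\<^sup>2 * 0 + b2 * 1 * 0\<^sup>2 + b3 * 0 ^ 3) F"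
      by (intro tendsto_intros x y)
    thus ?thesis by (simp add: add_divide_distrib power_divide power2_eq_square power3_eq_cube mult_ac)
  qed
  show "((\<lambda>s. Qc s / (\<tau> s)\<^sup>2) \<longlongrightarrow> a0) F" "((\<lambda>s. Qc' s / (\<tau> s)\<^sup>2) \<longlongrightarrow> a0') F"
    "((\<lambda>s. Cc s / (\<tau> s) ^ 3) \<longlongrightarrow> c0) F" "((\<lambda>s. Cc' s / (\<tau> s) ^ 3) \<longlongrightarrow> c0') F"
    unfolding Q Q' C C' by (rule quad quad cub cub)+
qed

lemma C_lim: "((\<lambda>s. Cc s / (\<tau> s)\<^sup>2) \<longlongrightarrow> 0) F"
  and C'_lim: "((\<lambda>s. Cc' s / (\<tau> s)\<^sup>2) \<longlongrightarrow> 0) F"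
  by (rule vanishing_order_mono[OF C_lim3 _ \<tau>] vanishing_order_mono[OF C'_lim3 _ \<tau>], simp)+

lemma L_lim: "((\<lambda>s. Lc s / (\<tau> s)\<^sup>2) \<longlongrightarrow> - a0) F"
proof -
  have "((\<lambda>s. (Lc s + Qc s + Cc s) / (\<tau> s)\<^sup>2
      - Qc s / (\<tau> s)\<^sup>2 - Cc s / (\<tau> s)\<^sup>2) \<longlongrightarrow> 0 - a0 - 0) F"
    by (intro tendsto_diff vanishing_order_mono[OF p _ \<tau>] Q_lim C_lim) simp
  thus ?thesis by (simp add: add_divide_distrib)
qed

lemma y_lim: "((\<lambda>s. Y s / (\<tau> s)\<^sup>2) \<longlongrightarrow> - a0 / l) F"
  using tendsto_divide[OF L_lim tendsto_const l] l by (simp add: L)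

lemma sqrt_lim: "((\<lambda>s. sqrt ((Qc s)\<^sup>2 - 4 * Lc s * Cc s) / (\<tau> s)\<^sup>2) \<longlongrightarrow> a0) F"
proof -
  have "((\<lambda>s. sqrt ((Qc s / (\<tau> s)\<^sup>2)\<^sup>2 - 4 * (Lc s / (\<tau> s)\<^sup>2) * (Cc s / (\<tau> s)\<^sup>2)))
      \<longlongrightarrow> sqrt (a0\<^sup>2 - 4 * (- a0) * 0)) F"
    by (intro tendsto_intros Q_lim L_lim C_lim)
  moreover have "sqrt ((Qc s / (\<tau> s)\<^sup>2)\<^sup>2 - 4 * (Lc s / (\<tau> s)\<^sup>2) * (Cc s / (\<tau> s)\<^sup>2))
      = sqrt ((Qc s)\<^sup>2 - 4 * Lc s * Cc s) / (\<tau> s)\<^sup>2" for s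
  proof -
    have "(Qc s / (\<tau> s)\<^sup>2)\<^sup>2 - 4 * (Lc s / (\<tau> s)\<^sup>2) * (Cc s / (\<tau> s)\<^sup>2)
        = ((Qc s)\<^sup>2 - 4 * Lc s * Cc s) / ((\<tau> s)\<^sup>2)\<^sup>2"
      by (simp add: diff_divide_distrib power_divide power2_eq_square)
    thus ?thesis by (simp only: real_sqrt_divide real_sqrt_abs abs_power2)
  qed
  ultimately show ?thesis using a0 by simp
qed

lemma S_lim: "((\<lambda>s. Sc s / (\<tau> s)\<^sup>2) \<longlongrightarrow> 2 * a0) F"
  using tendsto_add[OF Q_lim sqrt_lim] unfolding S_def by (simp add: add_divide_distrib)

text \<open>The point \<open>(X s, Y s)\<close> is close to the branch through the origin, on which \<open>2 * L + S\<close>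
  vanishes.\<close>

lemma h_lim: "((\<lambda>s. (2 * Lc s + Sc s) / (\<tau> s) ^ 8) \<longlongrightarrow> 0) F"
proof -
  define P where "P = (\<lambda>s. Lc s + Qc s + Cc s)"
  define r where "r = (\<lambda>s. sqrt ((Qc s)\<^sup>2 - 4 * Lc s * Cc s))"
  define U where "U = (\<lambda>s. Qc s + 2 * Cc s)"
  have P: "((\<lambda>s. P s / (\<tau> s) ^ 8) \<longlongrightarrow> 0) F" unfolding P_def by (rule p)
  have "((\<lambda>s. r s / (\<tau> s)\<^sup>2 + (Qc s / (\<tau> s)\<^sup>2 + 2 * (Cc s / (\<tau> s)\<^sup>2)))
      \<longlongrightarrow> a0 + (a0 + 2 * 0)) F"
    unfolding r_def by (intro tendsto_intros sqrt_lim Q_lim C_lim)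
  hence rU: "((\<lambda>s. (r s + U s) / (\<tau> s)\<^sup>2) \<longlongrightarrow> 2 * a0) F"
    by (simp add: U_def add_divide_distrib)
  have "((\<lambda>s. 2 * (P s / (\<tau> s) ^ 8)
      - 4 * (P s / (\<tau> s) ^ 8) * (Cc s / (\<tau> s)\<^sup>2) / ((r s + U s) / (\<tau> s)\<^sup>2))
      \<longlongrightarrow> 2 * 0 - 4 * 0 * 0 / (2 * a0)) F" (is "(?W \<longlongrightarrow> _) F")
    using a0 by (intro tendsto_intros P C_lim rU) auto
  hence "(?W \<longlongrightarrow> 0) F" by simp
  moreover have "eventually (\<lambda>s. ?W s = (2 * Lc s + Sc s) / (\<tau> s) ^ 8) F"
    using order_tendstoD(1)[OF x zero_less_one] order_tendstoD(1)[OF rU, of 0, simplified, OF a0] \<tau>(2)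
  proof eventually_elim
    case (elim s)
    have rU0: "r s + U s \<noteq> 0" and X0: "X s \<noteq> 0" using elim by auto
    have "(r s)\<^sup>2 = (Qc s)\<^sup>2 - 4 * Lc s * Cc s"
      using disc[of "X s" "Y s"] X0 by (simp add: r_def)
    hence "(r s - U s) * (r s + U s) = - 4 * P s * Cc s"
      unfolding U_def P_def by algebra
    hence "- 4 * P s * Cc s / (r s + U s) = r s - U s"
      using rU0 by (simp add: field_simps)
    moreover have "2 * (p / t ^ 8) - 4 * (p / t ^ 8) * (c / t\<^sup>2) / (k / t\<^sup>2)
        = (2 * p + (- 4 * p * c / k)) / t ^ 8" if "t \<noteq> 0" "k \<noteq> 0" for p c k t :: real
      using that by (simp add: field_simps)
    moreover have "2 * Lc s + Sc s = 2 * P s + (r s - U s)"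
      by (simp add: S_def r_def P_def U_def)
    ultimately show ?case using elim(3) rU0 by metis
  qed
  ultimately show ?thesis by (rule Lim_transform_eventually)
qed

lemma q_lim: "((\<lambda>s. (Qc' s + Cc' s) / (\<tau> s)\<^sup>2) \<longlongrightarrow> 0) F"
  by (rule vanishing_order_mono[OF q _ \<tau>]) simp

lemma G_lim: "((\<lambda>s. Gc s / (\<tau> s) ^ 10) \<longlongrightarrow> 2 * a0 * \<theta>) F"
proof -
  have "((\<lambda>s. Sc s / (\<tau> s)\<^sup>2 * ((Qc' s + Cc' s) / (\<tau> s) ^ 8)
      - Cc' s / (\<tau> s)\<^sup>2 * ((2 * Lc s + Sc s) / (\<tau> s) ^ 8))
      \<longlongrightarrow> 2 * a0 * \<theta> - 0 * 0) F" (is "(?W \<longlongrightarrow> _) F")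
    by (intro tendsto_diff tendsto_mult S_lim q C'_lim h_lim)
  hence "(?W \<longlongrightarrow> 2 * a0 * \<theta>) F" by simp
  moreover have "A / t\<^sup>2 * ((B + D) / t ^ 8) - D / t\<^sup>2 * ((2 * M + A) / t ^ 8) = (A * B - 2 * M * D) / t ^ 10"
    for A B D M t :: real
  proof -
    have "t ^ 10 = t\<^sup>2 * t ^ 8" by (simp flip: power_add)
    thus ?thesis by (simp add: algebra_simps flip: diff_divide_distrib)
  qed
  ultimately show ?thesis by (simp add: G_def)
qed

lemma R_lim: "((\<lambda>s. Rc s / (\<tau> s) ^ 12) \<longlongrightarrow> 0) F"
proof -
  define P where "P = (\<lambda>s. Lc s + Qc s + Cc s)"
  define P' where "P' = (\<lambda>s. Qc' s + Cc' s)"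
  have "((\<lambda>s. P' s / (\<tau> s) ^ 8 * ((Cc s / (\<tau> s)\<^sup>2) * (P' s / (\<tau> s)\<^sup>2)
      - 2 * (Cc s / (\<tau> s)\<^sup>2) * (Cc' s / (\<tau> s)\<^sup>2)
      - (Qc s / (\<tau> s)\<^sup>2) * (Cc' s / (\<tau> s)\<^sup>2))
      + P s / (\<tau> s) ^ 8 * (Cc' s / (\<tau> s)\<^sup>2)\<^sup>2)
      \<longlongrightarrow> \<theta> * (0 * 0 - 2 * 0 * 0 - a0 * 0) + 0 * 0\<^sup>2) F" (is "(?W \<longlongrightarrow> _) F")
    unfolding P_def P'_def by (intro tendsto_intros p q q_lim C_lim C'_lim Q_lim)
  moreover have "?W s = Rc s / (\<tau> s) ^ 12" for s
  proof -
    have "P' s / t ^ 8 * ((c / t\<^sup>2) * (P' s / t\<^sup>2) - 2 * (c / t\<^sup>2) * (c' / t\<^sup>2) - (b / t\<^sup>2) * (c' / t\<^sup>2))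
        + P s / t ^ 8 * (c' / t\<^sup>2)\<^sup>2
        = (P' s * (c * P' s - 2 * c * c' - b * c') + P s * c'\<^sup>2) / t ^ 12" for b c c' t
    proof -
      have "t ^ 12 = t ^ 8 * (t\<^sup>2 * t\<^sup>2)" by (simp flip: power_add)
      thus ?thesis
        by (simp add: power2_eq_square[of "c' / _"] power2_eq_square[of c'] algebra_simps
            flip: diff_divide_distrib add_divide_distrib)
    qed
    moreover have "P' s * (Cc s * P' s - 2 * Cc s * Cc' s
        - Qc s * Cc' s) + P s * (Cc' s)\<^sup>2 = Rc s"
      unfolding P_def P'_def R_def by algebra
    ultimately show ?thesis by simp
  qed
  ultimately show ?thesis by simp
qed

lemma hforms: "hform 1 L" "hform 2 Q" "hform 3 C" "hform 2 Q'" "hform 3 C'"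
proof -
  have "L = (\<lambda>X Y. l * Y)" "Q = (\<lambda>X Y. a0 * X\<^sup>2 + a1 * X * Y + a2 * Y\<^sup>2)"
    "C = (\<lambda>X Y. c0 * X ^ 3 + c1 * X\<^sup>2 * Y + c2 * X * Y\<^sup>2 + c3 * Y ^ 3)"
    "Q' = (\<lambda>X Y. a0' * X\<^sup>2 + a1' * X * Y + a2' * Y\<^sup>2)"
    "C' = (\<lambda>X Y. c0' * X ^ 3 + c1' * X\<^sup>2 * Y + c2' * X * Y\<^sup>2 + c3' * Y ^ 3)"
    by (intro ext L Q C Q' C')+
  thus "hform 1 L" "hform 2 Q" "hform 3 C" "hform 2 Q'" "hform 3 C'"
    by (simp_all only: hform_explicit)
qed

text \<open>Along the curve \<open>R\<close> vanishes to order more than 12, since it is a combination of \<open>L + Q + C\<close>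
  and \<open>Q' + C'\<close> with coefficients that vanish to order at least 5.\<close>

lemma R_factor:
  obtains \<alpha> \<beta> where "\<And>X Y. R X Y = Y ^ 6 * (\<alpha> * X + \<beta> * Y)"
proof -
  have "hform 7 (\<lambda>X Y. C X Y * (Q' X Y * Q' X Y))"
    by (rule hform_mult[OF hforms(3) hform_mult[OF hforms(4) hforms(4) refl]]) simp
  moreover have "hform 7 (\<lambda>X Y. Q X Y * (Q' X Y * C' X Y))"
    by (rule hform_mult[OF hforms(2) hform_mult[OF hforms(4) hforms(5) refl]]) simp
  moreover have "hform 7 (\<lambda>X Y. L X Y * (C' X Y * C' X Y))"
    by (rule hform_mult[OF hforms(1) hform_mult[OF hforms(5) hforms(5) refl]]) simp
  ultimately have "hform 7 (\<lambda>X Y. C X Y * (Q' X Y * Q' X Y) - Q X Y * (Q' X Y * C' X Y) + L X Y * (C' X Y * C' X Y))"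
    by (intro hform_add hform_diff)
  then obtain \<rho> where \<rho>: "\<And>X Y. R X Y = (\<Sum>i\<le>7. \<rho> i * X ^ (7 - i) * Y ^ i)"
    unfolding hform_def R_def power2_eq_square by (auto simp: mult.assoc)
  have "\<rho> i = 0" if "i \<le> 5" for i
    by (rule low_coefficients_vanish[OF F \<tau> x _ y_lim _ R_lim[unfolded \<rho>]]) (use that a0 l in auto)
  hence "R X Y = Y ^ 6 * (\<rho> 6 * X + \<rho> 7 * Y)" for X Y
    unfolding \<rho> by (simp add: eval_nat_numeral algebra_simps)
  thus thesis using that by blast
qed

text \<open>If \<open>R\<close> vanished identically, then \<open>E\<close> would vanish wherever \<open>G\<close> does not, and there \<open>G\<close> would agree
  with a form of degree 4. But a nonzero form of degree 4 vanishes along the curve to order at most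
  8, while \<open>G\<close> vanishes to order 10.\<close>

lemma R_nonzero: "\<exists>X Y. R X Y \<noteq> 0"
proof (rule ccontr)
  assume "\<not> ?thesis"
  hence R0: "R X Y = 0" for X Y by simp
  define T where "T = (\<lambda>X Y. Q X Y * Q' X Y - 2 * (L X Y * C' X Y))"
  have "hform 4 T"
  proof -
    have "hform 4 (\<lambda>X Y. Q X Y * Q' X Y)" "hform 4 (\<lambda>X Y. L X Y * C' X Y)"
      by (rule hform_mult[OF hforms(2) hforms(4)] hform_mult[OF hforms(1) hforms(5)], simp)+
    thus ?thesis unfolding T_def by (intro hform_diff hform_cmult)
  qed
  then obtain \<rho> where \<rho>: "\<And>X Y. T X Y = (\<Sum>i\<le>4. \<rho> i * X ^ (4 - i) * Y ^ i)"
    unfolding hform_def by blast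
  have nz: "eventually (\<lambda>s. Gc s \<noteq> 0 \<and> (X s, Y s) \<noteq> (0, 0)) F"
  proof -
    have "eventually (\<lambda>s. X s / \<tau> s > 0) F" using order_tendstoD(1)[OF x, of 0] by simp
    moreover have "eventually (\<lambda>s. Gc s / (\<tau> s) ^ 10 \<noteq> 0) F"
      using tendsto_imp_eventually_ne[OF G_lim, of 0] a0 \<theta> by simp
    ultimately show ?thesis by eventually_elim auto
  qed
  have GT: "G A B = 2 * T A B" if "G A B \<noteq> 0" "(A, B) \<noteq> (0, 0)" for A B
  proof -
    have "E A B = 0" using GE[OF that(2)] R0 that(1) by simp
    hence "S A B * (G A B - 2 * T A B) = 0"
      using S_sq[OF that(2)] unfolding E_def G_def T_def by algebra
    thus ?thesis using S_pos[OF that(2)] by simp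
  qed
  have "((\<lambda>s. Gc s / (\<tau> s) ^ 10 * (\<tau> s)\<^sup>2 / 2) \<longlongrightarrow> 2 * a0 * \<theta> * 0\<^sup>2 / 2) F"
    by (intro tendsto_intros G_lim \<tau>) simp
  hence "((\<lambda>s. Gc s / (\<tau> s) ^ 10 * (\<tau> s)\<^sup>2 / 2) \<longlongrightarrow> 0) F" by simp
  moreover have "eventually (\<lambda>s. Gc s / (\<tau> s) ^ 10 * (\<tau> s)\<^sup>2 / 2 = T (X s) (Y s) / (\<tau> s) ^ 8) F"
    using nz \<tau>(2)
  proof eventually_elim
    case (elim s)
    have "g / t ^ 10 * t\<^sup>2 / 2 = (g / 2) / t ^ 8" if "t \<noteq> 0" for g t :: real
      using that by (simp add: field_simps eval_nat_numeral)
    thus ?case using GT[of "X s" "Y s"] elim by simp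
  qed
  ultimately have T_lim: "((\<lambda>s. T (X s) (Y s) / (\<tau> s) ^ 8) \<longlongrightarrow> 0) F"
    by (rule Lim_transform_eventually)
  have "\<rho> i = 0" if "i \<le> 4" for i
    by (rule low_coefficients_vanish[OF F \<tau> x _ y_lim _ T_lim[unfolded \<rho>]]) (use that a0 l in auto)
  hence "T X Y = 0" for X Y unfolding \<rho> by simp
  hence "eventually (\<lambda>s. False) F" by (intro eventually_mono[OF nz]) (use GT in auto)
  thus False using F by simp
qed

lemma E_lim: "((\<lambda>s. Ec s / (\<tau> s) ^ 5) \<longlongrightarrow> E 1 0) F"
proof -
  have "((\<lambda>s. 2 * (Cc s / (\<tau> s) ^ 3) * (Qc' s / (\<tau> s)\<^sup>2)
      - Sc s / (\<tau> s)\<^sup>2 * (Cc' s / (\<tau> s) ^ 3)) \<longlongrightarrow> 2 * c0 * a0' - 2 * a0 * c0') F"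
    by (intro tendsto_intros C_lim3 Q'_lim S_lim C'_lim3)
  moreover have "2 * c0 * a0' - 2 * a0 * c0' = E 1 0"
    using a0 by (simp add: E_def S_def L Q C Q' C')
  moreover have "2 * (c / t ^ 3) * (b / t\<^sup>2) - g / t\<^sup>2 * (d / t ^ 3) = (2 * c * b - g * d) / t ^ 5"
    for b c d g t :: real
    by (simp add: diff_divide_distrib eval_nat_numeral)
  ultimately show ?thesis by (simp add: E_def)
qed

lemma G_nonzero:
  assumes B: "B \<noteq> 0"
  shows "G A B \<noteq> 0"
proof
  assume G0: "G A B = 0"
  obtain \<alpha> \<beta> where R: "\<And>X Y. R X Y = Y ^ 6 * (\<alpha> * X + \<beta> * Y)" using R_factor by blast
  have "R A B * S A B = 0" using GE[of A B] G0 B by simp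
  hence zero: "\<alpha> * A + \<beta> * B = 0" using S_pos[of A B] B by (simp add: R)
  have \<alpha>: "\<alpha> \<noteq> 0"
  proof
    assume "\<alpha> = 0"
    hence "\<beta> = 0" using zero B by simp
    thus False using R_nonzero \<open>\<alpha> = 0\<close> by (simp add: R)
  qed
  have E10: "E 1 0 \<noteq> 0"
  proof -
    have "((\<lambda>s. 2 * ((Y s / (\<tau> s)\<^sup>2) ^ 6 * (\<alpha> * (X s / \<tau> s) + \<beta> * (Y s / \<tau> s))) * (Sc s / (\<tau> s)\<^sup>2))
        \<longlongrightarrow> 2 * ((- a0 / l) ^ 6 * (\<alpha> * 1 + \<beta> * 0)) * (2 * a0)) F"
      by (intro tendsto_intros x y y_lim S_lim)
    moreover have "eventually (\<lambda>s. 2 * ((Y s / (\<tau> s)\<^sup>2) ^ 6 * (\<alpha> * (X s / \<tau> s) + \<beta> * (Y s / \<tau> s)))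
        * (Sc s / (\<tau> s)\<^sup>2) = Gc s / (\<tau> s) ^ 10 * (Ec s / (\<tau> s) ^ 5)) F"
      using \<tau>(2) order_tendstoD(1)[OF x zero_less_one]
    proof eventually_elim
      case (elim s)
      have "2 * ((b / t\<^sup>2) ^ 6 * (\<alpha> * (a / t) + \<beta> * (b / t))) * (g / t\<^sup>2)
          = 2 * (b ^ 6 * (\<alpha> * a + \<beta> * b)) * g / (t ^ 10 * t ^ 5)" for a b g t
      proof -
        have "2 * ((b / t\<^sup>2) ^ 6 * (c / t)) * (g / t\<^sup>2) = 2 * (b ^ 6 * c) * g / ((t\<^sup>2) ^ 6 * t * t\<^sup>2)" for c
          by (simp add: power_divide)
        moreover have "(t\<^sup>2) ^ 6 * t * t\<^sup>2 = t ^ 10 * t ^ 5"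
          by (simp add: eval_nat_numeral)
        moreover have "\<alpha> * (a / t) + \<beta> * (b / t) = (\<alpha> * a + \<beta> * b) / t"
          by (simp add: add_divide_distrib)
        ultimately show ?thesis by simp
      qed
      moreover have "Gc s * Ec s = 2 * Rc s * Sc s"
        using elim by (intro GE) auto
      ultimately show ?case by (simp add: R)
    qed
    ultimately have "((\<lambda>s. Gc s / (\<tau> s) ^ 10 * (Ec s / (\<tau> s) ^ 5))
        \<longlongrightarrow> 2 * ((- a0 / l) ^ 6 * (\<alpha> * 1 + \<beta> * 0)) * (2 * a0)) F"
      by (rule Lim_transform_eventually)
    moreover have "((\<lambda>s. Gc s / (\<tau> s) ^ 10 * (Ec s / (\<tau> s) ^ 5))
        \<longlongrightarrow> 2 * a0 * \<theta> * E 1 0) F"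
      by (intro tendsto_mult G_lim E_lim)
    ultimately have "2 * ((- a0 / l) ^ 6 * (\<alpha> * 1 + \<beta> * 0)) * (2 * a0) = 2 * a0 * \<theta> * E 1 0"
      using tendsto_unique[OF F] by blast
    thus ?thesis using a0 l \<alpha> by auto
  qed
  \<comment> \<open>\<open>E\<close> is odd, so it vanishes somewhere on the upper half circle.\<close>
  have "continuous_on {0..pi} (\<lambda>t. E (cos t) (sin t))"
    unfolding E_def S_def L Q C Q' C' by (intro continuous_intros)
  moreover have "E (cos pi) (sin pi) = - E 1 0"
    using E_scale[of "- 1" 1 0] by simp
  ultimately obtain t where t: "0 \<le> t" "t \<le> pi" "E (cos t) (sin t) = 0"
    using IVT'[of "\<lambda>t. E (cos t) (sin t)" 0 0 pi] IVT2'[of "\<lambda>t. E (cos t) (sin t)" pi 0 0] pi_ge_zero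
    by (cases "E 1 0 \<ge> 0") auto
  define A1 B1 where "A1 = cos t" and "B1 = sin t"
  have "t \<noteq> 0" "t \<noteq> pi" using t(3) E10 \<open>E (cos pi) (sin pi) = - E 1 0\<close> by auto
  hence B1: "B1 > 0" using t sin_gt_zero[of t] by (simp add: B1_def)
  have E0: "E A1 B1 = 0" using t(3) by (simp add: A1_def B1_def)
  have "R A1 B1 * S A1 B1 = 0" using GE[of A1 B1] E0 B1 by simp
  hence zero1: "\<alpha> * A1 + \<beta> * B1 = 0" using S_pos[of A1 B1] B1 by (simp add: R)
  have "G A1 B1 = 0"
  proof -
    have "A1 = B1 / B * A" "B1 = B1 / B * B"
      using zero zero1 \<alpha> B by (simp_all add: field_simps) algebra
    hence "G A1 B1 = (B1 / B) ^ 4 * G A B" using G_scale[of "B1 / B" A B] by simp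
    thus ?thesis using G0 by simp
  qed
  have S1: "S A1 B1 > 0" and D1: "(Q A1 B1)\<^sup>2 - 4 * L A1 B1 * C A1 B1 > 0"
    using S_pos[of A1 B1] disc[of A1 B1] B1 by auto
  \<comment> \<open>If both \<open>G\<close> and \<open>E\<close> vanished there, then so would \<open>Q'\<close> and \<open>C'\<close>, and \<open>R\<close>, quadratic in the two,
    would have a double zero, contrary to its factorisation.\<close>
  have "S A1 B1 * Q' A1 B1 * (S A1 B1 - Q A1 B1) = 0"
    using \<open>G A1 B1 = 0\<close> E0 S_sq[of A1 B1] B1 unfolding G_def E_def by simp algebra
  moreover have "S A1 B1 - Q A1 B1 > 0" using D1 by (simp add: S_def)
  ultimately have Q0: "Q' A1 B1 = 0" using S1 by simp
  hence C0: "C' A1 B1 = 0" using E0 S1 by (simp add: E_def)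
  obtain dC dQ dQ' dC' where d: "((\<lambda>a. C a B1) has_real_derivative dC) (at A1)"
    "((\<lambda>a. Q a B1) has_real_derivative dQ) (at A1)"
    "((\<lambda>a. Q' a B1) has_real_derivative dQ') (at A1)"
    "((\<lambda>a. C' a B1) has_real_derivative dC') (at A1)"
  proof (rule that)
    show "((\<lambda>a. C a B1) has_real_derivative (3 * c0 * A1\<^sup>2 + 2 * c1 * A1 * B1 + c2 * B1\<^sup>2)) (at A1)"
      unfolding C by (auto intro!: derivative_eq_intros simp: algebra_simps)
    show "((\<lambda>a. Q a B1) has_real_derivative (2 * a0 * A1 + a1 * B1)) (at A1)"
      unfolding Q by (auto intro!: derivative_eq_intros simp: algebra_simps)
    show "((\<lambda>a. Q' a B1) has_real_derivative (2 * a0' * A1 + a1' * B1)) (at A1)"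
      unfolding Q' by (auto intro!: derivative_eq_intros simp: algebra_simps)
    show "((\<lambda>a. C' a B1) has_real_derivative (3 * c0' * A1\<^sup>2 + 2 * c1' * A1 * B1 + c2' * B1\<^sup>2)) (at A1)"
      unfolding C' by (auto intro!: derivative_eq_intros simp: algebra_simps)
  qed
  have "((\<lambda>a. R a B1) has_real_derivative 0) (at A1)"
    unfolding R_def L by (rule derivative_eq_intros d refl)+ (simp add: Q0 C0)
  moreover have "((\<lambda>a. R a B1) has_real_derivative B1 ^ 6 * \<alpha>) (at A1)"
    unfolding R by (auto intro!: derivative_eq_intros)
  ultimately have "B1 ^ 6 * \<alpha> = 0" using DERIV_unique by blast
  thus False using B1 \<alpha> by simp
qed

lemma G_sign:
  assumes B: "B \<noteq> 0"
  shows "\<theta> * G A B > 0"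
proof -
  have "eventually (\<lambda>s. \<theta> * (Gc s / (\<tau> s) ^ 10) > 0) F"
  proof (rule order_tendstoD(1)[OF tendsto_mult[OF tendsto_const G_lim]])
    have eq: "\<theta> * (2 * a0 * \<theta>) = 2 * a0 * \<theta>\<^sup>2" by (simp add: power2_eq_square)
    show "0 < \<theta> * (2 * a0 * \<theta>)" unfolding eq using a0 \<theta> by simp
  qed
  moreover have "eventually (\<lambda>s. Y s / (\<tau> s)\<^sup>2 \<noteq> 0) F"
    using tendsto_imp_eventually_ne[OF y_lim, of 0] a0 l by simp
  ultimately have "eventually (\<lambda>s. \<theta> * Gc s > 0 \<and> Y s \<noteq> 0) F"
    using \<tau>(2) by eventually_elim (auto simp: zero_less_mult_iff zero_less_divide_iff)
  then obtain s where s: "\<theta> * Gc s > 0" "Y s \<noteq> 0"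
    using F eventually_happens by blast
  have sgn: "\<theta> * G A B > 0" if B: "B * Y s > 0" for A B
  proof -
    define g where "g = (\<lambda>t. G ((1 - t) * X s + t * A) ((1 - t) * Y s + t * B))"
    have "continuous_on {0..1} g"
      unfolding g_def G_def S_def L Q C Q' C' by (intro continuous_intros)
    moreover have "g t \<noteq> 0" if "t \<in> {0..1}" for t
    proof -
      have "((1 - t) * Y s + t * B) * Y s > 0"
      proof (cases "t = 0")
        case True thus ?thesis using s(2) by (auto simp: zero_less_mult_iff)
      next
        case False
        have "((1 - t) * Y s + t * B) * Y s = (1 - t) * (Y s)\<^sup>2 + t * (B * Y s)"
          by (simp add: algebra_simps power2_eq_square)
        moreover have "t * (B * Y s) > 0" "(1 - t) * (Y s)\<^sup>2 \<ge> 0" using False B that by auto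
        ultimately show ?thesis by simp
      qed
      hence "(1 - t) * Y s + t * B \<noteq> 0" by auto
      thus ?thesis unfolding g_def by (rule G_nonzero)
    qed
    ultimately have "g 0 * g 1 > 0" by (rule same_sign_if_nonvanishing)
    thus ?thesis using s(1) by (auto simp: g_def zero_less_mult_iff)
  qed
  show ?thesis
  proof (cases "B * Y s > 0")
    case True
    thus ?thesis by (rule sgn)
  next
    case False
    hence "(- B) * Y s > 0" using B s(2) by (auto simp: zero_less_mult_iff mult_less_0_iff)
    from sgn[OF this, of "- A"] show ?thesis using G_scale[of "- 1" A B] by simp
  qed
qed

lemma contact_sign:
  assumes "(A, B) \<noteq> (0, 0)" and h: "2 * L A B + S A B = 0"
  shows "\<theta> * (Q' A B + C' A B) > 0"
proof -
  have S: "S A B > 0" using S_pos assms(1) .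
  hence "B \<noteq> 0" using h by (auto simp: L)
  moreover have "G A B = S A B * (Q' A B + C' A B)"
    using h unfolding G_def by algebra
  ultimately have "S A B * (\<theta> * (Q' A B + C' A B)) > 0"
    using G_sign[of B A] by (simp add: mult_ac)
  thus ?thesis using S by (simp add: zero_less_mult_iff)
qed

end

section \<open>Ovals of real cubics\<close>

text \<open>The homogeneous parts of the Taylor expansion of a cubic polynomial at \<open>z\<close>. The cubic part does
  not depend on \<open>z\<close>.\<close>

definition poly3_lin :: "(nat \<Rightarrow> nat \<Rightarrow> real) \<Rightarrow> real \<times> real \<Rightarrow> real \<times> real \<Rightarrow> real" where
  "poly3_lin a z w =
     (a 1 0 + 2 * a 2 0 * fst z + a 1 1 * snd z
       + 3 * a 3 0 * (fst z)\<^sup>2 + 2 * a 2 1 * fst z * snd z + a 1 2 * (snd z)\<^sup>2) * fst w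
   + (a 0 1 + a 1 1 * fst z + 2 * a 0 2 * snd z
       + a 2 1 * (fst z)\<^sup>2 + 2 * a 1 2 * fst z * snd z + 3 * a 0 3 * (snd z)\<^sup>2) * snd w"

definition poly3_quad :: "(nat \<Rightarrow> nat \<Rightarrow> real) \<Rightarrow> real \<times> real \<Rightarrow> real \<times> real \<Rightarrow> real" where
  "poly3_quad a z w =
     (a 2 0 + 3 * a 3 0 * fst z + a 2 1 * snd z) * (fst w)\<^sup>2
   + (a 1 1 + 2 * a 2 1 * fst z + 2 * a 1 2 * snd z) * fst w * snd w
   + (a 0 2 + a 1 2 * fst z + 3 * a 0 3 * snd z) * (snd w)\<^sup>2"

definition poly3_cub :: "(nat \<Rightarrow> nat \<Rightarrow> real) \<Rightarrow> real \<times> real \<Rightarrow> real" where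
  "poly3_cub a w = a 3 0 * fst w ^ 3 + a 2 1 * (fst w)\<^sup>2 * snd w + a 1 2 * fst w * (snd w)\<^sup>2 + a 0 3 * snd w ^ 3"

text \<open>For a point \<open>z\<close> of the cubic, the line through \<open>z\<close> in direction \<open>w\<close> meets the cubic again at
  the points \<open>z + r *\<^sub>R w\<close> with \<open>lin + r * quad + r\<^sup>2 * cub = 0\<close>; this is the discriminant of that
  equation, and \<open>- 2 * lin / poly3_S\<close> is one of its roots.\<close>

definition poly3_disc :: "(nat \<Rightarrow> nat \<Rightarrow> real) \<Rightarrow> real \<times> real \<Rightarrow> real \<times> real \<Rightarrow> real" where
  "poly3_disc a z w = (poly3_quad a z w)\<^sup>2 - 4 * poly3_lin a z w * poly3_cub a w"

definition poly3_S :: "(nat \<Rightarrow> nat \<Rightarrow> real) \<Rightarrow> real \<times> real \<Rightarrow> real \<times> real \<Rightarrow> real" where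
  "poly3_S a z w = poly3_quad a z w + sqrt (poly3_disc a z w)"

lemma poly3_explicit:
  "poly2 3 a z = a 0 0 + a 1 0 * fst z + a 0 1 * snd z
     + a 2 0 * (fst z)\<^sup>2 + a 1 1 * fst z * snd z + a 0 2 * (snd z)\<^sup>2
     + a 3 0 * fst z ^ 3 + a 2 1 * (fst z)\<^sup>2 * snd z + a 1 2 * fst z * (snd z)\<^sup>2 + a 0 3 * snd z ^ 3"
  by (simp add: poly2_def eval_nat_numeral)

lemma poly3_add:
  "poly2 3 a (z + w) = poly2 3 a z + poly3_lin a z w + poly3_quad a z w + poly3_cub a w"
  unfolding poly3_explicit poly3_lin_def poly3_quad_def poly3_cub_def
  by (simp add: power2_eq_square power3_eq_cube algebra_simps)

lemma poly3_lin_scale: "poly3_lin a z (r *\<^sub>R w) = r * poly3_lin a z w"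
  and poly3_quad_scale: "poly3_quad a z (r *\<^sub>R w) = r\<^sup>2 * poly3_quad a z w"
  and poly3_cub_scale: "poly3_cub a (r *\<^sub>R w) = r ^ 3 * poly3_cub a w"
  unfolding poly3_lin_def poly3_quad_def poly3_cub_def
  by (simp_all add: power2_eq_square power3_eq_cube algebra_simps)

text \<open>The derivatives of the quadratic and of the cubic part in direction \<open>e\<close>.\<close>

definition poly3_quad' :: "(nat \<Rightarrow> nat \<Rightarrow> real) \<Rightarrow> real \<times> real \<Rightarrow> real \<times> real \<Rightarrow> real \<times> real \<Rightarrow> real" where
  "poly3_quad' a z w e =
     2 * (a 2 0 + 3 * a 3 0 * fst z + a 2 1 * snd z) * fst w * fst e
   + (a 1 1 + 2 * a 2 1 * fst z + 2 * a 1 2 * snd z) * (fst w * snd e + snd w * fst e)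
   + 2 * (a 0 2 + a 1 2 * fst z + 3 * a 0 3 * snd z) * snd w * snd e"

definition poly3_cub' :: "(nat \<Rightarrow> nat \<Rightarrow> real) \<Rightarrow> real \<times> real \<Rightarrow> real \<times> real \<Rightarrow> real" where
  "poly3_cub' a w e =
     (3 * a 3 0 * (fst w)\<^sup>2 + 2 * a 2 1 * fst w * snd w + a 1 2 * (snd w)\<^sup>2) * fst e
   + (a 2 1 * (fst w)\<^sup>2 + 2 * a 1 2 * fst w * snd w + 3 * a 0 3 * (snd w)\<^sup>2) * snd e"

lemma poly3_lin_shift:
  "poly3_lin a (z + r *\<^sub>R w) e = poly3_lin a z e + r * poly3_quad' a z w e + r\<^sup>2 * poly3_cub' a w e"
  unfolding poly3_lin_def poly3_quad'_def poly3_cub'_def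
  by (simp add: power2_eq_square algebra_simps)

lemma poly3_quad_deriv:
  "((\<lambda>t. poly3_quad a z (w + t *\<^sub>R e)) has_real_derivative poly3_quad' a z w e) (at 0)"
  unfolding poly3_quad_def poly3_quad'_def
  by (auto intro!: derivative_eq_intros simp: algebra_simps)

lemma poly3_cub_deriv:
  "((\<lambda>t. poly3_cub a (w + t *\<^sub>R e)) has_real_derivative poly3_cub' a w e) (at 0)"
  unfolding poly3_cub_def poly3_cub'_def
  by (auto intro!: derivative_eq_intros simp: algebra_simps power2_eq_square)

lemma poly3_lin_deriv:
  "((\<lambda>t. poly3_lin a z (w + t *\<^sub>R e)) has_real_derivative poly3_lin a z e) (at 0)"
  unfolding poly3_lin_def by (auto intro!: derivative_eq_intros simp: algebra_simps)

lemma continuous_on_poly3_parts: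
  assumes "continuous_on S f"
  shows "continuous_on S (\<lambda>x. poly3_lin a z (f x))" "continuous_on S (\<lambda>x. poly3_quad a z (f x))"
    "continuous_on S (\<lambda>x. poly3_cub a (f x))"
  unfolding poly3_lin_def poly3_quad_def poly3_cub_def by (intro continuous_intros assms)+

text \<open>The vector with coordinates \<open>X\<close> and \<open>Y\<close> with respect to \<open>v\<close> and its image under a rotation by a
  right angle.\<close>

definition frame :: "real \<times> real \<Rightarrow> real \<Rightarrow> real \<Rightarrow> real \<times> real" where
  "frame v X Y = X *\<^sub>R v + Y *\<^sub>R (- snd v, fst v)"

lemma frame_scale: "frame v (r * X) (r * Y) = r *\<^sub>R frame v X Y"
  by (simp add: frame_def algebra_simps)

lemma frame_coordinates:
  assumes "v \<noteq> 0"
  shows "w = frame v ((fst w * fst v + snd w * snd v) / (norm v)\<^sup>2)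
                     ((snd w * fst v - fst w * snd v) / (norm v)\<^sup>2)"
proof -
  define N where "N = (norm v)\<^sup>2"
  have nv: "N = (fst v)\<^sup>2 + (snd v)\<^sup>2"
    by (simp add: N_def norm_prod_def)
  have "N \<noteq> 0" using assms by (simp add: N_def)
  thus ?thesis unfolding frame_def N_def[symmetric]
    by (simp add: prod_eq_iff field_simps) (simp add: nv power2_eq_square algebra_simps)
qed

lemma norm_frame_le: "norm (frame v X Y) \<le> (\<bar>X\<bar> + \<bar>Y\<bar>) * norm v"
proof -
  define n where "n = (- snd v, fst v)"
  have "norm n = norm v" by (simp add: n_def norm_prod_def add.commute)
  thus ?thesis unfolding frame_def n_def[symmetric]
    using norm_triangle_ineq[of "X *\<^sub>R v" "Y *\<^sub>R n"] by (simp add: distrib_right)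
qed

lemma line_unbounded:
  fixes z w :: "real \<times> real"
  assumes "w \<noteq> 0"
  shows "\<not> bounded (range (\<lambda>t. z + t *\<^sub>R w))"
proof
  assume "bounded (range (\<lambda>t. z + t *\<^sub>R w))"
  then obtain M where M: "norm (z + t *\<^sub>R w) \<le> M" for t unfolding bounded_iff by blast
  define t where "t = (M + norm z + 1) / norm w"
  have "norm (t *\<^sub>R w) \<ge> M + norm z + 1" using assms by (simp add: t_def)
  moreover have "norm (t *\<^sub>R w) \<le> norm (z + t *\<^sub>R w) + norm z"
    using norm_triangle_ineq4[of "z + t *\<^sub>R w" z] by simp
  ultimately show False using M[of t] by simp
qed

text \<open>A real cubic without real singular points, with a bounded closed part \<open>K\<close> that is separated
  from the rest \<open>B\<close> and stays connected when the point \<open>z0\<close> is removed, as a closed curve does; \<open>v\<close> is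
  tangent at \<open>z0\<close>.\<close>

locale cubic_oval =
  fixes a :: "nat \<Rightarrow> nat \<Rightarrow> real" and z0 v :: "real \<times> real" and K B :: "(real \<times> real) set"
  assumes curve: "alg_curve 3 a = K \<union> B" and closed: "closed K" "closed B"
    and disjoint: "K \<inter> B = {}" and bounded: "bounded K" and z0: "z0 \<in> K"
    and conn: "connected (K - {z0})"
    and smooth: "\<And>z. z \<in> alg_curve 3 a \<Longrightarrow> \<exists>w. poly3_lin a z w \<noteq> 0"
    and v: "v \<noteq> 0" and tangent: "poly3_lin a z0 v = 0"
begin

abbreviation "lin \<equiv> poly3_lin a z0"
abbreviation "quad \<equiv> poly3_quad a z0"
abbreviation "cub \<equiv> poly3_cub a"

abbreviation "disc \<equiv> poly3_disc a z0"

definition "l = lin (- snd v, fst v)"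

lemma lin_frame: "lin (frame v X Y) = Y * l"
proof -
  have "lin (frame v X Y) = X * lin v + Y * l"
    unfolding frame_def l_def poly3_lin_def by (simp add: algebra_simps)
  thus ?thesis by (simp add: tangent)
qed

lemma poly3_at: "poly2 3 a (z0 + w) = lin w + quad w + cub w"
proof -
  have "poly2 3 a z0 = 0" using z0 curve by (auto simp: alg_curve_def)
  thus ?thesis by (simp add: poly3_add)
qed

lemma l: "l \<noteq> 0"
proof
  assume "l = 0"
  hence "lin w = 0" for w using lin_frame frame_coordinates[OF v, of w] by (metis mult_zero_right)
  thus False using smooth[of z0] z0 curve by auto
qed

text \<open>The component contains points close to \<open>z0\<close> on both sides, in directions close to the tangent.\<close>

lemma points_near:
  assumes \<eta>: "\<eta> > 0"
  shows "eventually (\<lambda>r. \<exists>\<kappa>. \<bar>\<kappa>\<bar> \<le> \<eta> \<and> z0 + r *\<^sub>R frame v 1 \<kappa> \<in> K) (at 0)"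
proof -
  define \<phi> where "\<phi> = (\<lambda>r \<kappa>. \<kappa> + (r * quad (frame v 1 \<kappa>) + r\<^sup>2 * cub (frame v 1 \<kappa>)) / l)"
  have lim: "((\<lambda>r. \<phi> r \<kappa>) \<longlongrightarrow> \<kappa>) (at 0)" for \<kappa>
  proof -
    have "((\<lambda>r. \<phi> r \<kappa>) \<longlongrightarrow> \<kappa> + (0 * quad (frame v 1 \<kappa>) + 0\<^sup>2 * cub (frame v 1 \<kappa>)) / l) (at 0)"
      unfolding \<phi>_def by (intro tendsto_intros l)
    thus ?thesis by simp
  qed
  have "open (- B)" "z0 \<in> - B" using closed disjoint z0 by auto
  then obtain e where e: "e > 0" "ball z0 e \<subseteq> - B" using open_contains_ball by blast
  have "((\<lambda>r. \<bar>r\<bar> * ((1 + \<eta>) * norm v)) \<longlongrightarrow> \<bar>0\<bar> * ((1 + \<eta>) * norm v)) (at (0 :: real))"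
    by (intro tendsto_intros)
  hence "eventually (\<lambda>r. \<bar>r\<bar> * ((1 + \<eta>) * norm v) < e) (at (0 :: real))"
    using e(1) by (intro order_tendstoD(2)) auto
  moreover have "eventually (\<lambda>r. \<phi> r \<eta> > 0) (at 0)" "eventually (\<lambda>r. \<phi> r (- \<eta>) < 0) (at 0)"
    using \<eta> by (auto intro: order_tendstoD lim)
  ultimately show ?thesis
  proof eventually_elim
    case (elim r)
    have "continuous_on {- \<eta>..\<eta>} (\<phi> r)"
      unfolding \<phi>_def frame_def by (intro continuous_intros continuous_on_poly3_parts) (use l in auto)
    then obtain \<kappa> where \<kappa>: "- \<eta> \<le> \<kappa>" "\<kappa> \<le> \<eta>" "\<phi> r \<kappa> = 0"
      using IVT'[of "\<phi> r" "- \<eta>" 0 \<eta>] elim \<eta> by auto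
    have "poly2 3 a (z0 + r *\<^sub>R frame v 1 \<kappa>) = r * l * \<phi> r \<kappa>"
    proof -
      have "l * \<phi> r \<kappa> = l * \<kappa> + (r * quad (frame v 1 \<kappa>) + r\<^sup>2 * cub (frame v 1 \<kappa>))"
        using l by (simp add: \<phi>_def field_simps)
      thus ?thesis
        unfolding poly3_at poly3_lin_scale poly3_quad_scale poly3_cub_scale lin_frame
        by (simp add: mult.assoc) (simp add: algebra_simps power2_eq_square power3_eq_cube)
    qed
    hence "z0 + r *\<^sub>R frame v 1 \<kappa> \<in> K \<union> B"
      using \<kappa> curve by (auto simp: alg_curve_def)
    moreover have "norm (r *\<^sub>R frame v 1 \<kappa>) < e"
    proof -
      have "norm (r *\<^sub>R frame v 1 \<kappa>) \<le> \<bar>r\<bar> * ((1 + \<bar>\<kappa>\<bar>) * norm v)"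
        using norm_frame_le[of v 1 \<kappa>] by (simp add: mult_left_mono)
      also have "\<dots> \<le> \<bar>r\<bar> * ((1 + \<eta>) * norm v)"
        using \<kappa> by (intro mult_left_mono mult_right_mono) auto
      finally show ?thesis using elim by simp
    qed
    hence "z0 + r *\<^sub>R frame v 1 \<kappa> \<notin> B"
    proof -
      assume "norm (r *\<^sub>R frame v 1 \<kappa>) < e"
      hence "z0 + r *\<^sub>R frame v 1 \<kappa> \<in> ball z0 e"
        by (simp add: dist_norm norm_minus_commute)
      thus ?thesis using e(2) by blast
    qed
    ultimately show ?case using \<kappa> by (intro exI[of _ \<kappa>]) auto
  qed
qed

text \<open>Points of \<open>K\<close> close to \<open>z0\<close> lie on both sides of a line through \<open>z0\<close> that is not the tangent.
  As \<open>K - {z0}\<close> is connected, the line meets it.\<close>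

lemma line_meets_again:
  assumes w: "lin w \<noteq> 0"
  shows "\<exists>r. r \<noteq> 0 \<and> z0 + r *\<^sub>R w \<in> K"
proof (rule ccontr)
  assume "\<not> ?thesis"
  hence no: "z0 + r *\<^sub>R w \<notin> K" if "r \<noteq> 0" for r using that by blast
  obtain X Y where XY: "w = frame v X Y" using frame_coordinates[OF v] by blast
  have Y: "Y \<noteq> 0" using w by (auto simp: XY lin_frame)
  define \<sigma> where "\<sigma> = (\<lambda>z. fst w * snd (z - z0) - snd w * fst (z - z0))"
  have nz: "\<sigma> z \<noteq> 0" if z: "z \<in> K - {z0}" for z
  proof
    assume \<sigma>0: "\<sigma> z = 0"
    obtain A B where AB: "z - z0 = frame v A B" using frame_coordinates[OF v] by blast
    have "\<sigma> z = (X * B - Y * A) * (norm v)\<^sup>2"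
      unfolding \<sigma>_def AB XY by (simp add: frame_def norm_prod_def algebra_simps power2_eq_square)
    hence "A = B / Y * X" using \<sigma>0 Y v by (simp add: field_simps)
    hence "z - z0 = (B / Y) *\<^sub>R w"
      unfolding AB XY using Y by (simp flip: frame_scale)
    hence "z = z0 + (B / Y) *\<^sub>R w" by (simp add: algebra_simps)
    moreover have "B / Y \<noteq> 0" using z calculation by auto
    ultimately show False using no z by auto
  qed
  define \<eta> where "\<eta> = \<bar>Y\<bar> / (2 * (\<bar>X\<bar> + 1))"
  have \<eta>: "\<eta> > 0" using Y by (simp add: \<eta>_def)
  obtain d where d: "d > 0" "\<And>r. r \<noteq> 0 \<Longrightarrow> \<bar>r\<bar> < d \<Longrightarrow> \<exists>\<kappa>. \<bar>\<kappa>\<bar> \<le> \<eta> \<and> z0 + r *\<^sub>R frame v 1 \<kappa> \<in> K"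
    using points_near[OF \<eta>] by (auto simp: eventually_at)
  have pt: "\<exists>z\<in>K - {z0}. \<sigma> z * (- Y * r) > 0" if r: "r \<noteq> 0" "\<bar>r\<bar> < d" for r
  proof -
    obtain \<kappa> where \<kappa>: "\<bar>\<kappa>\<bar> \<le> \<eta>" "z0 + r *\<^sub>R frame v 1 \<kappa> \<in> K" using d(2)[OF r] by blast
    have nv: "(norm v)\<^sup>2 > 0" using v by simp
    have \<sigma>1: "\<sigma> (z0 + r *\<^sub>R frame v 1 \<kappa>) = (X * \<kappa> - Y) * r * (norm v)\<^sup>2"
      unfolding \<sigma>_def XY by (simp add: frame_def norm_prod_def algebra_simps power2_eq_square)
    have "(X * \<kappa> - Y) * (- Y) > 0"
    proof -
      have "\<bar>X * \<kappa>\<bar> \<le> \<bar>X\<bar> * \<eta>" using \<kappa> by (simp add: abs_mult mult_left_mono)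
      also have "\<dots> < \<bar>Y\<bar>"
      proof -
        have "\<bar>Y\<bar> * (\<bar>X\<bar> + 2) > 0" using Y by simp
        hence "\<bar>X\<bar> * \<bar>Y\<bar> < \<bar>Y\<bar> * (2 * (\<bar>X\<bar> + 1))" by (simp add: algebra_simps)
        moreover have "2 * (\<bar>X\<bar> + 1) > 0" by simp
        moreover have "\<bar>X\<bar> * \<eta> = \<bar>X\<bar> * \<bar>Y\<bar> / (2 * (\<bar>X\<bar> + 1))" by (simp add: \<eta>_def)
        ultimately show ?thesis by (simp only: pos_divide_less_eq)
      qed
      finally have "\<bar>X * \<kappa>\<bar> < \<bar>Y\<bar>" .
      hence "Y > 0 \<Longrightarrow> X * \<kappa> - Y < 0" "Y < 0 \<Longrightarrow> X * \<kappa> - Y > 0" by linarith+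
      thus ?thesis
        using Y mult_neg_neg[of "X * \<kappa> - Y" "- Y"] mult_pos_pos[of "X * \<kappa> - Y" "- Y"]
        by (cases "Y > 0") simp_all
    qed
    hence "((X * \<kappa> - Y) * (- Y)) * (r\<^sup>2 * (norm v)\<^sup>2) > 0" by (rule mult_pos_pos) (use r nv in auto)
    also have "((X * \<kappa> - Y) * (- Y)) * (r\<^sup>2 * (norm v)\<^sup>2) = \<sigma> (z0 + r *\<^sub>R frame v 1 \<kappa>) * (- Y * r)"
      unfolding \<sigma>1 power2_eq_square by algebra
    finally have pos: "\<sigma> (z0 + r *\<^sub>R frame v 1 \<kappa>) * (- Y * r) > 0" .
    moreover have "\<sigma> z0 = 0" by (simp add: \<sigma>_def)
    ultimately show ?thesis using \<kappa>(2) by (intro bexI[of _ "z0 + r *\<^sub>R frame v 1 \<kappa>"]) auto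
  qed
  obtain z1 z2 where z12: "z1 \<in> K - {z0}" "z2 \<in> K - {z0}" "\<sigma> z1 * (- Y * (d / 2)) > 0" "\<sigma> z2 * (- Y * (- d / 2)) > 0"
    using pt[of "d / 2"] pt[of "- d / 2"] d(1) by auto
  have "connected (\<sigma> ` (K - {z0}))"
    unfolding \<sigma>_def by (intro connected_continuous_image conn continuous_intros)
  hence "is_interval (\<sigma> ` (K - {z0}))" by (simp add: is_interval_connected_1)
  hence "\<exists>z\<in>K - {z0}. \<sigma> z = 0" if "z1 \<in> K - {z0}" "z2 \<in> K - {z0}" "\<sigma> z1 \<le> 0" "0 \<le> \<sigma> z2" for z1 z2
    using mem_is_interval_1_I[of "\<sigma> ` (K - {z0})" "\<sigma> z1" "\<sigma> z2" 0] that by force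
  moreover have "\<sigma> z1 \<le> 0 \<and> 0 \<le> \<sigma> z2 \<or> \<sigma> z2 \<le> 0 \<and> 0 \<le> \<sigma> z1"
    using z12(3,4) d(1) by (auto simp: zero_less_mult_iff mult_less_0_iff)
  ultimately have "\<exists>z\<in>K - {z0}. \<sigma> z = 0" using z12(1,2) by metis
  thus False using nz by metis
qed

lemma second_root:
  assumes "r \<noteq> 0" "z0 + r *\<^sub>R w \<in> K"
  shows "lin w + r * quad w + r\<^sup>2 * cub w = 0"
proof -
  have "poly2 3 a (z0 + r *\<^sub>R w) = 0" using assms(2) curve by (auto simp: alg_curve_def)
  hence "r * (lin w + r * quad w + r\<^sup>2 * cub w) = 0"
    by (simp add: poly3_at poly3_lin_scale poly3_quad_scale poly3_cub_scale algebra_simps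
        power2_eq_square power3_eq_cube)
  thus ?thesis using assms(1) by simp
qed

lemma disc_nonneg: "disc w \<ge> 0"
proof (cases "lin w = 0")
  case True
  thus ?thesis by (simp add: poly3_disc_def)
next
  case False
  then obtain r where r: "r \<noteq> 0" "z0 + r *\<^sub>R w \<in> K" using line_meets_again by blast
  hence "lin w + r * quad w + r\<^sup>2 * cub w = 0" by (rule second_root)
  hence "disc w = (quad w + 2 * r * cub w)\<^sup>2" unfolding poly3_disc_def by algebra
  thus ?thesis by simp
qed

lemma no_line: "w \<noteq> 0 \<Longrightarrow> lin w = 0 \<Longrightarrow> quad w = 0 \<Longrightarrow> cub w \<noteq> 0"
proof
  assume w: "w \<noteq> 0" "lin w = 0" "quad w = 0" "cub w = 0"
  define \<Lambda> where "\<Lambda> = range (\<lambda>t. z0 + t *\<^sub>R w)"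
  have "poly2 3 a (z0 + t *\<^sub>R w) = 0" for t
    by (simp add: poly3_at poly3_lin_scale poly3_quad_scale poly3_cub_scale w)
  hence "\<Lambda> \<subseteq> K \<union> B" unfolding \<Lambda>_def curve[symmetric] by (auto simp: alg_curve_def)
  moreover have "connected \<Lambda>"
    unfolding \<Lambda>_def by (intro connected_continuous_image continuous_intros) simp
  moreover have "z0 \<in> \<Lambda>" unfolding \<Lambda>_def by (rule image_eqI[of _ _ 0]) auto
  ultimately have "\<Lambda> \<inter> B = {}"
    using connected_closedD[of \<Lambda> K B] closed disjoint z0 by blast
  hence "\<Lambda> \<subseteq> K" using \<open>\<Lambda> \<subseteq> K \<union> B\<close> by blast
  hence "bounded (range (\<lambda>t. z0 + t *\<^sub>R w))"
    using bounded bounded_subset unfolding \<Lambda>_def by blast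
  thus False using line_unbounded w by blast
qed

text \<open>The discriminant is nonnegative, so where it vanishes its derivative vanishes as well, and this
  makes the second intersection of the line with \<open>K\<close> a singular point of the cubic. On the tangent
  line, a zero of the discriminant would put the whole line into the bounded set \<open>K\<close>.\<close>

lemma disc_pos:
  assumes w: "w \<noteq> 0"
  shows "disc w > 0"
proof (rule ccontr)
  assume "\<not> disc w > 0"
  hence d0: "disc w = 0" using disc_nonneg[of w] by simp
  have crit: "2 * quad w * poly3_quad' a z0 w e - 4 * lin e * cub w - 4 * lin w * poly3_cub' a w e = 0" for e
  proof (rule DERIV_local_min[where f = "\<lambda>t. disc (w + t *\<^sub>R e)" and x = 0 and d = 1])
    show "((\<lambda>t. disc (w + t *\<^sub>R e)) has_real_derivative
        2 * quad w * poly3_quad' a z0 w e - 4 * lin e * cub w - 4 * lin w * poly3_cub' a w e) (at 0)"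
      unfolding poly3_disc_def
      by (rule derivative_eq_intros refl poly3_quad_deriv poly3_lin_deriv poly3_cub_deriv)+
        (simp add: algebra_simps)
  qed (use d0 disc_nonneg in auto)
  show False
  proof (cases "lin w = 0")
    case True
    hence "quad w = 0" using d0 by (simp add: poly3_disc_def)
    hence "l * cub w = 0" using crit[of "(- snd v, fst v)"] True by (simp add: l_def)
    thus False using no_line[OF w True \<open>quad w = 0\<close>] l by simp
  next
    case False
    then obtain r where r: "r \<noteq> 0" "z0 + r *\<^sub>R w \<in> K" using line_meets_again by blast
    hence root: "lin w + r * quad w + r\<^sup>2 * cub w = 0" by (rule second_root)
    hence "(quad w + 2 * r * cub w)\<^sup>2 = 0" using d0 unfolding poly3_disc_def by algebra
    hence dbl: "quad w = - 2 * r * cub w" by simp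
    hence lw: "lin w = r\<^sup>2 * cub w" using root by algebra
    have c: "cub w \<noteq> 0" using lw False by auto
    have "poly3_lin a (z0 + r *\<^sub>R w) e = 0" for e
    proof -
      have "cub w * poly3_lin a (z0 + r *\<^sub>R w) e = 0"
        using crit[of e] dbl lw unfolding poly3_lin_shift by algebra
      thus ?thesis using c by simp
    qed
    thus False using smooth[of "z0 + r *\<^sub>R w"] r(2) curve by auto
  qed
qed

lemma flex_free: "quad v \<noteq> 0"
  using disc_pos[OF v] tangent by (auto simp: poly3_disc_def)

end

text \<open>The sign of the equation is chosen such that the quadratic part is positive on the tangent;
  then \<open>poly3_S\<close> belongs to the root that gives the points of the oval.\<close>

locale positive_cubic_oval = cubic_oval +
  assumes quad_pos: "poly3_quad a z0 v > 0"
begin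

abbreviation "S \<equiv> poly3_S a z0"

lemma continuous_disc: "continuous_on A f \<Longrightarrow> continuous_on A (\<lambda>x. disc (f x))"
  unfolding poly3_disc_def by (intro continuous_intros continuous_on_poly3_parts)

text \<open>On \<open>K - {z0}\<close> the product of \<open>2 * lin + S\<close> and its conjugate is zero, and they have no common zero.
  By connectedness one of them vanishes throughout, and close to \<open>z0\<close> this is the first.\<close>

lemma on_oval:
  assumes z: "z \<in> K"
  shows "2 * lin (z - z0) + S (z - z0) = 0"
proof (cases "z = z0")
  case True
  thus ?thesis by (simp add: poly3_S_def poly3_disc_def poly3_lin_def poly3_quad_def)
next
  case False
  define h where "h = (\<lambda>z. 2 * lin (z - z0) + quad (z - z0) + sqrt (disc (z - z0)))"
  define h' where "h' = (\<lambda>z. 2 * lin (z - z0) + quad (z - z0) - sqrt (disc (z - z0)))"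
  have prod: "h z * h' z = 0" if "z \<in> K" for z
  proof -
    have "poly2 3 a (z0 + (z - z0)) = 0" using that curve by (auto simp: alg_curve_def)
    hence "lin (z - z0) + quad (z - z0) + cub (z - z0) = 0" by (simp only: poly3_at)
    moreover have "(sqrt (disc (z - z0)))\<^sup>2 = disc (z - z0)" using disc_nonneg by simp
    ultimately show ?thesis unfolding h_def h'_def poly3_disc_def by algebra
  qed
  have cont: "continuous_on UNIV h" "continuous_on UNIV h'"
    unfolding h_def h'_def by (intro continuous_intros continuous_on_poly3_parts continuous_disc)+
  have cl: "closed {z. h z = 0}" "closed {z. h' z = 0}"
    by (intro closed_Collect_eq cont continuous_intros)+
  have disj: "{z. h z = 0} \<inter> {z. h' z = 0} \<inter> (K - {z0}) = {}"
  proof (rule equals0I)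
    fix z assume "z \<in> {z. h z = 0} \<inter> {z. h' z = 0} \<inter> (K - {z0})"
    hence "h z = 0" "h' z = 0" "z - z0 \<noteq> 0" by simp_all
    thus False using disc_pos[of "z - z0"] by (simp add: h_def h'_def)
  qed
  \<comment> \<open>Close to the base point only the first factor vanishes.\<close>
  have near: "\<exists>z\<in>K - {z0}. h' z \<noteq> 0"
  proof -
    define \<psi> where "\<psi> = (\<lambda>x. quad (frame v 1 (snd x)) + 2 * fst x * cub (frame v 1 (snd x)))"
    have "open {x. \<psi> x > 0}"
      unfolding \<psi>_def frame_def
      by (intro open_Collect_less continuous_intros continuous_on_poly3_parts)
    moreover have "(0, 0) \<in> {x. \<psi> x > 0}" using quad_pos by (simp add: \<psi>_def frame_def flip: zero_prod_def)
    ultimately obtain e where e: "e > 0" "ball (0, 0) e \<subseteq> {x. \<psi> x > 0}"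
      using open_contains_ball by blast
    obtain d where d: "d > 0" "\<And>r. r \<noteq> 0 \<Longrightarrow> \<bar>r\<bar> < d \<Longrightarrow> \<exists>\<kappa>. \<bar>\<kappa>\<bar> \<le> e / 3 \<and> z0 + r *\<^sub>R frame v 1 \<kappa> \<in> K"
      using points_near[of "e / 3"] e(1) by (auto simp: eventually_at)
    define r where "r = min (d / 2) (e / 3)"
    have r: "r > 0" "r < d" "r \<le> e / 3" using d(1) e(1) by (auto simp: r_def)
    obtain \<kappa> where \<kappa>: "\<bar>\<kappa>\<bar> \<le> e / 3" "z0 + r *\<^sub>R frame v 1 \<kappa> \<in> K" using d(2)[of r] r by auto
    define w where "w = r *\<^sub>R frame v 1 \<kappa>"
    have "norm (r, \<kappa>) < e"
      using norm_Pair_le[of r \<kappa>] r \<kappa>(1) e(1) by simp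
    hence "(r, \<kappa>) \<in> {x. \<psi> x > 0}" using e(2) by (auto simp: dist_norm simp flip: zero_prod_def)
    hence "quad w + 2 * cub w > 0"
    proof -
      assume "(r, \<kappa>) \<in> {x. \<psi> x > 0}"
      hence "r\<^sup>2 * \<psi> (r, \<kappa>) > 0" using r by simp
      also have "r\<^sup>2 * \<psi> (r, \<kappa>) = quad w + 2 * cub w"
        unfolding w_def poly3_quad_scale poly3_cub_scale \<psi>_def
        by (simp add: algebra_simps power2_eq_square power3_eq_cube)
      finally show ?thesis .
    qed
    moreover have "lin w + quad w + cub w = 0"
    proof -
      have "poly2 3 a (z0 + w) = 0" using \<kappa>(2) curve by (auto simp: alg_curve_def w_def)
      thus ?thesis by (simp only: poly3_at)
    qed
    ultimately have "2 * lin w + quad w < 0" by simp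
    moreover have "sqrt (disc w) \<ge> 0" using disc_nonneg by simp
    ultimately have "2 * lin w + quad w - sqrt (disc w) < 0" by linarith
    hence "h' (z0 + w) < 0" by (simp add: h'_def)
    moreover have "h' z0 = 0"
      by (simp add: h'_def poly3_disc_def poly3_lin_def poly3_quad_def)
    ultimately show ?thesis using \<kappa>(2) by (intro bexI[of _ "z0 + w"]) (auto simp: w_def)
  qed
  have sub: "K - {z0} \<subseteq> {z. h z = 0} \<union> {z. h' z = 0}" using prod by auto
  have "{z. h z = 0} \<inter> (K - {z0}) = {} \<or> {z. h' z = 0} \<inter> (K - {z0}) = {}"
    by (rule connected_closedD[OF conn disj sub cl])
  hence "{z. h' z = 0} \<inter> (K - {z0}) = {}" using near sub by blast
  hence "h z = 0" using sub z False by blast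
  thus ?thesis by (simp add: h_def poly3_S_def)
qed

lemma S_scale: "S (r *\<^sub>R w) = r\<^sup>2 * S w"
proof -
  have "disc (r *\<^sub>R w) = (r\<^sup>2)\<^sup>2 * disc w"
    unfolding poly3_disc_def poly3_lin_scale poly3_quad_scale poly3_cub_scale
    by (simp add: algebra_simps power2_eq_square power3_eq_cube)
  hence "sqrt (disc (r *\<^sub>R w)) = r\<^sup>2 * sqrt (disc w)"
    by (simp only: real_sqrt_mult real_sqrt_abs abs_power2)
  thus ?thesis by (simp add: poly3_S_def poly3_quad_scale distrib_left)
qed

lemma S_pos:
  assumes w: "w \<noteq> 0"
  shows "S w > 0"
proof -
  have nz: "S w \<noteq> 0" if w: "w \<noteq> 0" for w
  proof (cases "lin w = 0")
    case True
    obtain X Y where XY: "w = frame v X Y" using frame_coordinates[OF v] by blast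
    hence "Y = 0" using True l by (simp add: lin_frame)
    hence wX: "w = X *\<^sub>R v" by (simp add: XY frame_def zero_prod_def)
    hence "quad w > 0" using w quad_pos by (simp add: poly3_quad_scale)
    moreover have "sqrt (disc w) \<ge> 0" using disc_nonneg by simp
    ultimately have "S w > 0" unfolding poly3_S_def by (rule add_pos_nonneg)
    thus ?thesis by simp
  next
    case False
    then obtain r where r: "r \<noteq> 0" "z0 + r *\<^sub>R w \<in> K" using line_meets_again by blast
    hence "2 * lin (r *\<^sub>R w) + S (r *\<^sub>R w) = 0" using on_oval[OF r(2)] by simp
    hence "r * (2 * lin w + r * S w) = 0"
      by (simp add: poly3_lin_scale S_scale algebra_simps power2_eq_square)
    thus ?thesis using r(1) False by auto
  qed
  have "connected (S ` (- {0}))"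
    unfolding poly3_S_def
    by (intro connected_continuous_image continuous_intros continuous_on_poly3_parts continuous_disc
        connected_punctured_universe) simp
  hence "is_interval (S ` (- {0}))" by (simp add: is_interval_connected_1)
  moreover have "S v > 0"
    using quad_pos disc_nonneg[of v] by (simp add: poly3_S_def add_pos_nonneg)
  moreover have "0 \<notin> S ` (- {0})" using nz by (metis ComplD imageE singletonI)
  ultimately show ?thesis
    using w v mem_is_interval_1_I[of "S ` (- {0})" "S w" "S v" 0]
    by (metis ComplI imageI less_eq_real_def linorder_not_le singletonD)
qed

end

section \<open>Contact with the osculating conic or cubic\<close>

lemma tendsto_poly3_parts:
  assumes "\<And>i j. ((\<lambda>u. A u i j) \<longlongrightarrow> a i j) F" "(z \<longlongrightarrow> z0) F" "(w \<longlongrightarrow> w0) F"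
  shows "((\<lambda>u. poly3_lin (A u) (z u) (w u)) \<longlongrightarrow> poly3_lin a z0 w0) F"
    "((\<lambda>u. poly3_quad (A u) (z u) (w u)) \<longlongrightarrow> poly3_quad a z0 w0) F"
    "((\<lambda>u. poly3_cub (A u) (w u)) \<longlongrightarrow> poly3_cub a w0) F"
  unfolding poly3_lin_def poly3_quad_def poly3_cub_def by (intro tendsto_intros assms)+

lemma poly3_parts_comb:
  "poly2 3 (\<lambda>i j. a i j - c * b i j) z = poly2 3 a z - c * poly2 3 b z"
  "poly3_lin (\<lambda>i j. a i j - c * b i j) z w = poly3_lin a z w - c * poly3_lin b z w"
  "poly3_quad (\<lambda>i j. a i j - c * b i j) z w = poly3_quad a z w - c * poly3_quad b z w"
  "poly3_cub (\<lambda>i j. a i j - c * b i j) w = poly3_cub a w - c * poly3_cub b w"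
  unfolding poly3_explicit poly3_lin_def poly3_quad_def poly3_cub_def by (simp_all add: algebra_simps)

lemma poly3_frame:
  "poly3_lin a z (frame v X Y) = X * poly3_lin a z v + Y * poly3_lin a z (- snd v, fst v)"
  "poly3_quad a z (frame v X Y) = poly3_quad a z v * X\<^sup>2 + poly3_quad' a z v (- snd v, fst v) * X * Y
     + poly3_quad a z (- snd v, fst v) * Y\<^sup>2"
  "poly3_cub a (frame v X Y) = poly3_cub a v * X ^ 3 + poly3_cub' a v (- snd v, fst v) * X\<^sup>2 * Y
     + poly3_cub' a (- snd v, fst v) v * X * Y\<^sup>2 + poly3_cub a (- snd v, fst v) * Y ^ 3"
  unfolding frame_def poly3_lin_def poly3_quad_def poly3_quad'_def poly3_cub_def poly3_cub'_def
  by (simp_all add: algebra_simps power2_eq_square power3_eq_cube)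

lemma limits_agree:
  fixes f g :: "'a \<Rightarrow> real"
  assumes "F \<noteq> bot" "(g \<longlongrightarrow> L) F" "(f \<longlongrightarrow> M) F" "eventually (\<lambda>s. f s = g s) F"
  shows "L = M"
  using tendsto_unique[OF assms(1,2) Lim_transform_eventually[OF assms(3,4)]] .

text \<open>A curve with nonzero velocity \<open>v\<close> at the parameter \<open>u\<close>, possibly one-sided.\<close>

locale contact_curve =
  fixes \<gamma> :: "real \<Rightarrow> real \<times> real" and I :: "real set" and u :: real and v :: "real \<times> real"
  assumes nt: "at u within I \<noteq> bot"
    and velocity: "((\<lambda>s. (\<gamma> s - \<gamma> u) /\<^sub>R (s - u)) \<longlongrightarrow> v) (at u within I)" and v: "v \<noteq> 0"
begin

abbreviation "F \<equiv> at u within I"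
abbreviation "\<omega> s \<equiv> (\<gamma> s - \<gamma> u) /\<^sub>R (s - u)"

lemma \<tau>: "((\<lambda>s. s - u) \<longlongrightarrow> 0) F" "eventually (\<lambda>s. s - u \<noteq> 0) F"
proof -
  have "((\<lambda>s. s - u) \<longlongrightarrow> u - u) F" by (intro tendsto_intros)
  thus "((\<lambda>s. s - u) \<longlongrightarrow> 0) F" by simp
  show "eventually (\<lambda>s. s - u \<noteq> 0) F"
    using eventually_neq_at_within[of u u I] by eventually_elim auto
qed

lemma expand:
  assumes "s \<noteq> u"
  shows "poly2 3 a (\<gamma> s) = poly2 3 a (\<gamma> u) + (s - u) * poly3_lin a (\<gamma> u) (\<omega> s)
    + (s - u)\<^sup>2 * poly3_quad a (\<gamma> u) (\<omega> s)
    + (s - u) ^ 3 * poly3_cub a (\<omega> s)"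
proof -
  define w where "w = \<omega> s"
  have eq: "\<gamma> s = \<gamma> u + (s - u) *\<^sub>R w" using assms by (simp add: w_def)
  show ?thesis unfolding w_def[symmetric]
    by (subst eq) (simp only: poly3_add poly3_lin_scale poly3_quad_scale poly3_cub_scale)
qed

lemma first_order:
  assumes lim: "((\<lambda>s. poly2 3 a (\<gamma> s) / (s - u) ^ k) \<longlongrightarrow> c) F" and k: "k \<ge> 2"
  shows "poly2 3 a (\<gamma> u) = 0" "poly3_lin a (\<gamma> u) v = 0"
proof -
  note parts = tendsto_poly3_parts[of "\<lambda>_. a" a F "\<lambda>_. \<gamma> u", OF tendsto_const tendsto_const velocity]
  have "((\<lambda>s. poly2 3 a (\<gamma> u) + (s - u) * poly3_lin a (\<gamma> u) (\<omega> s)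
    + (s - u)\<^sup>2 * poly3_quad a (\<gamma> u) (\<omega> s) + (s - u) ^ 3 * poly3_cub a (\<omega> s))
    \<longlongrightarrow> poly2 3 a (\<gamma> u) + 0 * poly3_lin a (\<gamma> u) v + 0\<^sup>2 * poly3_quad a (\<gamma> u) v + 0 ^ 3 * poly3_cub a v) F"
    (is "(?f \<longlongrightarrow> ?l) F")
    by (intro tendsto_add tendsto_mult tendsto_power tendsto_const \<tau> parts)
  moreover have "((\<lambda>s. poly2 3 a (\<gamma> s)) \<longlongrightarrow> 0) F"
    using vanishing_order_mono[OF lim _ \<tau>, of 0] k by simp
  moreover have "eventually (\<lambda>s. poly2 3 a (\<gamma> s) = ?f s) F"
    using \<tau>(2) by eventually_elim (rule expand, simp)
  ultimately have "?l = 0"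
    by (rule limits_agree[OF nt])
  thus p0: "poly2 3 a (\<gamma> u) = 0" by simp
  have "((\<lambda>s. poly3_lin a (\<gamma> u) (\<omega> s) + (s - u) * poly3_quad a (\<gamma> u) (\<omega> s) + (s - u)\<^sup>2 * poly3_cub a (\<omega> s))
    \<longlongrightarrow> poly3_lin a (\<gamma> u) v + 0 * poly3_quad a (\<gamma> u) v + 0\<^sup>2 * poly3_cub a v) F"
    (is "(?g \<longlongrightarrow> ?m) F")
    by (intro tendsto_add tendsto_mult tendsto_power tendsto_const \<tau> parts)
  moreover have "((\<lambda>s. poly2 3 a (\<gamma> s) / (s - u) ^ 1) \<longlongrightarrow> 0) F"
    using vanishing_order_mono[OF lim _ \<tau>, of 1] k by simp
  moreover have "eventually (\<lambda>s. poly2 3 a (\<gamma> s) / (s - u) ^ 1 = ?g s) F"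
    using \<tau>(2)
  proof eventually_elim
    case (elim s)
    have "(0 + t * x + t\<^sup>2 * y + t ^ 3 * z) / t ^ 1 = x + t * y + t\<^sup>2 * z" if "t \<noteq> 0" for t x y z :: real
      using that by (simp add: field_simps power2_eq_square power3_eq_cube)
    thus ?case using elim expand[of s a] unfolding p0 by simp
  qed
  ultimately have "?m = 0"
    by (rule limits_agree[OF nt])
  thus "poly3_lin a (\<gamma> u) v = 0" by simp
qed

text \<open>Coordinates of the curve with respect to the tangent frame at the contact point.\<close>

definition "X s = (fst (\<gamma> s - \<gamma> u) * fst v + snd (\<gamma> s - \<gamma> u) * snd v) / (norm v)\<^sup>2"
definition "Y s = (snd (\<gamma> s - \<gamma> u) * fst v - fst (\<gamma> s - \<gamma> u) * snd v) / (norm v)\<^sup>2"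

lemma frame_XY: "\<gamma> s - \<gamma> u = frame v (X s) (Y s)"
  unfolding X_def Y_def by (rule frame_coordinates[OF v])

lemma frame_XY': "\<gamma> s = \<gamma> u + frame v (X s) (Y s)"
  unfolding frame_XY[symmetric] by simp

lemma XY_lim: "((\<lambda>s. X s / (s - u)) \<longlongrightarrow> 1) F" "((\<lambda>s. Y s / (s - u)) \<longlongrightarrow> 0) F"
proof -
  have nv: "(norm v)\<^sup>2 = fst v * fst v + snd v * snd v" "(norm v)\<^sup>2 \<noteq> 0"
  proof -
    show "(norm v)\<^sup>2 \<noteq> 0" using v by simp
    show "(norm v)\<^sup>2 = fst v * fst v + snd v * snd v" by (simp add: norm_prod_def power2_eq_square)
  qed
  have "((\<lambda>s. (fst (\<omega> s) * fst v + snd (\<omega> s) * snd v) / (norm v)\<^sup>2)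
      \<longlongrightarrow> (fst v * fst v + snd v * snd v) / (norm v)\<^sup>2) F"
    by (intro tendsto_divide tendsto_add tendsto_mult tendsto_fst tendsto_snd tendsto_const velocity nv)
  thus "((\<lambda>s. X s / (s - u)) \<longlongrightarrow> 1) F"
  proof -
    assume "((\<lambda>s. (fst (\<omega> s) * fst v + snd (\<omega> s) * snd v) / (norm v)\<^sup>2)
      \<longlongrightarrow> (fst v * fst v + snd v * snd v) / (norm v)\<^sup>2) F"
    moreover have "(fst v * fst v + snd v * snd v) / (norm v)\<^sup>2 = 1" using nv by (metis div_self)
    ultimately show ?thesis unfolding X_def by (simp add: divide_inverse algebra_simps)
  qed
  have "((\<lambda>s. (snd (\<omega> s) * fst v - fst (\<omega> s) * snd v) / (norm v)\<^sup>2)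
      \<longlongrightarrow> (snd v * fst v - fst v * snd v) / (norm v)\<^sup>2) F"
    by (intro tendsto_divide tendsto_diff tendsto_mult tendsto_fst tendsto_snd tendsto_const velocity nv)
  thus "((\<lambda>s. Y s / (s - u)) \<longlongrightarrow> 0) F"
    unfolding Y_def by (simp add: divide_inverse algebra_simps)
qed

text \<open>A conic is treated as a cubic polynomial without cubic part. Contact of order 4 at \<open>\<gamma> u\<close> exhausts
  the intersections of two conics: modulo \<open>a\<close>, the conic \<open>b\<close> is a multiple of the square of the
  tangent line, so it has one sign on the rest of \<open>a\<close>.\<close>

lemma conic_contact_sign:
  assumes conic: "\<And>w. poly3_cub a w = 0" "\<And>w. poly3_cub b w = 0"
    and bounded: "bounded (alg_curve 3 a)"
    and p: "((\<lambda>s. poly2 3 a (\<gamma> s) / (s - u) ^ 4) \<longlongrightarrow> 0) F"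
    and q: "((\<lambda>s. poly2 3 b (\<gamma> s) / (s - u) ^ 4) \<longlongrightarrow> \<theta>) F" and \<theta>: "\<theta> \<noteq> 0"
    and z: "poly2 3 a z = 0" "z \<noteq> \<gamma> u"
  shows "\<theta> * poly2 3 b z > 0"
proof -
  note a1 = first_order[OF p] and b1 = first_order[OF q]
  define n where "n = (- snd v, fst v)"
  define l where "l = poly3_lin a (\<gamma> u) n"
  define a0 where "a0 = poly3_quad a (\<gamma> u) v"
  have at: "poly2 3 a (\<gamma> u + w) = poly3_lin a (\<gamma> u) w + poly3_quad a (\<gamma> u) w" for w
    using a1 by (simp add: poly3_add conic)
  have a0: "a0 \<noteq> 0"
  proof
    assume "a0 = 0"
    hence "poly2 3 a (\<gamma> u + t *\<^sub>R v) = 0" for t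
      using a1 by (simp add: at poly3_lin_scale poly3_quad_scale a0_def)
    hence "range (\<lambda>t. \<gamma> u + t *\<^sub>R v) \<subseteq> alg_curve 3 a" by (auto simp: alg_curve_def)
    thus False using line_unbounded[OF v] bounded bounded_subset by blast
  qed
  note parts = tendsto_poly3_parts[of "\<lambda>_. a" a F "\<lambda>_. \<gamma> u", OF tendsto_const tendsto_const velocity]
  have p2: "((\<lambda>s. poly2 3 a (\<gamma> s) / (s - u)\<^sup>2) \<longlongrightarrow> 0) F"
    using vanishing_order_mono[OF p _ \<tau>, of 2] by simp
  have "((\<lambda>s. poly2 3 a (\<gamma> s) / (s - u)\<^sup>2 - poly3_quad a (\<gamma> u) (\<omega> s)) \<longlongrightarrow> 0 - a0) F"
    unfolding a0_def by (intro tendsto_diff p2 parts)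
  moreover have "eventually (\<lambda>s. poly2 3 a (\<gamma> s) / (s - u)\<^sup>2 - poly3_quad a (\<gamma> u) (\<omega> s)
      = l * (Y s / (s - u)\<^sup>2)) F"
    using \<tau>(2)
  proof eventually_elim
    case (elim s)
    have "poly2 3 a (\<gamma> s) = poly3_lin a (\<gamma> u) (frame v (X s) (Y s)) + poly3_quad a (\<gamma> u) (\<gamma> s - \<gamma> u)"
      using at[of "\<gamma> s - \<gamma> u"] by (simp flip: frame_XY)
    moreover have "poly3_lin a (\<gamma> u) (frame v (X s) (Y s)) = l * Y s"
      using a1 by (simp add: poly3_frame l_def n_def)
    moreover have "poly3_quad a (\<gamma> u) (\<gamma> s - \<gamma> u) = (s - u)\<^sup>2 * poly3_quad a (\<gamma> u) (\<omega> s)"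
      using elim unfolding poly3_quad_scale[symmetric] by simp
    moreover have "(l * y + t\<^sup>2 * x) / t\<^sup>2 - x = l * (y / t\<^sup>2)" if "t \<noteq> 0" for t x y :: real
      using that by (simp add: field_simps)
    ultimately show ?case using elim by simp
  qed
  ultimately have "((\<lambda>s. l * (Y s / (s - u)\<^sup>2)) \<longlongrightarrow> 0 - a0) F"
    by (rule Lim_transform_eventually)
  hence ly: "((\<lambda>s. l * (Y s / (s - u)\<^sup>2)) \<longlongrightarrow> - a0) F" by simp
  have l: "l \<noteq> 0"
  proof
    assume "l = 0"
    hence "((\<lambda>s. 0) \<longlongrightarrow> - a0) F" using ly by simp
    from tendsto_unique[OF nt this tendsto_const] show False using a0 by simp
  qed
  define y0 where "y0 = - a0 / l"
  have y: "((\<lambda>s. Y s / (s - u)\<^sup>2) \<longlongrightarrow> y0) F" and y0: "y0 \<noteq> 0"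
    using tendsto_divide[OF ly tendsto_const l] l a0 by (simp_all add: y0_def)
  define \<mu> where "\<mu> = poly3_lin b (\<gamma> u) n / l"
  define c where "c = (\<lambda>i j. b i j - \<mu> * a i j)"
  define \<rho> where "\<rho> = (\<lambda>i :: nat. if i = 0 then poly3_quad c (\<gamma> u) v
     else if i = 1 then poly3_quad' c (\<gamma> u) v n else poly3_quad c (\<gamma> u) n)"
  have c_at: "poly2 3 c (\<gamma> u + frame v A B) = (\<Sum>i\<le>2. \<rho> i * A ^ (2 - i) * B ^ i)" for A B
  proof -
    have "poly2 3 c (\<gamma> u) = 0" unfolding c_def poly3_parts_comb using a1 b1 by simp
    moreover have "poly3_lin c (\<gamma> u) (frame v A B) = 0"
      unfolding c_def poly3_parts_comb poly3_frame using a1 b1 l by (simp add: \<mu>_def l_def n_def)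
    moreover have "poly3_cub c w = 0" for w unfolding c_def poly3_parts_comb conic by simp
    moreover have "(\<Sum>i\<le>2. \<rho> i * A ^ (2 - i) * B ^ i) = \<rho> 0 * A\<^sup>2 + \<rho> 1 * A * B + \<rho> 2 * B\<^sup>2"
      by (simp add: numeral_2_eq_2)
    moreover have "\<rho> 0 = poly3_quad c (\<gamma> u) v" "\<rho> 1 = poly3_quad' c (\<gamma> u) v n" "\<rho> 2 = poly3_quad c (\<gamma> u) n"
      by (simp_all add: \<rho>_def)
    ultimately show ?thesis
      by (simp only: poly3_add poly3_frame(2) n_def)
  qed
  have c4: "((\<lambda>s. poly2 3 c (\<gamma> s) / (s - u) ^ 4) \<longlongrightarrow> \<theta>) F"
  proof -
    have "((\<lambda>s. poly2 3 b (\<gamma> s) / (s - u) ^ 4 - \<mu> * (poly2 3 a (\<gamma> s) / (s - u) ^ 4)) \<longlongrightarrow> \<theta> - \<mu> * 0) F"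
      by (intro tendsto_diff tendsto_mult tendsto_const p q)
    thus ?thesis unfolding c_def poly3_parts_comb by (simp add: diff_divide_distrib)
  qed
  have c_curve: "poly2 3 c (\<gamma> s) = (\<Sum>i\<le>2. \<rho> i * X s ^ (2 - i) * Y s ^ i)" for s
    by (subst frame_XY') (rule c_at)
  have "((\<lambda>s. poly2 3 c (\<gamma> s) / (s - u) ^ 3) \<longlongrightarrow> 0) F"
    by (rule vanishing_order_mono[OF c4 _ \<tau>]) simp
  hence c3: "((\<lambda>s. (\<Sum>i\<le>2. \<rho> i * X s ^ (2 - i) * Y s ^ i) / (s - u) ^ 3) \<longlongrightarrow> 0) F"
    unfolding c_curve .
  have "\<rho> i = 0" if "i \<le> 1" for i
    by (rule low_coefficients_vanish[OF nt \<tau> XY_lim(1) _ y y0 c3]) (use that in auto)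
  hence c_at': "poly2 3 c (\<gamma> u + frame v A B) = \<rho> 2 * B\<^sup>2" for A B
    unfolding c_at by (simp add: numeral_2_eq_2)
  have "((\<lambda>s. \<rho> 2 * (Y s / (s - u)\<^sup>2)\<^sup>2) \<longlongrightarrow> \<rho> 2 * y0\<^sup>2) F"
    by (intro tendsto_intros y)
  moreover have "\<rho> 2 * (Y s / (s - u)\<^sup>2)\<^sup>2 = poly2 3 c (\<gamma> s) / (s - u) ^ 4" for s
    unfolding frame_XY'[of s] c_at' by (simp add: power_divide)
  ultimately have "((\<lambda>s. poly2 3 c (\<gamma> s) / (s - u) ^ 4) \<longlongrightarrow> \<rho> 2 * y0\<^sup>2) F" by simp
  from tendsto_unique[OF nt this c4] have \<theta>_eq: "\<rho> 2 * y0\<^sup>2 = \<theta>" .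
  hence "\<theta> * \<rho> 2 = (\<rho> 2 * y0)\<^sup>2" by (auto simp: power2_eq_square)
  moreover have "\<rho> 2 * y0 \<noteq> 0" using \<theta>_eq \<theta> by auto
  ultimately have sgn: "\<theta> * \<rho> 2 > 0" by simp
  obtain A B where AB: "z - \<gamma> u = frame v A B" using frame_coordinates[OF v] by blast
  hence z': "z = \<gamma> u + frame v A B" by (simp add: algebra_simps)
  have "B \<noteq> 0"
  proof
    assume "B = 0"
    hence "a0 * A\<^sup>2 = 0" using z(1) a1 unfolding z' at poly3_frame by (simp add: a0_def)
    hence "z = \<gamma> u" using a0 \<open>B = 0\<close> by (simp add: z' frame_def flip: zero_prod_def)
    thus False using z(2) by simp
  qed
  moreover have "poly2 3 b z = \<rho> 2 * B\<^sup>2"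
  proof -
    have "poly2 3 c z = poly2 3 b z" unfolding c_def poly3_parts_comb z(1) by simp
    thus ?thesis using c_at' z' by simp
  qed
  ultimately show ?thesis using sgn by (simp flip: mult.assoc)
qed

text \<open>The corresponding statement for cubics: if \<open>b\<close> vanishes along the curve to order exactly 8, then
  it has one sign on the rest of the oval of \<open>a\<close> through \<open>\<gamma> u\<close>, which is given by
  \<open>2 * lin + S = 0\<close>.\<close>

lemma oval_contact_sign:
  assumes smooth: "\<exists>w. poly3_lin a (\<gamma> u) w \<noteq> 0"
    and disc: "\<And>w. w \<noteq> 0 \<Longrightarrow> poly3_disc a (\<gamma> u) w > 0"
    and S: "\<And>w. w \<noteq> 0 \<Longrightarrow> poly3_S a (\<gamma> u) w > 0"
    and a0: "poly3_quad a (\<gamma> u) v > 0"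
    and p: "((\<lambda>s. poly2 3 a (\<gamma> s) / (s - u) ^ 9) \<longlongrightarrow> \<kappa>) F"
    and q: "((\<lambda>s. poly2 3 b (\<gamma> s) / (s - u) ^ 8) \<longlongrightarrow> \<theta>) F" and \<theta>: "\<theta> \<noteq> 0"
    and w: "w \<noteq> 0" "2 * poly3_lin a (\<gamma> u) w + poly3_S a (\<gamma> u) w = 0"
  shows "\<theta> * poly2 3 b (\<gamma> u + w) > 0"
proof -
  note a1 = first_order[OF p] and b1 = first_order[OF q]
  define n where "n = (- snd v, fst v)"
  define l where "l = poly3_lin a (\<gamma> u) n"
  have lin: "poly3_lin a (\<gamma> u) (frame v A B) = l * B" for A B
    using a1 by (simp add: poly3_frame l_def n_def)
  have l: "l \<noteq> 0"
  proof
    assume "l = 0"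
    hence "poly3_lin a (\<gamma> u) w = 0" for w using lin frame_coordinates[OF v, of w] by (metis mult_zero_left)
    thus False using smooth by simp
  qed
  define \<mu> where "\<mu> = poly3_lin b (\<gamma> u) n / l"
  define c where "c = (\<lambda>i j. b i j - \<mu> * a i j)"
  have c_at: "poly2 3 c (\<gamma> u + w) = poly3_quad c (\<gamma> u) w + poly3_cub c w" for w
  proof -
    have "poly2 3 c (\<gamma> u) = 0" unfolding c_def poly3_parts_comb using a1 b1 by simp
    moreover have "poly3_lin c (\<gamma> u) w = 0"
    proof -
      obtain A B where AB: "w = frame v A B" using frame_coordinates[OF v] by blast
      show ?thesis
        unfolding AB c_def poly3_parts_comb poly3_frame using a1 b1 l by (simp add: \<mu>_def l_def n_def)
    qed
    ultimately show ?thesis by (simp add: poly3_add)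
  qed
  have a_at: "poly2 3 a (\<gamma> u + w) = poly3_lin a (\<gamma> u) w + poly3_quad a (\<gamma> u) w + poly3_cub a w" for w
    using a1 by (simp add: poly3_add)
  have p8: "((\<lambda>s. poly2 3 a (\<gamma> s) / (s - u) ^ 8) \<longlongrightarrow> 0) F"
    using vanishing_order_mono[OF p _ \<tau>, of 8] by simp
  have c8: "((\<lambda>s. poly2 3 c (\<gamma> s) / (s - u) ^ 8) \<longlongrightarrow> \<theta>) F"
  proof -
    have "((\<lambda>s. poly2 3 b (\<gamma> s) / (s - u) ^ 8 - \<mu> * (poly2 3 a (\<gamma> s) / (s - u) ^ 8)) \<longlongrightarrow> \<theta> - \<mu> * 0) F"
      by (intro tendsto_diff tendsto_mult tendsto_const p8 q)
    thus ?thesis unfolding c_def poly3_parts_comb by (simp add: diff_divide_distrib)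
  qed
  have frame_nz: "frame v A B \<noteq> 0" if "(A, B) \<noteq> (0, 0)" for A B
  proof
    assume 0: "frame v A B = 0"
    have "(A\<^sup>2 + B\<^sup>2) * ((fst v)\<^sup>2 + (snd v)\<^sup>2) = (fst (frame v A B))\<^sup>2 + (snd (frame v A B))\<^sup>2"
      unfolding frame_def by (simp add: power2_eq_square algebra_simps)
    hence "(A\<^sup>2 + B\<^sup>2) * ((fst v)\<^sup>2 + (snd v)\<^sup>2) = 0" using 0 by simp
    thus False using v that by (auto simp: sum_power2_eq_zero_iff prod_eq_iff)
  qed
  interpret cubic_contact
    "\<lambda>A B. poly3_lin a (\<gamma> u) (frame v A B)" "\<lambda>A B. poly3_quad a (\<gamma> u) (frame v A B)"
    "\<lambda>A B. poly3_cub a (frame v A B)"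
    "\<lambda>A B. poly3_quad c (\<gamma> u) (frame v A B)" "\<lambda>A B. poly3_cub c (frame v A B)"
    "\<lambda>A B. poly3_S a (\<gamma> u) (frame v A B)"
    "\<lambda>A B. poly3_S a (\<gamma> u) (frame v A B) * poly3_quad c (\<gamma> u) (frame v A B)
      - 2 * poly3_lin a (\<gamma> u) (frame v A B) * poly3_cub c (frame v A B)"
    "\<lambda>A B. 2 * poly3_cub a (frame v A B) * poly3_quad c (\<gamma> u) (frame v A B)
      - poly3_S a (\<gamma> u) (frame v A B) * poly3_cub c (frame v A B)"
    "\<lambda>A B. poly3_cub a (frame v A B) * (poly3_quad c (\<gamma> u) (frame v A B))\<^sup>2
      - poly3_quad a (\<gamma> u) (frame v A B) * poly3_quad c (\<gamma> u) (frame v A B) * poly3_cub c (frame v A B)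
      + poly3_lin a (\<gamma> u) (frame v A B) * (poly3_cub c (frame v A B))\<^sup>2"
    l "poly3_quad a (\<gamma> u) v" "poly3_quad' a (\<gamma> u) v n" "poly3_quad a (\<gamma> u) n"
    "poly3_cub a v" "poly3_cub' a v n" "poly3_cub' a n v" "poly3_cub a n"
    "poly3_quad c (\<gamma> u) v" "poly3_quad' c (\<gamma> u) v n" "poly3_quad c (\<gamma> u) n"
    "poly3_cub c v" "poly3_cub' c v n" "poly3_cub' c n v" "poly3_cub c n"
    \<theta> X Y "\<lambda>s. s - u" F
  proof
    show "poly3_lin a (\<gamma> u) (frame v A B) = l * B" for A B by (rule lin)
    show "(\<lambda>A B. poly3_S a (\<gamma> u) (frame v A B)) = (\<lambda>A B. poly3_quad a (\<gamma> u) (frame v A B)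
        + sqrt ((poly3_quad a (\<gamma> u) (frame v A B))\<^sup>2
          - 4 * poly3_lin a (\<gamma> u) (frame v A B) * poly3_cub a (frame v A B)))"
      by (simp add: poly3_S_def poly3_disc_def)
    show "(poly3_quad a (\<gamma> u) (frame v A B))\<^sup>2
        - 4 * poly3_lin a (\<gamma> u) (frame v A B) * poly3_cub a (frame v A B) > 0"
      if "(A, B) \<noteq> (0, 0)" for A B
      using disc[OF frame_nz[OF that]] unfolding poly3_disc_def .
    show "poly3_S a (\<gamma> u) (frame v A B) > 0" if "(A, B) \<noteq> (0, 0)" for A B
      by (rule S[OF frame_nz[OF that]])
    show "((\<lambda>s. (poly3_lin a (\<gamma> u) (frame v (X s) (Y s)) + poly3_quad a (\<gamma> u) (frame v (X s) (Y s))
        + poly3_cub a (frame v (X s) (Y s))) / (s - u) ^ 8) \<longlongrightarrow> 0) F"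
      using p8 unfolding a_at[symmetric] frame_XY'[symmetric] .
    show "((\<lambda>s. (poly3_quad c (\<gamma> u) (frame v (X s) (Y s))
        + poly3_cub c (frame v (X s) (Y s))) / (s - u) ^ 8) \<longlongrightarrow> \<theta>) F"
      using c8 unfolding c_at[symmetric] frame_XY'[symmetric] .
  qed (use l a0 \<theta> nt \<tau> XY_lim in \<open>simp_all add: poly3_frame n_def\<close>)
  obtain A B where AB: "w = frame v A B" using frame_coordinates[OF v] by blast
  have "(A, B) \<noteq> (0, 0)" using w(1) AB by (auto simp: frame_def zero_prod_def)
  from contact_sign[OF this] have "\<theta> * poly2 3 c (\<gamma> u + w) > 0"
    using w(2) unfolding AB c_at by simp
  moreover have "poly2 3 a (\<gamma> u + w) = 0"
  proof -
    have "(poly3_S a (\<gamma> u) w)\<^sup>2 = 2 * poly3_quad a (\<gamma> u) w * poly3_S a (\<gamma> u) w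
        - 4 * poly3_lin a (\<gamma> u) w * poly3_cub a w"
      using S_sq[OF \<open>(A, B) \<noteq> (0, 0)\<close>] AB by simp
    hence "poly3_S a (\<gamma> u) w * poly2 3 a (\<gamma> u + w) = 0"
      using w(2) unfolding a_at by algebra
    thus ?thesis using S[OF w(1)] by simp
  qed
  ultimately show ?thesis unfolding c_def poly3_parts_comb by simp
qed

end

section \<open>Osculating ellipses and ovals\<close>

lemma card_monomials: "card {(i :: nat, j :: nat). i + j \<le> d} = (\<Sum>i\<le>d. Suc (d - i))"
proof -
  have "{(i, j). i + j \<le> d} = (SIGMA i:{..d}. {..d - i})" by auto
  thus ?thesis by simp
qed

lemma monomial_enumeration:
  assumes "CARD('n::finite) = (\<Sum>i\<le>d. Suc (d - i))"
  shows "\<exists>\<beta> :: 'n \<Rightarrow> nat \<times> nat. bij_betw \<beta> UNIV {(i, j). i + j \<le> d}"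
proof (rule finite_same_card_bij)
  have "{(i, j). i + j \<le> d} \<subseteq> {..d} \<times> {..d}" by auto
  thus "finite {(i :: nat, j). i + j \<le> d}" by (rule finite_subset) simp
  show "CARD('n) = card {(i :: nat, j :: nat). i + j \<le> d}" unfolding card_monomials by (rule assms)
qed simp

lemma osculating_families:
  assumes "smooth_regular_curve I \<gamma>" "s0 \<in> I" "t0 \<in> I" "s0 \<noteq> t0"
  shows "(\<And>t. t \<in> I \<Longrightarrow> \<not> extactic 2 I \<gamma> t) \<Longrightarrow> \<exists>a b. osculating_family 2 I \<gamma> a b"
    and "(\<And>t. t \<in> I \<Longrightarrow> \<not> extactic 3 I \<gamma> t) \<Longrightarrow> \<exists>a b. osculating_family 3 I \<gamma> a b"
proof -
  \<comment> \<open>The types 6 and 10 enumerate the monomials of degree at most 2 and at most 3.\<close>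
  have "CARD(6) = (\<Sum>i\<le>2. Suc (2 - i))" by (simp add: numeral_2_eq_2)
  then obtain \<beta>2 :: "6 \<Rightarrow> nat \<times> nat" where \<beta>2: "bij_betw \<beta>2 UNIV {(i, j). i + j \<le> 2}"
    using monomial_enumeration by blast
  have "CARD(10) = (\<Sum>i\<le>3. Suc (3 - i))" by (simp add: numeral_3_eq_3)
  then obtain \<beta>3 :: "10 \<Rightarrow> nat \<times> nat" where \<beta>3: "bij_betw \<beta>3 UNIV {(i, j). i + j \<le> 3}"
    using monomial_enumeration by blast
  show "\<exists>a b. osculating_family 2 I \<gamma> a b" if "\<And>t. t \<in> I \<Longrightarrow> \<not> extactic 2 I \<gamma> t"
    by (rule osculating_family_exists[OF assms that \<beta>2]) (simp_all add: curve_space_dim_def)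
  show "\<exists>a b. osculating_family 3 I \<gamma> a b" if "\<And>t. t \<in> I \<Longrightarrow> \<not> extactic 3 I \<gamma> t"
    by (rule osculating_family_exists[OF assms that \<beta>3]) (simp_all add: curve_space_dim_def)
qed

lemma poly2_coeff_deriv:
  assumes "\<And>i j. ((\<lambda>u. a u i j) has_real_derivative b u i j) (at u within I)"
  shows "((\<lambda>u. poly2 d (a u) z) has_real_derivative poly2 d (b u) z) (at u within I)"
  unfolding poly2_def by (intro DERIV_sum DERIV_cmult_right assms)

lemma contact_curve_velocity:
  assumes \<gamma>: "smooth_regular_curve I \<gamma>" and nt: "\<And>t. t \<in> I \<Longrightarrow> at t within I \<noteq> bot" and u: "u \<in> I"
  shows "contact_curve \<gamma> I u (nderiv_on I 1 \<gamma> u)"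
proof
  show "at u within I \<noteq> bot" using nt u .
  show "nderiv_on I 1 \<gamma> u \<noteq> 0" using \<gamma> u by (simp add: smooth_regular_curve_def)
  note d = smooth_curve_deriv_seqs[OF \<gamma> nt]
  have "((\<lambda>s. fst (\<gamma> s)) has_real_derivative fst (nderiv_on I 1 \<gamma> u)) (at u within I)"
    "((\<lambda>s. snd (\<gamma> s)) has_real_derivative snd (nderiv_on I 1 \<gamma> u)) (at u within I)"
    using d u by (auto simp: deriv_seq_def nderiv_on_def dest!: spec[of _ 0])
  hence "((\<lambda>s. ((fst (\<gamma> s) - fst (\<gamma> u)) / (s - u), (snd (\<gamma> s) - snd (\<gamma> u)) / (s - u)))
      \<longlongrightarrow> (fst (nderiv_on I 1 \<gamma> u), snd (nderiv_on I 1 \<gamma> u))) (at u within I)"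
    unfolding has_field_derivative_iff by (intro tendsto_Pair)
  moreover have "((fst (\<gamma> s) - fst (\<gamma> u)) / (s - u), (snd (\<gamma> s) - snd (\<gamma> u)) / (s - u)) = (\<gamma> s - \<gamma> u) /\<^sub>R (s - u)" for s
    by (simp add: prod_eq_iff divide_inverse mult.commute)
  ultimately show "((\<lambda>s. (\<gamma> s - \<gamma> u) /\<^sub>R (s - u)) \<longlongrightarrow> nderiv_on I 1 \<gamma> u) (at u within I)"
    by simp
qed

text \<open>The normalised equation of the osculating conic, evaluated at a fixed point \<open>x\<close>,
  crosses zero downwards whenever \<open>x\<close> lies on the conic.\<close>

theorem osculating_conics_disjoint:
  assumes \<gamma>: "smooth_regular_curve I \<gamma>" and ext: "\<And>t. t \<in> I \<Longrightarrow> \<not> extactic 2 I \<gamma> t"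
    and ell: "\<And>t a. t \<in> I \<Longrightarrow> osculates 2 I \<gamma> t a \<Longrightarrow> is_ellipse (alg_curve 2 a)"
    and st: "s \<in> I" "t \<in> I" "s \<noteq> t" and osc: "osculates 2 I \<gamma> s a" "osculates 2 I \<gamma> t b"
  shows "alg_curve 2 a \<inter> alg_curve 2 b = {}"
proof (rule equals0I)
  fix x assume x: "x \<in> alg_curve 2 a \<inter> alg_curve 2 b"
  have I: "is_interval I" using \<gamma> by (simp add: smooth_regular_curve_def)
  have nt: "at t within I \<noteq> bot" if "t \<in> I" for t using interval_at_within_nontrivial[OF I st that] .
  obtain p q where fam: "osculating_family 2 I \<gamma> p q" using osculating_families(1)[OF \<gamma> st ext] by blast
  define cut :: "(nat \<Rightarrow> nat \<Rightarrow> real) \<Rightarrow> nat \<Rightarrow> nat \<Rightarrow> real"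
    where "cut = (\<lambda>c i j. if i + j \<le> 2 then c i j else 0)"
  have cut: "poly2 3 (cut c) z = poly2 2 c z" for c z
    unfolding poly3_explicit by (simp add: cut_def poly2_def numeral_2_eq_2 power2_eq_square)
  have cut_cub: "poly3_cub (cut c) w = 0" for c w by (simp add: poly3_cub_def cut_def)
  have n: "curve_space_dim 2 = 5" by (simp add: curve_space_dim_def)
  define f where "f = (\<lambda>u. poly2 2 (p u) x)"
  have df: "(f has_real_derivative poly2 2 (q u) x) (at u within I)" if "u \<in> I" for u
    unfolding f_def using fam that by (intro poly2_coeff_deriv) (simp add: osculating_family_def)
  have "eventually (\<lambda>r. - 1 * f r * (r - u) > 0) (at u within I)" if u: "u \<in> I" and fu: "f u = 0" for u
  proof (cases "x = \<gamma> u")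
    case True
    have "((\<lambda>s. f s / (u - s) ^ 5) \<longlongrightarrow> 1 / fact 5) (at u within I)"
      using fam u unfolding f_def True osculating_family_def n by blast
    thus ?thesis by (rule crossing_from_odd_order) auto
  next
    case False
    interpret contact_curve \<gamma> I u "nderiv_on I 1 \<gamma> u" by (rule contact_curve_velocity[OF \<gamma> nt u])
    have "(- 1 / fact 4) * poly2 3 (cut (q u)) x > 0"
    proof (rule conic_contact_sign[where a = "cut (p u)"])
      have "is_ellipse (alg_curve 2 (p u))" using ell u fam unfolding osculating_family_def by blast
      then obtain L :: "real \<times> real \<Rightarrow> real \<times> real" and b where
        L: "linear L" "alg_curve 2 (p u) = (\<lambda>z. L z + b) ` sphere 0 1"
        unfolding is_ellipse_def by blast
      have "compact (alg_curve 2 (p u))"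
        unfolding L(2) using L(1)
        by (intro compact_continuous_image continuous_intros linear_continuous_on) (auto simp: linear_conv_bounded_linear)
      thus "bounded (alg_curve 3 (cut (p u)))"
        by (simp add: alg_curve_def cut compact_imp_bounded)
      have "((\<lambda>s. poly2 2 (p u) (\<gamma> s) / (s - u) ^ 5) \<longlongrightarrow> 1 / fact 5) (at u within I)"
        using fam u unfolding osculating_family_def n by blast
      from vanishing_order_mono[OF this _ \<tau>, of 4]
      show "((\<lambda>s. poly2 3 (cut (p u)) (\<gamma> s) / (s - u) ^ 4) \<longlongrightarrow> 0) (at u within I)"
        by (simp add: cut)
      have "((\<lambda>s. poly2 2 (q u) (\<gamma> s) / (s - u) ^ (5 - 1)) \<longlongrightarrow> - 1 / fact (5 - 1)) (at u within I)"
        using fam u unfolding osculating_family_def n by blast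
      thus "((\<lambda>s. poly2 3 (cut (q u)) (\<gamma> s) / (s - u) ^ 4) \<longlongrightarrow> - 1 / fact 4) (at u within I)"
        by (simp add: cut)
    qed (use cut_cub fu False in \<open>auto simp: cut f_def\<close>)
    hence "- 1 * poly2 2 (q u) x > 0" by (simp add: cut fact_numeral)
    thus ?thesis by (rule crossing_from_derivative[OF df[OF u] fu])
  qed
  moreover have "continuous_on I f"
    unfolding continuous_on_eq_continuous_within using df DERIV_continuous by blast
  moreover have "f s = 0" "f t = 0"
  proof -
    have "alg_curve 2 a = alg_curve 2 (p s)" "alg_curve 2 b = alg_curve 2 (p t)"
      using fam osc st unfolding osculating_family_def by blast+
    thus "f s = 0" "f t = 0" using x by (auto simp: f_def alg_curve_def)
  qed
  ultimately have "s = t" using unique_zero_of_one_way_crossing[OF I, of f "- 1" s t] st by blast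
  thus False using st by simp
qed

lemma nonsingular_cubic_gradient:
  assumes "nonsingular_curve 3 a" "z \<in> alg_curve 3 a"
  shows "\<exists>w. poly3_lin a z w \<noteq> 0"
proof (rule ccontr)
  assume "\<not> ?thesis"
  hence lin: "poly3_lin a z w = 0" for w by blast
  define x y where "x = fst z" and "y = snd z"
  have p: "poly2 3 a z = 0" using assms(2) by (simp add: alg_curve_def)
  \<comment> \<open>The partial derivatives at the affine point; the one in the third variable follows from
    Euler's identity.\<close>
  define gx where "gx = a 1 0 + 2 * a 2 0 * x + a 1 1 * y + 3 * a 3 0 * x\<^sup>2 + 2 * a 2 1 * x * y + a 1 2 * y\<^sup>2"
  define gy where "gy = a 0 1 + a 1 1 * x + 2 * a 0 2 * y + a 2 1 * x\<^sup>2 + 2 * a 1 2 * x * y + 3 * a 0 3 * y\<^sup>2"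
  define gz where "gz = 3 * a 0 0 + 2 * (a 1 0 * x + a 0 1 * y) + (a 2 0 * x\<^sup>2 + a 1 1 * x * y + a 0 2 * y\<^sup>2)"
  have gx: "gx = 0" using lin[of "(1, 0)"] by (simp add: poly3_lin_def gx_def x_def y_def)
  have gy: "gy = 0" using lin[of "(0, 1)"] by (simp add: poly3_lin_def gy_def x_def y_def)
  have "gz = 3 * poly2 3 a z - x * gx - y * gy"
    unfolding poly3_explicit gx_def gy_def gz_def x_def[symmetric] y_def[symmetric]
    by (simp add: algebra_simps power2_eq_square power3_eq_cube)
  hence gz: "gz = 0" using p gx gy by simp
  define c where "c = (\<lambda>i j. complex_of_real (a i j))"
  have hom: "homogenization 3 a X Y Z = c 0 0 * Z ^ 3 + (c 1 0 * X + c 0 1 * Y) * Z\<^sup>2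
      + (c 2 0 * X\<^sup>2 + c 1 1 * X * Y + c 0 2 * Y\<^sup>2) * Z
      + c 3 0 * X ^ 3 + c 2 1 * X\<^sup>2 * Y + c 1 2 * X * Y\<^sup>2 + c 0 3 * Y ^ 3" for X Y Z
    unfolding homogenization_def c_def by (simp add: eval_nat_numeral algebra_simps)
  let ?x = "complex_of_real x" and ?y = "complex_of_real y"
  have "homogenization 3 a ?x ?y 1 = complex_of_real (poly2 3 a z)"
    unfolding hom poly3_explicit c_def x_def y_def by simp
  hence "homogenization 3 a ?x ?y 1 = 0" using p by simp
  moreover have "((\<lambda>u. homogenization 3 a u ?y 1) has_field_derivative complex_of_real gx) (at ?x)"
    unfolding hom gx_def c_def by (auto intro!: derivative_eq_intros simp: power2_eq_square algebra_simps)
  moreover have "((\<lambda>u. homogenization 3 a ?x u 1) has_field_derivative complex_of_real gy) (at ?y)"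
    unfolding hom gy_def c_def by (auto intro!: derivative_eq_intros simp: power2_eq_square algebra_simps)
  moreover have "((\<lambda>u. homogenization 3 a ?x ?y u) has_field_derivative complex_of_real gz) (at 1)"
    unfolding hom gz_def c_def by (auto intro!: derivative_eq_intros simp: power2_eq_square algebra_simps)
  ultimately show False
    using assms(1) gx gy gz unfolding nonsingular_curve_def
    by (metis DERIV_imp_deriv of_real_0 prod.inject zero_neq_one)
qed

lemma is_oval_bounded: "is_oval C \<Longrightarrow> bounded C"
  unfolding is_oval_def using compact_simple_path_image compact_imp_bounded by blast

lemma is_oval_minus_point_connected:
  assumes "is_oval C" "z \<in> C"
  shows "connected (C - {z})"
proof -
  obtain g where g: "simple_path g" "pathfinish g = pathstart g" "path_image g = C"
    using assms(1) unfolding is_oval_def by blast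
  then obtain \<tau> where \<tau>: "\<tau> \<in> {0..1}" "g \<tau> = z" using assms(2) by (auto simp: path_image_def)
  define h where "h = shiftpath \<tau> g"
  have "simple_path h" "path_image h = C" "pathstart h = z" "pathfinish h = z"
    using g \<tau> simple_path_shiftpath[of g \<tau>] path_image_shiftpath[of \<tau> g]
      pathstart_shiftpath[of \<tau> g] pathfinish_shiftpath[of \<tau> g]
    by (simp_all add: h_def)
  thus ?thesis using connected_simple_path_endless[of h] by simp
qed

lemma cubic_ovalI:
  assumes "nonsingular_curve 3 a" "components (alg_curve 3 a) = {C, B}" "is_oval C" "\<not> bounded B"
    and "z \<in> C" "v \<noteq> 0" "poly3_lin a z v = 0"
  shows "cubic_oval a z v C B"
proof
  have cl: "closed (alg_curve 3 a)"
    unfolding alg_curve_def poly3_explicit by (intro closed_Collect_eq continuous_intros)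
  have comp: "C \<in> components (alg_curve 3 a)" "B \<in> components (alg_curve 3 a)" using assms(2) by auto
  show "alg_curve 3 a = C \<union> B" using Union_components[of "alg_curve 3 a"] assms(2) by simp
  show "closed C" "closed B" using closed_components[OF cl] comp by auto
  show b: "bounded C" using is_oval_bounded assms(3) .
  show "C \<inter> B = {}" using components_eq[OF comp] b assms(4) by blast
  show "connected (C - {z})" using is_oval_minus_point_connected assms by blast
  show "\<exists>w. poly3_lin a z w \<noteq> 0" if "z \<in> alg_curve 3 a" for z
    using nonsingular_cubic_gradient[OF assms(1) that] .
qed (use assms in auto)

lemma poly3_parts_scale:
  "poly2 3 (\<lambda>i j. c * a i j) z = c * poly2 3 a z"
  "poly3_lin (\<lambda>i j. c * a i j) z w = c * poly3_lin a z w"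
  "poly3_quad (\<lambda>i j. c * a i j) z w = c * poly3_quad a z w"
  "poly3_cub (\<lambda>i j. c * a i j) w = c * poly3_cub a w"
  unfolding poly3_explicit poly3_lin_def poly3_quad_def poly3_cub_def by (simp_all add: algebra_simps)

text \<open>For a point \<open>z\<close> of the oval of \<open>a\<close>, and for the sign of the equation used above, the zero set of
  \<open>branch_fun a z\<close> contains that oval, translated by \<open>- z\<close>, but not the rest of the cubic.
  Its product with the conjugate is the equation of the cubic up to the factor \<open>4 * lin\<close>.\<close>

definition branch_fun :: "(nat \<Rightarrow> nat \<Rightarrow> real) \<Rightarrow> real \<times> real \<Rightarrow> real \<times> real \<Rightarrow> real" where
  "branch_fun a z w = 2 * poly3_lin a z w + poly3_S a z w"

definition conj_branch_fun :: "(nat \<Rightarrow> nat \<Rightarrow> real) \<Rightarrow> real \<times> real \<Rightarrow> real \<times> real \<Rightarrow> real" where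
  "conj_branch_fun a z w = 2 * poly3_lin a z w + poly3_quad a z w - sqrt (poly3_disc a z w)"

lemma branch_fun_mult_conj:
  assumes "poly3_disc a z w \<ge> 0" "poly2 3 a z = 0"
  shows "branch_fun a z w * conj_branch_fun a z w = 4 * poly3_lin a z w * poly2 3 a (z + w)"
proof -
  have "(sqrt (poly3_disc a z w))\<^sup>2 = (poly3_quad a z w)\<^sup>2 - 4 * poly3_lin a z w * poly3_cub a w"
    using assms(1) by (simp add: poly3_disc_def)
  moreover have "poly2 3 a (z + w) = poly3_lin a z w + poly3_quad a z w + poly3_cub a w"
    by (simp add: poly3_add assms)
  ultimately show ?thesis unfolding branch_fun_def conj_branch_fun_def poly3_S_def by algebra
qed

lemma tendsto_branch_fun:
  assumes "\<And>i j. ((\<lambda>u. A u i j) \<longlongrightarrow> a i j) F" "(z \<longlongrightarrow> z0) F" "(w \<longlongrightarrow> w0) F"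
  shows "((\<lambda>u. branch_fun (A u) (z u) (w u)) \<longlongrightarrow> branch_fun a z0 w0) F"
    "((\<lambda>u. conj_branch_fun (A u) (z u) (w u)) \<longlongrightarrow> conj_branch_fun a z0 w0) F"
proof -
  note parts = tendsto_poly3_parts[of A a F z z0 w w0, OF assms]
  show "((\<lambda>u. branch_fun (A u) (z u) (w u)) \<longlongrightarrow> branch_fun a z0 w0) F"
    "((\<lambda>u. conj_branch_fun (A u) (z u) (w u)) \<longlongrightarrow> conj_branch_fun a z0 w0) F"
    unfolding branch_fun_def conj_branch_fun_def poly3_S_def poly3_disc_def
    by (intro tendsto_intros parts)+
qed

text \<open>The equation \<open>P u\<close> of the osculating cubic at \<open>\<gamma> u\<close>, evaluated at a fixed point \<open>x\<close>, may also vanish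
  when \<open>x\<close> lies on the infinite branch, where its derivative can have any sign. It is therefore
  replaced by \<open>h u\<close>, which vanishes only if \<open>x\<close> lies on the oval, and which has the sign of \<open>P u\<close> for
  parameters close to such a \<open>u\<close>.\<close>

theorem osculating_cubic_ovals_disjoint:
  assumes \<gamma>: "smooth_regular_curve I \<gamma>" and ext: "\<And>t. t \<in> I \<Longrightarrow> \<not> extactic 3 I \<gamma> t"
    and cub: "\<And>t a. t \<in> I \<Longrightarrow> osculates 3 I \<gamma> t a \<Longrightarrow> nonsingular_curve 3 a \<and>
         (\<exists>C B. components (alg_curve 3 a) = {C, B} \<and> is_oval C \<and> \<not> bounded B \<and> \<gamma> t \<in> C)"
    and st: "s \<in> I" "t \<in> I" "s \<noteq> t" and osc: "osculates 3 I \<gamma> s a" "osculates 3 I \<gamma> t b"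
    and C: "C \<in> components (alg_curve 3 a)" "is_oval C"
    and D: "D \<in> components (alg_curve 3 b)" "is_oval D"
  shows "C \<inter> D = {}"
proof (rule equals0I)
  fix x assume x: "x \<in> C \<inter> D"
  have I: "is_interval I" using \<gamma> by (simp add: smooth_regular_curve_def)
  have nt: "at t within I \<noteq> bot" if "t \<in> I" for t using interval_at_within_nontrivial[OF I st that] .
  obtain p0 q0 where fam: "osculating_family 3 I \<gamma> p0 q0" using osculating_families(2)[OF \<gamma> st ext] by blast
  have n: "curve_space_dim 3 = 9" by (simp add: curve_space_dim_def)
  define v where "v = nderiv_on I 1 \<gamma>"
  have cc: "contact_curve \<gamma> I u (v u)" if "u \<in> I" for u
    unfolding v_def by (rule contact_curve_velocity[OF \<gamma> nt that])
  have oval0: "\<exists>K B. components (alg_curve 3 (p0 u)) = {K, B} \<and> \<not> bounded B \<and> cubic_oval (p0 u) (\<gamma> u) (v u) K B"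
    if u: "u \<in> I" for u
  proof -
    interpret contact_curve \<gamma> I u "v u" by (rule cc[OF u])
    have "osculates 3 I \<gamma> u (p0 u)" using fam u unfolding osculating_family_def by blast
    from cub[OF u this] obtain K B where KB: "nonsingular_curve 3 (p0 u)"
      "components (alg_curve 3 (p0 u)) = {K, B}" "is_oval K" "\<not> bounded B" "\<gamma> u \<in> K"
      by (elim conjE exE) (rule that)
    have "((\<lambda>s. poly2 3 (p0 u) (\<gamma> s) / (s - u) ^ 9) \<longlongrightarrow> 1 / fact 9) (at u within I)"
      using fam u unfolding osculating_family_def n by blast
    from first_order(2)[OF this] have "poly3_lin (p0 u) (\<gamma> u) (v u) = 0" by simp
    from cubic_ovalI[OF KB v this] KB(2,4) show ?thesis by (intro exI conjI)
  qed
  have p0_lim: "((\<lambda>r. p0 r i j) \<longlongrightarrow> p0 u i j) (at u within I)" if "u \<in> I" for u i j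
    using fam that DERIV_continuous unfolding osculating_family_def continuous_within by blast
  have \<gamma>_lim: "(\<gamma> \<longlongrightarrow> \<gamma> u) (at u within I)" if u: "u \<in> I" for u
  proof -
    interpret contact_curve \<gamma> I u "v u" by (rule cc[OF u])
    have "((\<lambda>s. \<gamma> u + (s - u) *\<^sub>R ((\<gamma> s - \<gamma> u) /\<^sub>R (s - u))) \<longlongrightarrow> \<gamma> u + 0 *\<^sub>R v u) (at u within I)"
      by (intro tendsto_add tendsto_scaleR tendsto_const \<tau> velocity)
    hence "((\<lambda>s. \<gamma> u + (s - u) *\<^sub>R ((\<gamma> s - \<gamma> u) /\<^sub>R (s - u))) \<longlongrightarrow> \<gamma> u) (at u within I)" by simp
    moreover have "eventually (\<lambda>s. \<gamma> u + (s - u) *\<^sub>R ((\<gamma> s - \<gamma> u) /\<^sub>R (s - u)) = \<gamma> s) (at u within I)"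
      using \<tau>(2) by eventually_elim simp
    ultimately show ?thesis by (rule Lim_transform_eventually)
  qed
  have v_lim: "(v \<longlongrightarrow> v u) (at u within I)" if u: "u \<in> I" for u
  proof -
    note d = smooth_curve_deriv_seqs[OF \<gamma> nt]
    have "((\<lambda>s. fst (v s)) \<longlongrightarrow> fst (v u)) (at u within I)" "((\<lambda>s. snd (v s)) \<longlongrightarrow> snd (v u)) (at u within I)"
      using d u DERIV_continuous unfolding deriv_seq_def v_def continuous_within by blast+
    from tendsto_Pair[OF this] show ?thesis by simp
  qed
  \<comment> \<open>The sign of the second derivative of the cubic along its tangent does not depend on the point.\<close>
  have quad_cont: "continuous_on I (\<lambda>u. poly3_quad (p0 u) (\<gamma> u) (v u))"
    unfolding continuous_on_def by (intro ballI tendsto_poly3_parts p0_lim \<gamma>_lim v_lim)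
  have quad_nz: "poly3_quad (p0 u) (\<gamma> u) (v u) \<noteq> 0" if "u \<in> I" for u
    using oval0[OF that] by (elim exE conjE) (rule cubic_oval.flex_free)
  obtain \<epsilon> :: real where \<epsilon>: "\<epsilon> = 1 \<or> \<epsilon> = - 1" "\<And>u. u \<in> I \<Longrightarrow> \<epsilon> * poly3_quad (p0 u) (\<gamma> u) (v u) > 0"
    by (rule continuous_nonvanishing_same_sign[OF I quad_cont quad_nz]) (assumption | rule that)+
  have \<epsilon>0: "\<epsilon> \<noteq> 0" "\<epsilon> * \<epsilon> = 1" using \<epsilon>(1) by auto
  define p where "p = (\<lambda>u i j. \<epsilon> * p0 u i j)"
  define q where "q = (\<lambda>u i j. \<epsilon> * q0 u i j)"
  have same: "alg_curve 3 (p u) = alg_curve 3 (p0 u)" for u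
    using \<epsilon>0 by (simp add: alg_curve_def p_def poly3_parts_scale)
  have oval: "\<exists>K B. components (alg_curve 3 (p0 u)) = {K, B} \<and> \<not> bounded B \<and> positive_cubic_oval (p u) (\<gamma> u) (v u) K B"
    if u: "u \<in> I" for u
  proof -
    obtain K B where KB: "components (alg_curve 3 (p0 u)) = {K, B}" "\<not> bounded B"
      and o: "cubic_oval (p0 u) (\<gamma> u) (v u) K B"
      using oval0[OF u] by (elim conjE exE) (rule that)
    have "positive_cubic_oval (p u) (\<gamma> u) (v u) K B"
      using o \<epsilon>(2)[OF u] \<epsilon>0
      unfolding positive_cubic_oval_def positive_cubic_oval_axioms_def cubic_oval_def same
      by (simp add: p_def poly3_parts_scale)
    with KB show ?thesis by (intro exI conjI)
  qed
  have p_lim: "((\<lambda>r. p r i j) \<longlongrightarrow> p u i j) (at u within I)" if "u \<in> I" for u i j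
    unfolding p_def by (intro tendsto_intros p0_lim that)
  have disc: "poly3_disc (p u) (\<gamma> u) w > 0" "poly3_S (p u) (\<gamma> u) w > 0" if "u \<in> I" "w \<noteq> 0" for u w
  proof -
    obtain K B where "positive_cubic_oval (p u) (\<gamma> u) (v u) K B"
      using oval[OF \<open>u \<in> I\<close>] by (elim exE conjE) (rule that)
    then interpret positive_cubic_oval "p u" "\<gamma> u" "v u" K B .
    show "poly3_disc (p u) (\<gamma> u) w > 0" "poly3_S (p u) (\<gamma> u) w > 0" using disc_pos S_pos that by auto
  qed
  have disc0: "poly3_disc (p u) (\<gamma> u) w \<ge> 0" if "u \<in> I" for u w
    using disc(1)[OF that, of w] by (cases "w = 0") (auto simp: poly3_disc_def poly3_lin_def poly3_quad_def)
  have base: "poly2 3 (p u) (\<gamma> u) = 0" if "u \<in> I" for u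
  proof -
    obtain K B where "positive_cubic_oval (p u) (\<gamma> u) (v u) K B"
      using oval[OF \<open>u \<in> I\<close>] by (elim exE conjE) (rule that)
    then interpret positive_cubic_oval "p u" "\<gamma> u" "v u" K B .
    show ?thesis using z0 curve by (auto simp: alg_curve_def)
  qed
  define h where "h = (\<lambda>u. branch_fun (p u) (\<gamma> u) (x - \<gamma> u))"
  define h' where "h' = (\<lambda>u. conj_branch_fun (p u) (\<gamma> u) (x - \<gamma> u))"
  define lx where "lx = (\<lambda>u. poly3_lin (p u) (\<gamma> u) (x - \<gamma> u))"
  define P where "P = (\<lambda>u. poly2 3 (p u) x)"
  have prod: "h u * h' u = 4 * lx u * P u" if "u \<in> I" for u
    using branch_fun_mult_conj[OF disc0[OF that] base[OF that], of "x - \<gamma> u"]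
    by (simp add: h_def h'_def lx_def P_def)
  have h_lim: "(h \<longlongrightarrow> h u) (at u within I)" "(h' \<longlongrightarrow> h' u) (at u within I)" "(lx \<longlongrightarrow> lx u) (at u within I)"
    if "u \<in> I" for u
    unfolding h_def h'_def lx_def
    by (intro tendsto_branch_fun tendsto_poly3_parts tendsto_diff tendsto_const p_lim \<gamma>_lim that)+
  have on: "h u = 0" if u: "u \<in> I" and A: "A \<in> components (alg_curve 3 (p0 u))" "is_oval A" "x \<in> A" for u A
  proof -
    obtain K B where KB: "components (alg_curve 3 (p0 u)) = {K, B}" "\<not> bounded B"
      and o: "positive_cubic_oval (p u) (\<gamma> u) (v u) K B"
      using oval[OF u] by (elim conjE exE) (rule that)
    interpret positive_cubic_oval "p u" "\<gamma> u" "v u" K B by (rule o)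
    have "A = K" using A KB is_oval_bounded by blast
    thus ?thesis using on_oval[of x] A(3) by (simp add: h_def branch_fun_def)
  qed
  have cross: "eventually (\<lambda>r. - \<epsilon> * h r * (r - u) > 0) (at u within I)" if u: "u \<in> I" and hu: "h u = 0" for u
  proof -
    interpret contact_curve \<gamma> I u "v u" by (rule cc[OF u])
    obtain K B where "positive_cubic_oval (p u) (\<gamma> u) (v u) K B" using oval[OF u] by (elim exE conjE) (rule that)
    then interpret positive_cubic_oval "p u" "\<gamma> u" "v u" K B .
    have "eventually (\<lambda>r. h' r * lx r > 0) (at u within I) \<and> eventually (\<lambda>r. - \<epsilon> * P r * (r - u) > 0) (at u within I)"
    proof (cases "x = \<gamma> u")
      case True
      have "((\<lambda>r. poly2 3 (p0 r) (\<gamma> u) / (u - r) ^ 9) \<longlongrightarrow> 1 / fact 9) (at u within I)"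
        using fam u unfolding osculating_family_def n by blast
      hence P9: "((\<lambda>r. \<epsilon> * P r / (u - r) ^ 9) \<longlongrightarrow> 1 / fact 9) (at u within I)"
        using \<epsilon>0 by (simp add: P_def p_def poly3_parts_scale True flip: mult.assoc)
      have "eventually (\<lambda>r. - 1 * (\<epsilon> * P r) * (r - u) > 0) (at u within I)"
        by (rule crossing_from_odd_order[OF P9]) auto
      hence 1: "eventually (\<lambda>r. - \<epsilon> * P r * (r - u) > 0) (at u within I)" by simp
      \<comment> \<open>Here \<open>\lx\<close> and \<open>h'\<close> vanish to order 2 at \<open>u\<close>. The functions \<open>L\<close> and \<open>H\<close> are their quotients by
        \<open>(r - u)\<^sup>2\<close>, with limits \<open>- a0\<close> and \<open>- 2 * a0\<close>.\<close>
      define \<omega> where "\<omega> = (\<lambda>r. (\<gamma> r - \<gamma> u) /\<^sub>R (r - u))"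
      have \<omega>: "(\<omega> \<longlongrightarrow> v u) (at u within I)" unfolding \<omega>_def by (rule velocity)
      define a0 where "a0 = poly3_quad (p u) (\<gamma> u) (v u)"
      have a0: "a0 > 0" using quad_pos by (simp add: a0_def)
      define Q where "Q = (\<lambda>r. poly3_quad (p r) (\<gamma> r) (\<omega> r))"
      define c where "c = (\<lambda>r. poly3_cub (p r) (\<omega> r))"
      have Q: "(Q \<longlongrightarrow> a0) (at u within I)" and c: "(c \<longlongrightarrow> poly3_cub (p u) (v u)) (at u within I)"
        unfolding Q_def c_def a0_def by (rule tendsto_poly3_parts[OF p_lim[OF u] \<gamma>_lim[OF u] \<omega>])+
      have "((\<lambda>r. \<epsilon> * P r / (u - r)\<^sup>2) \<longlongrightarrow> 0) (at u within I)"
      proof (rule vanishing_order_mono[OF P9])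
        show "((\<lambda>r. u - r) \<longlongrightarrow> 0) (at u within I)" using tendsto_minus[OF \<tau>(1)] by simp
        show "eventually (\<lambda>r. u - r \<noteq> 0) (at u within I)" using \<tau>(2) by eventually_elim simp
      qed simp
      from tendsto_mult[OF tendsto_const this, of \<epsilon>]
      have P2: "((\<lambda>r. P r / (r - u)\<^sup>2) \<longlongrightarrow> 0) (at u within I)"
        using \<epsilon>0 by (simp add: power2_commute[of u] flip: mult.assoc)
      define L where "L = (\<lambda>r. P r / (r - u)\<^sup>2 - Q r + (r - u) * c r)"
      have "(L \<longlongrightarrow> 0 - a0 + 0 * poly3_cub (p u) (v u)) (at u within I)"
        unfolding L_def by (intro tendsto_intros P2 Q c \<tau>)
      hence L: "(L \<longlongrightarrow> - a0) (at u within I)" by simp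
      define H where "H = (\<lambda>r. 2 * L r + Q r - sqrt ((Q r)\<^sup>2 + 4 * L r * ((r - u) * c r)))"
      have "(H \<longlongrightarrow> 2 * (- a0) + a0 - sqrt (a0\<^sup>2 + 4 * (- a0) * (0 * poly3_cub (p u) (v u)))) (at u within I)"
        unfolding H_def by (intro tendsto_intros L Q c \<tau>)
      hence H: "(H \<longlongrightarrow> - 2 * a0) (at u within I)" using a0 by simp
      have "((\<lambda>r. H r * L r) \<longlongrightarrow> - 2 * a0 * - a0) (at u within I)" by (intro tendsto_mult H L)
      hence "eventually (\<lambda>r. H r * L r > 0) (at u within I)"
        by (rule order_tendstoD(1)) (use a0 in simp)
      moreover have "eventually (\<lambda>r. r \<in> I) (at u within I)" by (simp add: eventually_at_filter)
      ultimately have "eventually (\<lambda>r. h' r * lx r > 0) (at u within I)"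
        using \<tau>(2)
      proof eventually_elim
        case (elim r)
        have "(r - u) *\<^sub>R \<omega> r = \<gamma> r - \<gamma> u" using elim(3) by (simp add: \<omega>_def)
        hence w: "x - \<gamma> r = (- (r - u)) *\<^sub>R \<omega> r" unfolding True scaleR_minus_left by simp
        have quad: "poly3_quad (p r) (\<gamma> r) (x - \<gamma> r) = (r - u)\<^sup>2 * Q r"
          unfolding w poly3_quad_scale Q_def by algebra
        have cub: "poly3_cub (p r) (x - \<gamma> r) = - ((r - u) ^ 3 * c r)"
          unfolding w poly3_cub_scale c_def by algebra
        have "P r = lx r + (r - u)\<^sup>2 * Q r - (r - u) ^ 3 * c r"
          using poly3_add[of "p r" "\<gamma> r" "x - \<gamma> r"] base[OF elim(2)] by (simp add: P_def lx_def quad cub)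
        moreover have "(r - u)\<^sup>2 * L r = P r - (r - u)\<^sup>2 * Q r + (r - u) ^ 3 * c r"
          unfolding L_def using elim(3) by (simp add: distrib_left right_diff_distrib power2_eq_square power3_eq_cube)
        ultimately have lx: "lx r = (r - u)\<^sup>2 * L r" by simp
        have "poly3_disc (p r) (\<gamma> r) (x - \<gamma> r) = ((r - u)\<^sup>2)\<^sup>2 * ((Q r)\<^sup>2 + 4 * L r * ((r - u) * c r))"
          unfolding poly3_disc_def quad cub lx[unfolded lx_def] by algebra
        hence "sqrt (poly3_disc (p r) (\<gamma> r) (x - \<gamma> r)) = (r - u)\<^sup>2 * sqrt ((Q r)\<^sup>2 + 4 * L r * ((r - u) * c r))"
          by (simp only: real_sqrt_mult real_sqrt_abs abs_power2)
        hence "h' r = (r - u)\<^sup>2 * H r"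
          unfolding h'_def conj_branch_fun_def quad lx[unfolded lx_def] H_def by (simp add: algebra_simps)
        hence "h' r * lx r = ((r - u)\<^sup>2)\<^sup>2 * (H r * L r)" using lx by (simp add: power2_eq_square)
        thus ?case using elim by (simp add: zero_less_mult_iff)
      qed
      thus ?thesis using 1 by blast
    next
      case False
      hence w: "x - \<gamma> u \<noteq> 0" by simp
      have S: "poly3_S (p u) (\<gamma> u) (x - \<gamma> u) > 0" and d: "poly3_disc (p u) (\<gamma> u) (x - \<gamma> u) > 0"
        using disc[OF u w] by auto
      have hu': "2 * poly3_lin (p u) (\<gamma> u) (x - \<gamma> u) + poly3_S (p u) (\<gamma> u) (x - \<gamma> u) = 0"
        using hu by (simp add: h_def branch_fun_def)
      have "lx u < 0" using hu' S by (simp add: lx_def)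
      moreover have "h' u = - 2 * sqrt (poly3_disc (p u) (\<gamma> u) (x - \<gamma> u))"
        using hu' by (simp add: h'_def conj_branch_fun_def poly3_S_def)
      hence "h' u < 0" using d by simp
      ultimately have "h' u * lx u > 0" by (simp add: mult_neg_neg)
      hence 1: "eventually (\<lambda>r. h' r * lx r > 0) (at u within I)"
        using order_tendstoD(1)[OF tendsto_mult[OF h_lim(2,3)[OF u]]] by blast
      have "(- \<epsilon> / fact 8) * poly2 3 (q u) (\<gamma> u + (x - \<gamma> u)) > 0"
      proof (rule oval_contact_sign[where a = "p u" and \<kappa> = "\<epsilon> / fact 9"])
        show "\<exists>w. poly3_lin (p u) (\<gamma> u) w \<noteq> 0" using smooth z0 curve by blast
        have "((\<lambda>s. poly2 3 (p0 u) (\<gamma> s) / (s - u) ^ 9) \<longlongrightarrow> 1 / fact 9) (at u within I)"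
          using fam u unfolding osculating_family_def n by blast
        from tendsto_mult[OF tendsto_const this, of \<epsilon>]
        show "((\<lambda>s. poly2 3 (p u) (\<gamma> s) / (s - u) ^ 9) \<longlongrightarrow> \<epsilon> / fact 9) (at u within I)"
          by (simp add: p_def poly3_parts_scale)
        have "((\<lambda>s. poly2 3 (q0 u) (\<gamma> s) / (s - u) ^ (9 - 1)) \<longlongrightarrow> - 1 / fact (9 - 1)) (at u within I)"
          using fam u unfolding osculating_family_def n by blast
        from tendsto_mult[OF tendsto_const this, of \<epsilon>]
        show "((\<lambda>s. poly2 3 (q u) (\<gamma> s) / (s - u) ^ 8) \<longlongrightarrow> - \<epsilon> / fact 8) (at u within I)"
          by (simp add: q_def poly3_parts_scale)
      qed (use disc[OF u] quad_pos hu' w \<epsilon>0 in auto)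
      hence "- \<epsilon> * poly2 3 (q u) x > 0" by (simp add: fact_numeral)
      moreover have "(P has_real_derivative poly2 3 (q u) x) (at u within I)"
        unfolding P_def p_def q_def using fam u
        by (intro poly2_coeff_deriv DERIV_cmult) (simp add: osculating_family_def)
      moreover have "P u = 0"
      proof -
        have "4 * lx u * P u = 0" using prod[OF u] hu by simp
        thus ?thesis using \<open>lx u < 0\<close> by simp
      qed
      ultimately have "eventually (\<lambda>r. - \<epsilon> * P r * (r - u) > 0) (at u within I)"
        using crossing_from_derivative by blast
      thus ?thesis using 1 by blast
    qed
    moreover have "eventually (\<lambda>r. r \<in> I) (at u within I)" by (simp add: eventually_at_filter)
    ultimately have "eventually (\<lambda>r. h' r * lx r > 0 \<and> - \<epsilon> * P r * (r - u) > 0 \<and> r \<in> I) (at u within I)"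
      by (auto intro: eventually_conj)
    thus ?thesis
    proof eventually_elim
      case (elim r)
      hence "lx r \<noteq> 0" by auto
      hence "4 * (lx r)\<^sup>2 * (- \<epsilon> * P r * (r - u)) > 0" using elim by (intro mult_pos_pos[of "4 * (lx r)\<^sup>2"]) auto
      also have "4 * (lx r)\<^sup>2 * (- \<epsilon> * P r * (r - u)) = (h' r * lx r) * (- \<epsilon> * h r * (r - u))"
        using prod[of r] elim by algebra
      finally show ?case using elim by (simp only: zero_less_mult_pos)
    qed
  qed
  have "alg_curve 3 a = alg_curve 3 (p0 s)" "alg_curve 3 b = alg_curve 3 (p0 t)"
    using fam osc st unfolding osculating_family_def by blast+
  hence zero: "h s = 0" "h t = 0" using on[of s C] on[of t D] st C D x by auto
  have cont: "continuous_on I h" unfolding continuous_on_def using h_lim by blast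
  have "s = t" by (rule unique_zero_of_one_way_crossing[OF I cont cross st(1,2) zero])
  thus False using st by simp
qed

section \<open>Osculating hyperbolas\<close>

lemma frac_linear_derivs:
  assumes "c * x + d \<noteq> 0"
  shows "(deriv ^^ 1) (frac_linear a b c d) x = (a * d - b * c) / (c * x + d)\<^sup>2"
    and "(deriv ^^ 2) (frac_linear a b c d) x = - 2 * c * (a * d - b * c) / (c * x + d) ^ 3"
    and "(deriv ^^ 3) (frac_linear a b c d) x = 6 * c\<^sup>2 * (a * d - b * c) / (c * x + d) ^ 4"
proof -
  define U where "U = {x. c * x + d \<noteq> 0}"
  have U: "open U" unfolding U_def by (intro open_Collect_neq continuous_intros)
  have d1: "((frac_linear a b c d) has_real_derivative (a * d - b * c) / (c * x + d)\<^sup>2) (at x)"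
    if "x \<in> U" for x
  proof -
    have "((\<lambda>x. (a * x + b) / (c * x + d)) has_real_derivative
        (a * (c * x + d) - (a * x + b) * c) / ((c * x + d) * (c * x + d))) (at x)"
      using that by (intro DERIV_divide) (auto intro!: derivative_eq_intros simp: U_def)
    moreover have "a * (c * x + d) - (a * x + b) * c = a * d - b * c" by (simp add: algebra_simps)
    ultimately show ?thesis unfolding frac_linear_def power2_eq_square by simp
  qed
  have pw: "((\<lambda>x. k / (c * x + d) ^ Suc m) has_real_derivative - real (Suc m) * c * k / (c * x + d) ^ Suc (Suc m)) (at x)"
    if "x \<in> U" for x k m
  proof -
    have y: "c * x + d \<noteq> 0" using that by (simp add: U_def)
    have "((\<lambda>x. c * x + d) has_real_derivative c) (at x)" by (auto intro!: derivative_eq_intros)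
    from DERIV_divide[OF DERIV_const DERIV_power[OF this, of "Suc m"], of k]
    have "((\<lambda>x. k / (c * x + d) ^ Suc m) has_real_derivative
        (0 * (c * x + d) ^ Suc m - k * (real (Suc m) * (c * (c * x + d) ^ m)))
          / ((c * x + d) ^ Suc m * (c * x + d) ^ Suc m)) (at x)"
      using y by simp
    moreover have "(0 * y ^ Suc m - k * (real (Suc m) * (c * y ^ m))) / (y ^ Suc m * y ^ Suc m)
        = - real (Suc m) * c * k / y ^ Suc (Suc m)" if "y \<noteq> 0" for y
      using that by (simp add: divide_simps) (simp add: algebra_simps)
    ultimately show ?thesis using y by simp
  qed
  have step: "deriv f x = g' x" if "x \<in> U" "\<And>x. x \<in> U \<Longrightarrow> f x = g x" "(g has_real_derivative g' x) (at x)"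
    for f g g' :: "real \<Rightarrow> real" and x
    using DERIV_imp_deriv[OF has_field_derivative_transform_within_open[OF that(3) U that(1)]] that(2) by simp
  have e1: "deriv (frac_linear a b c d) x = (a * d - b * c) / (c * x + d)\<^sup>2" if "x \<in> U" for x
    by (rule DERIV_imp_deriv[OF d1[OF that]])
  have d2: "((\<lambda>x. (a * d - b * c) / (c * x + d)\<^sup>2) has_real_derivative - 2 * c * (a * d - b * c) / (c * x + d) ^ 3) (at x)"
    if "x \<in> U" for x
    using pw[OF that, of "a * d - b * c" 1] by (simp add: numeral_2_eq_2 numeral_3_eq_3)
  have e2: "deriv (deriv (frac_linear a b c d)) x = - 2 * c * (a * d - b * c) / (c * x + d) ^ 3" if "x \<in> U" for x
    by (rule step[where g = "\<lambda>x. (a * d - b * c) / (c * x + d)\<^sup>2"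
          and g' = "\<lambda>x. - 2 * c * (a * d - b * c) / (c * x + d) ^ 3", OF that e1 d2[OF that]])
  have d3: "((\<lambda>x. - 2 * c * (a * d - b * c) / (c * x + d) ^ 3) has_real_derivative 6 * c\<^sup>2 * (a * d - b * c) / (c * x + d) ^ 4) (at x)"
    if "x \<in> U" for x
  proof -
    have n: "Suc 2 = 3" "Suc 3 = 4" by simp_all
    have eq: "- real 3 * c * (- 2 * c * (a * d - b * c)) = 6 * c\<^sup>2 * (a * d - b * c)"
      by (simp add: power2_eq_square)
    show ?thesis using pw[OF that, of "- 2 * c * (a * d - b * c)" 2] unfolding n eq .
  qed
  have e3: "deriv (deriv (deriv (frac_linear a b c d))) x = 6 * c\<^sup>2 * (a * d - b * c) / (c * x + d) ^ 4" if "x \<in> U" for x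
    by (rule step[where g = "\<lambda>x. - 2 * c * (a * d - b * c) / (c * x + d) ^ 3"
          and g' = "\<lambda>x. 6 * c\<^sup>2 * (a * d - b * c) / (c * x + d) ^ 4", OF that e2 d3[OF that]])
  have x: "x \<in> U" using assms by (simp add: U_def)
  show "(deriv ^^ 1) (frac_linear a b c d) x = (a * d - b * c) / (c * x + d)\<^sup>2"
    "(deriv ^^ 2) (frac_linear a b c d) x = - 2 * c * (a * d - b * c) / (c * x + d) ^ 3"
    "(deriv ^^ 3) (frac_linear a b c d) x = 6 * c\<^sup>2 * (a * d - b * c) / (c * x + d) ^ 4"
    using e1[OF x] e2[OF x] e3[OF x] by (simp_all add: eval_nat_numeral)
qed

text \<open>Here \<open>E\<close> does not increase as long as \<open>n \<ge> 0\<close> and does not decrease afterwards, and it is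
  positive at the turning point if there is one.\<close>

lemma valley_nonzero:
  fixes E n \<rho> :: "real \<Rightarrow> real"
  assumes der: "\<And>u. u \<in> {s..t} \<Longrightarrow> (E has_real_derivative - \<rho> u * n u) (at u)"
    and \<rho>: "\<And>u. u \<in> {s..t} \<Longrightarrow> \<rho> u \<ge> 0"
    and n: "continuous_on {s..t} n" "\<And>u v. s \<le> u \<Longrightarrow> u \<le> v \<Longrightarrow> v \<le> t \<Longrightarrow> n v \<le> n u"
    and pos: "\<And>u. u \<in> {s..t} \<Longrightarrow> n u = 0 \<Longrightarrow> E u > 0"
    and same: "E s * E t > 0" and u: "u \<in> {s..t}"
  shows "E u \<noteq> 0"
proof -
  have down: "E v \<le> E w" if "s \<le> w" "w \<le> v" "v \<le> t" "\<And>z. z \<in> {w..v} \<Longrightarrow> n z \<ge> 0" for v w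
  proof (rule DERIV_nonpos_imp_nonincreasing[OF that(2)])
    fix z assume z: "w \<le> z" "z \<le> v"
    thus "\<exists>y. (E has_real_derivative y) (at z) \<and> y \<le> 0"
      using der[of z] \<rho>[of z] that(4)[of z] that by (intro exI[of _ "- \<rho> z * n z"]) auto
  qed
  have up: "E w \<le> E v" if "s \<le> w" "w \<le> v" "v \<le> t" "\<And>z. z \<in> {w..v} \<Longrightarrow> n z \<le> 0" for v w
  proof (rule DERIV_nonneg_imp_nondecreasing[OF that(2)])
    fix z assume z: "w \<le> z" "z \<le> v"
    have "\<rho> z * n z \<le> 0" using \<rho>[of z] that(4)[of z] that z by (intro mult_nonneg_nonpos) auto
    thus "\<exists>y. (E has_real_derivative y) (at z) \<and> y \<ge> 0"
      using der[of z] that z by (intro exI[of _ "- \<rho> z * n z"]) auto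
  qed
  show ?thesis
  proof (cases "\<exists>z\<in>{s..t}. n z = 0")
    case True
    then obtain z where z: "z \<in> {s..t}" "n z = 0" by blast
    have "E z \<le> E u"
    proof (cases "u \<le> z")
      case True
      show ?thesis using u z True n(2)[of _ z] by (intro down) auto
    next
      case False
      show ?thesis using u z False n(2)[of z] by (intro up) auto
    qed
    thus ?thesis using pos[OF z] by simp
  next
    case False
    then obtain \<epsilon> :: real where \<epsilon>: "\<epsilon> = 1 \<or> \<epsilon> = - 1" "\<And>z. z \<in> {s..t} \<Longrightarrow> \<epsilon> * n z > 0"
      using continuous_nonvanishing_same_sign[OF _ n(1)] is_interval_cc by metis
    from \<epsilon>(1) show ?thesis
    proof
      assume "\<epsilon> = 1"
      hence "n z \<ge> 0" if "z \<in> {s..t}" for z using \<epsilon>(2)[OF that] by simp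
      hence "E u \<le> E s" "E t \<le> E u" using u by (auto intro!: down)
      thus ?thesis using same by (auto simp: zero_less_mult_iff)
    next
      assume "\<epsilon> = - 1"
      hence "n z \<le> 0" if "z \<in> {s..t}" for z using \<epsilon>(2)[OF that] by simp
      hence "E s \<le> E u" "E u \<le> E t" using u by (auto intro!: up)
      thus ?thesis using same by (auto simp: zero_less_mult_iff)
    qed
  qed
qed

lemma strict_increase:
  fixes G G' :: "real \<Rightarrow> real"
  assumes "s < t" and der: "\<And>u. u \<in> {s..t} \<Longrightarrow> (G has_real_derivative G' u) (at u)"
    and nonneg: "\<And>u. u \<in> {s..t} \<Longrightarrow> G' u \<ge> 0"
    and zero: "\<And>u v. u \<in> {s..t} \<Longrightarrow> v \<in> {s..t} \<Longrightarrow> G' u = 0 \<Longrightarrow> G' v = 0 \<Longrightarrow> u = v"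
  shows "G s < G t"
proof -
  define c where "c = (s + t) / 2"
  have c: "s < c" "c < t" using assms(1) by (auto simp: c_def)
  have "\<exists>u. s < u \<and> u < c \<and> G c - G s = (c - s) * G' u"
    by (rule MVT2[OF c(1)]) (use c der in auto)
  then obtain u where u: "s < u" "u < c" "G c - G s = (c - s) * G' u" by blast
  have "\<exists>v. c < v \<and> v < t \<and> G t - G c = (t - c) * G' v"
    by (rule MVT2[OF c(2)]) (use c der in auto)
  then obtain v where v: "c < v" "v < t" "G t - G c = (t - c) * G' v" by blast
  have "G' u \<ge> 0" "G' v \<ge> 0" using nonneg u v by auto
  moreover have "G' u \<noteq> 0 \<or> G' v \<noteq> 0" using zero[of u v] u v by auto
  ultimately have "G' u > 0 \<and> G' v \<ge> 0 \<or> G' u \<ge> 0 \<and> G' v > 0" by linarith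
  hence "(c - s) * G' u + (t - c) * G' v > 0"
  proof (elim disjE conjE)
    assume "G' u > 0" "G' v \<ge> 0"
    thus ?thesis using c by (intro add_pos_nonneg mult_pos_pos mult_nonneg_nonneg) auto
  next
    assume "G' u \<ge> 0" "G' v > 0"
    thus ?thesis using c by (intro add_nonneg_pos mult_pos_pos mult_nonneg_nonneg) auto
  qed
  thus ?thesis using u v by linarith
qed

text \<open>The value at \<open>x\<close> of the osculating fractional-linear transformation at \<open>t\<close> is \<open>hyp t x\<close>. Its
  denominator \<open>den t x\<close>, normalised to be 1 at \<open>t\<close>, is positive on the contact branch and negative on
  the remote branch. The function \<open>q\<close> is half the Schwarzian derivative.\<close>

locale nonvanishing_derivative =
  fixes f :: "real \<Rightarrow> real"
  assumes smooth: "smooth_fun f" and nz: "\<And>t. deriv f t \<noteq> 0"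
begin

abbreviation "f1 \<equiv> deriv f"
abbreviation "f2 \<equiv> deriv (deriv f)"
abbreviation "f3 \<equiv> deriv (deriv (deriv f))"

definition "m t = f2 t / (2 * f1 t)"
definition "q t = f3 t / (2 * f1 t) - 3 * (m t)\<^sup>2"
definition "den t x = 1 - m t * (x - t)"
definition "hyp t x = f t + f1 t * (x - t) / den t x"

lemma derivs:
  "(f has_real_derivative f1 t) (at t)" "(f1 has_real_derivative f2 t) (at t)"
  "(f2 has_real_derivative f3 t) (at t)" "continuous_on A f3"
proof -
  have d: "((deriv ^^ k) f has_real_derivative (deriv ^^ Suc k) f t) (at t)" for k t
    using smooth by (simp add: smooth_fun_def DERIV_deriv_iff_field_differentiable)
  show "(f has_real_derivative f1 t) (at t)" "(f1 has_real_derivative f2 t) (at t)"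
    "(f2 has_real_derivative f3 t) (at t)"
    using d[of 0 t] d[of 1 t] d[of 2 t] by (simp_all add: eval_nat_numeral)
  have "isCont f3 t" for t using DERIV_isCont[OF d[of 3 t]] by (simp add: eval_nat_numeral)
  thus "continuous_on A f3" by (simp add: continuous_at_imp_continuous_on)
qed

lemma continuous_f: "continuous_on A f" "continuous_on A f1" "continuous_on A f2"
  using derivs DERIV_isCont by (meson continuous_at_imp_continuous_on)+

lemma continuous_q: "continuous_on A q"
  unfolding q_def m_def using nz by (intro continuous_intros continuous_f derivs) auto

lemma m_deriv: "(m has_real_derivative q t + (m t)\<^sup>2) (at t)"
proof -
  have "((\<lambda>t. f2 t / (2 * f1 t)) has_real_derivative
      (f3 t * (2 * f1 t) - f2 t * (2 * f2 t)) / (2 * f1 t * (2 * f1 t))) (at t)"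
    using nz by (intro DERIV_divide derivs DERIV_cmult) auto
  moreover have "(f3 t * (2 * f1 t) - f2 t * (2 * f2 t)) / (2 * f1 t * (2 * f1 t)) = q t + (m t)\<^sup>2"
    using nz[of t] by (simp add: q_def m_def field_simps power2_eq_square)
  ultimately show ?thesis unfolding m_def by simp
qed

lemma sign_f1: obtains \<sigma> :: real where "\<sigma> = 1 \<or> \<sigma> = - 1" "\<And>t. \<sigma> * f1 t > 0"
proof (rule continuous_nonvanishing_same_sign[OF is_interval_univ continuous_f(2) nz])
  fix \<epsilon> :: real assume "\<epsilon> = 1 \<or> \<epsilon> = - 1" "\<And>t. t \<in> UNIV \<Longrightarrow> \<epsilon> * f1 t > 0"
  thus thesis using that[of \<epsilon>] by simp
qed

lemma osculating:
  assumes "osculating_frac_linear f t a b c d"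
  shows "c * x + d = (c * t + d) * den t x" and "c * t + d \<noteq> 0"
    and "c * x + d \<noteq> 0 \<Longrightarrow> frac_linear a b c d x = hyp t x"
proof -
  define e where "e = c * t + d"
  have e: "e \<noteq> 0" "a * d - b * c \<noteq> 0" using assms by (auto simp: osculating_frac_linear_def e_def)
  have k: "(deriv ^^ k) (frac_linear a b c d) t = (deriv ^^ k) f t" if "k \<le> 2" for k
    using assms that by (simp add: osculating_frac_linear_def)
  have k0: "a * t + b = f t * e"
  proof -
    have "(a * t + b) / e = f t" using k[of 0] by (simp add: frac_linear_def e_def)
    thus ?thesis using e(1) by (simp only: nonzero_divide_eq_eq not_False_eq_True)
  qed
  have k1: "a * d - b * c = f1 t * e\<^sup>2"
  proof -
    have "(a * d - b * c) / e\<^sup>2 = f1 t"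
      using k[of 1] frac_linear_derivs(1)[of c t d a b] e(1) by (simp add: e_def)
    thus ?thesis using e(1) by (simp only: nonzero_divide_eq_eq power_not_zero not_False_eq_True)
  qed
  have "- 2 * c * (a * d - b * c) / e ^ 3 = f2 t"
    using k[of 2] frac_linear_derivs(2)[of c t d a b] e by (simp add: e_def eval_nat_numeral)
  hence "f2 t = - 2 * c * f1 t / e"
    unfolding k1 using e by (simp add: eval_nat_numeral)
  hence "m t = - c / e" using nz[of t] by (simp add: m_def)
  hence c: "c = - m t * e" using e by (simp add: field_simps)
  show den: "c * x + d = (c * t + d) * den t x"
    using c unfolding den_def e_def by algebra
  show "c * t + d \<noteq> 0" using e by (simp add: e_def)
  have "e * a = e * (c * f t + f1 t * e)"
    using k0 k1 unfolding e_def by algebra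
  hence "a = c * f t + f1 t * e" using e by simp
  hence "a * x + b = f t * (c * x + d) + f1 t * (x - t) * e"
    using k0 unfolding e_def by algebra
  hence "frac_linear a b c d x = f t + f1 t * (x - t) * e / (c * x + d)" if "c * x + d \<noteq> 0"
    using that by (simp add: frac_linear_def add_divide_distrib)
  thus "frac_linear a b c d x = hyp t x" if "c * x + d \<noteq> 0"
    using that e unfolding hyp_def den e_def[symmetric] by simp
qed

lemma osculating_exists: "osculating_frac_linear f t (f1 t - m t * f t) (f t * (1 + m t * t) - f1 t * t) (- m t) (1 + m t * t)"
proof -
  define a b c d where "a = f1 t - m t * f t" and "b = f t * (1 + m t * t) - f1 t * t"
    and "c = - m t" and "d = 1 + m t * t"
  have e: "c * t + d = 1" by (simp add: c_def d_def)
  have det: "a * d - b * c = f1 t" by (simp add: a_def b_def c_def d_def algebra_simps)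
  have "(deriv ^^ k) (frac_linear a b c d) t = (deriv ^^ k) f t" if "k \<le> 2" for k
  proof -
    have "k = 0 \<or> k = 1 \<or> k = 2" using that by auto
    moreover have "frac_linear a b c d t = f t"
      unfolding frac_linear_def e by (simp add: a_def b_def algebra_simps)
    moreover have "(deriv ^^ 1) (frac_linear a b c d) t = f1 t"
      using frac_linear_derivs(1)[of c t d a b] by (simp add: e det)
    moreover have "(deriv ^^ 2) (frac_linear a b c d) t = f2 t"
      using frac_linear_derivs(2)[of c t d a b] nz[of t] by (simp add: e det) (simp add: c_def m_def)
    ultimately show ?thesis by (auto simp: eval_nat_numeral)
  qed
  hence "osculating_frac_linear f t a b c d"
    unfolding osculating_frac_linear_def using e det nz[of t] by simp
  thus ?thesis by (simp only: a_def b_def c_def d_def)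
qed

lemma q_nonzero:
  assumes "\<not> hyperbola_hyper_osculates f t"
  shows "q t \<noteq> 0"
proof
  assume "q t = 0"
  hence "f3 t = 6 * (m t)\<^sup>2 * f1 t" using nz[of t] by (simp add: q_def field_simps)
  moreover define a b c d where "a = f1 t - m t * f t" and "b = f t * (1 + m t * t) - f1 t * t"
    and "c = - m t" and "d = 1 + m t * t"
  have e: "c * t + d = 1" by (simp add: c_def d_def)
  have det: "a * d - b * c = f1 t" by (simp add: a_def b_def c_def d_def algebra_simps)
  have "(deriv ^^ 3) (frac_linear a b c d) t = 6 * (m t)\<^sup>2 * f1 t"
    using frac_linear_derivs(3)[of c t d a b, unfolded e det] by (simp add: c_def)
  moreover have "osculating_frac_linear f t a b c d"
    unfolding a_def b_def c_def d_def by (rule osculating_exists)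
  ultimately show False
    using assms unfolding hyperbola_hyper_osculates_def by (auto simp: eval_nat_numeral)
qed

text \<open>Up to a positive factor, \<open>den u x\<close> is the value at \<open>x\<close> of the tangent at \<open>u\<close> to the graph of
  \<open>\<psi> = 1 / sqrt \<bar>f1\<bar>\<close>, and \<open>\<psi>'' = - q * \<psi>\<close>. So the derivative of that
  value with respect to \<open>u\<close> has the sign of \<open>- q u * (x - u)\<close>.\<close>

lemma den_nonzero_between:
  assumes q: "\<And>u. u \<in> {s..t} \<Longrightarrow> q u > 0" and same: "den s x * den t x > 0" and u: "u \<in> {s..t}"
  shows "den u x \<noteq> 0"
proof -
  obtain \<sigma> :: real where \<sigma>: "\<sigma> = 1 \<or> \<sigma> = - 1" "\<And>t. \<sigma> * f1 t > 0" using sign_f1 by blast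
  define \<psi> where "\<psi> = (\<lambda>u. exp (- (ln (\<sigma> * f1 u) / 2)))"
  have \<psi>: "(\<psi> has_real_derivative - m u * \<psi> u) (at u)" for u
  proof -
    have "(\<psi> has_real_derivative exp (- (ln (\<sigma> * f1 u) / 2)) * - (1 / (\<sigma> * f1 u) * (\<sigma> * f2 u) / 2)) (at u)"
      unfolding \<psi>_def
      by (rule derivative_eq_intros derivs refl | use \<sigma>(2)[of u] in simp)+
    moreover have "- (1 / (\<sigma> * f1 u) * (\<sigma> * f2 u) / 2) = - m u"
      using \<sigma>(2)[of u] by (auto simp: m_def)
    ultimately show ?thesis unfolding \<psi>_def by (simp add: mult.commute)
  qed
  have "\<psi> u * den u x \<noteq> 0"
  proof (rule valley_nonzero[where u = u and E = "\<lambda>u. \<psi> u * den u x" and \<rho> = "\<lambda>u. \<psi> u * q u" and n = "\<lambda>u. x - u" and s = s and t = t])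
    fix u assume "u \<in> {s..t}"
    have "((\<lambda>u. \<psi> u * (1 - m u * (x - u))) has_real_derivative
        - m u * \<psi> u * (1 - m u * (x - u)) + (0 - ((q u + (m u)\<^sup>2) * (x - u) + (0 - 1) * m u)) * \<psi> u) (at u)"
      by (intro DERIV_mult \<psi> DERIV_diff DERIV_const m_deriv DERIV_ident)
    moreover have "- m u * \<psi> u * (1 - m u * (x - u)) + (0 - ((q u + (m u)\<^sup>2) * (x - u) + (0 - 1) * m u)) * \<psi> u
        = - (\<psi> u * q u) * (x - u)"
      by (simp add: algebra_simps power2_eq_square)
    ultimately show "((\<lambda>u. \<psi> u * den u x) has_real_derivative - (\<psi> u * q u) * (x - u)) (at u)"
      unfolding den_def by simp
    show "\<psi> u * q u \<ge> 0" using q[OF \<open>u \<in> {s..t}\<close>] by (simp add: \<psi>_def)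
  next
    show "\<psi> u * den u x > 0" if "x - u = 0" for u
      using that by (simp add: den_def \<psi>_def)
  next
    have "\<psi> s * \<psi> t * (den s x * den t x) > 0" using same by (simp add: \<psi>_def)
    thus "\<psi> s * den s x * (\<psi> t * den t x) > 0" by (simp add: mult_ac)
  qed (use u in \<open>auto intro!: continuous_intros\<close>)
  thus ?thesis by simp
qed

text \<open>If the denominator does not vanish between \<open>s\<close> and \<open>t\<close>, then the value at \<open>x\<close> of the osculating
  transformation is strictly monotone in between.\<close>

lemma hyp_distinct_pos:
  assumes st: "s < t" and q: "\<And>u. u \<in> {s..t} \<Longrightarrow> q u > 0" and same: "den s x * den t x > 0"
  shows "hyp s x \<noteq> hyp t x"
proof -
  obtain \<sigma> :: real where \<sigma>: "\<sigma> = 1 \<or> \<sigma> = - 1" "\<And>t. \<sigma> * f1 t > 0" using sign_f1 by blast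
  have nz': "den u x \<noteq> 0" if "u \<in> {s..t}" for u using den_nonzero_between[OF q same that] .
  have "\<sigma> * hyp s x < \<sigma> * hyp t x"
  proof (rule strict_increase[OF st, where G' = "\<lambda>u. \<sigma> * f1 u * q u * ((x - u) / den u x)\<^sup>2"])
    fix u assume u: "u \<in> {s..t}"
    have d: "den u x \<noteq> 0" using nz' u .
    have "((\<lambda>u. 1 - m u * (x - u)) has_real_derivative
        0 - ((q u + (m u)\<^sup>2) * (x - u) + (0 - 1) * m u)) (at u)"
      by (intro DERIV_diff DERIV_mult DERIV_const m_deriv DERIV_ident)
    hence D: "((\<lambda>u. den u x) has_real_derivative m u - (q u + (m u)\<^sup>2) * (x - u)) (at u)"
      unfolding den_def by (simp add: algebra_simps)
    have "((\<lambda>u. f u + f1 u * (x - u) / den u x) has_real_derivative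
        f1 u + ((f2 u * (x - u) + (0 - 1) * f1 u) * den u x
          - f1 u * (x - u) * (m u - (q u + (m u)\<^sup>2) * (x - u))) / (den u x * den u x)) (at u)"
      by (intro DERIV_add DERIV_divide DERIV_mult DERIV_diff DERIV_const DERIV_ident derivs D d)
    moreover have "f1 u + ((f2 u * (x - u) + (0 - 1) * f1 u) * den u x
          - f1 u * (x - u) * (m u - (q u + (m u)\<^sup>2) * (x - u))) / (den u x * den u x)
        = f1 u * q u * ((x - u) / den u x)\<^sup>2"
    proof -
      have f2: "f2 u = 2 * m u * f1 u" using nz[of u] by (simp add: m_def)
      have "f1 u * (den u x * den u x) + ((f2 u * (x - u) + (0 - 1) * f1 u) * den u x
          - f1 u * (x - u) * (m u - (q u + (m u)\<^sup>2) * (x - u))) = f1 u * q u * (x - u)\<^sup>2"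
        unfolding f2 den_def by algebra
      thus ?thesis using d by (simp add: power_divide power2_eq_square[of "den u x"] add_divide_eq_iff mult_ac)
    qed
    ultimately have "((\<lambda>u. hyp u x) has_real_derivative f1 u * q u * ((x - u) / den u x)\<^sup>2) (at u)"
      unfolding hyp_def by simp
    from DERIV_cmult[OF this, of \<sigma>]
    show "((\<lambda>u. \<sigma> * hyp u x) has_real_derivative \<sigma> * f1 u * q u * ((x - u) / den u x)\<^sup>2) (at u)"
      by (simp only: mult.assoc)
    show "\<sigma> * f1 u * q u * ((x - u) / den u x)\<^sup>2 \<ge> 0"
      using \<sigma>(2)[of u] q[OF u] by simp
  next
    fix u v assume uv: "u \<in> {s..t}" "v \<in> {s..t}" "\<sigma> * f1 u * q u * ((x - u) / den u x)\<^sup>2 = 0"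
      "\<sigma> * f1 v * q v * ((x - v) / den v x)\<^sup>2 = 0"
    have "x - w = 0" if "w \<in> {s..t}" "\<sigma> * f1 w * q w * ((x - w) / den w x)\<^sup>2 = 0" for w
      using that \<sigma>(2)[of w] q[of w] nz'[of w] by auto
    from this[OF uv(1,3)] this[OF uv(2,4)] show "u = v" by simp
  qed
  thus ?thesis by auto
qed

text \<open>For \<open>q < 0\<close> the denominator may have zeros between \<open>s\<close> and \<open>t\<close>. Exchanging the two coordinates, which
  replaces \<open>f\<close> by its inverse and changes the sign of the Schwarzian derivative, reduces this case to
  the previous one; \<open>den'\<close> is the denominator of the inverse transformation.\<close>

definition "den' t y = 1 + m t / f1 t * (y - f t)"

lemma den'_eq: "den t x \<noteq> 0 \<Longrightarrow> den' t (hyp t x) = 1 / den t x"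
  using nz[of t] by (simp add: den'_def hyp_def field_simps) (simp add: den_def algebra_simps)

lemma mf1_deriv: "((\<lambda>u. m u / f1 u) has_real_derivative (q u - (m u)\<^sup>2) / f1 u) (at u)"
proof -
  have f2: "f2 u = 2 * m u * f1 u" using nz[of u] by (simp add: m_def)
  have "((\<lambda>u. m u / f1 u) has_real_derivative ((q u + (m u)\<^sup>2) * f1 u - m u * f2 u) / (f1 u * f1 u)) (at u)"
    by (intro DERIV_divide m_deriv derivs nz)
  moreover have "((q u + (m u)\<^sup>2) * f1 u - m u * f2 u) / (f1 u * f1 u) = (q u - (m u)\<^sup>2) / f1 u"
    unfolding f2 using nz[of u] by (simp add: divide_simps) (simp add: algebra_simps power2_eq_square)
  ultimately show ?thesis by simp
qed

lemma den'_nonzero_between: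
  assumes q: "\<And>u. u \<in> {s..t} \<Longrightarrow> q u < 0" and same: "den' s y * den' t y > 0" and u: "u \<in> {s..t}"
  shows "den' u y \<noteq> 0"
proof -
  obtain \<sigma> :: real where \<sigma>: "\<sigma> = 1 \<or> \<sigma> = - 1" "\<And>t. \<sigma> * f1 t > 0" using sign_f1 by blast
  define \<psi> where "\<psi> = (\<lambda>u. exp (ln (\<sigma> * f1 u) / 2))"
  have \<psi>: "(\<psi> has_real_derivative m u * \<psi> u) (at u)" for u
  proof -
    have "(\<psi> has_real_derivative exp (ln (\<sigma> * f1 u) / 2) * (1 / (\<sigma> * f1 u) * (\<sigma> * f2 u) / 2)) (at u)"
      unfolding \<psi>_def
      by (rule derivative_eq_intros derivs refl | use \<sigma>(2)[of u] in simp)+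
    moreover have "1 / (\<sigma> * f1 u) * (\<sigma> * f2 u) / 2 = m u"
      using \<sigma>(2)[of u] by (auto simp: m_def)
    ultimately show ?thesis unfolding \<psi>_def by (simp add: mult.commute)
  qed
  have mono: "\<sigma> * f u \<le> \<sigma> * f v" if "u \<le> v" for u v
  proof (rule DERIV_nonneg_imp_nondecreasing[OF that])
    fix z show "\<exists>y. ((\<lambda>u. \<sigma> * f u) has_real_derivative y) (at z) \<and> y \<ge> 0"
      using \<sigma>(2)[of z] DERIV_cmult[OF derivs(1)[of z], of \<sigma>] by (auto intro: less_imp_le)
  qed
  have "\<psi> u * den' u y \<noteq> 0"
  proof (rule valley_nonzero[where u = u and E = "\<lambda>u. \<psi> u * den' u y" and \<rho> = "\<lambda>u. \<psi> u * (- q u) / (\<sigma> * f1 u)" and n = "\<lambda>u. \<sigma> * (y - f u)" and s = s and t = t])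
    fix u assume "u \<in> {s..t}"
    have "((\<lambda>u. \<psi> u * (1 + m u / f1 u * (y - f u))) has_real_derivative
        m u * \<psi> u * (1 + m u / f1 u * (y - f u))
          + (0 + ((q u - (m u)\<^sup>2) / f1 u * (y - f u) + (0 - f1 u) * (m u / f1 u))) * \<psi> u) (at u)"
      by (intro DERIV_mult \<psi> DERIV_diff DERIV_add DERIV_const mf1_deriv derivs)
    moreover have "m u * \<psi> u * (1 + m u / f1 u * (y - f u))
          + (0 + ((q u - (m u)\<^sup>2) / f1 u * (y - f u) + (0 - f1 u) * (m u / f1 u))) * \<psi> u
        = \<psi> u * q u / f1 u * (y - f u)"
      using nz[of u] by (simp add: divide_simps) (simp add: algebra_simps power2_eq_square)
    moreover have "- (\<psi> u * (- q u) / (\<sigma> * f1 u)) * (\<sigma> * (y - f u)) = \<psi> u * q u / f1 u * (y - f u)"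
      using \<sigma>(1) by auto
    ultimately show "((\<lambda>u. \<psi> u * den' u y) has_real_derivative
        - (\<psi> u * (- q u) / (\<sigma> * f1 u)) * (\<sigma> * (y - f u))) (at u)"
      unfolding den'_def by simp
    have "\<psi> u * (- q u) \<ge> 0" using q[OF \<open>u \<in> {s..t}\<close>] by (simp add: \<psi>_def mult_le_0_iff)
    thus "\<psi> u * (- q u) / (\<sigma> * f1 u) \<ge> 0" using \<sigma>(2)[of u] by (intro divide_nonneg_pos)
  next
    show "\<psi> u * den' u y > 0" if "\<sigma> * (y - f u) = 0" for u
      using that \<sigma>(1) by (auto simp: den'_def \<psi>_def)
  next
    have "\<psi> s * \<psi> t * (den' s y * den' t y) > 0" using same by (simp add: \<psi>_def)
    thus "\<psi> s * den' s y * (\<psi> t * den' t y) > 0" by (simp add: mult_ac)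
  next
    show "continuous_on {s..t} (\<lambda>u. \<sigma> * (y - f u))" by (intro continuous_intros continuous_f)
    show "\<sigma> * (y - f v) \<le> \<sigma> * (y - f u)" if "u \<le> v" for u v
      using mono[OF that] by (simp add: right_diff_distrib)
  qed (use u in auto)
  thus ?thesis by simp
qed

lemma hyp_distinct_neg:
  assumes st: "s < t" and q: "\<And>u. u \<in> {s..t} \<Longrightarrow> q u < 0" and same: "den s x * den t x > 0"
  shows "hyp s x \<noteq> hyp t x"
proof
  assume eq: "hyp s x = hyp t x"
  define y where "y = hyp s x"
  obtain \<sigma> :: real where \<sigma>: "\<sigma> = 1 \<or> \<sigma> = - 1" "\<And>t. \<sigma> * f1 t > 0" using sign_f1 by blast
  have d0: "den s x \<noteq> 0" "den t x \<noteq> 0" using same by auto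
  have "den' s y = 1 / den s x" "den' t y = 1 / den t x"
    using den'_eq[OF d0(1)] den'_eq[OF d0(2)] by (simp_all add: y_def eq)
  hence same': "den' s y * den' t y > 0" using same by simp
  have nz': "den' u y \<noteq> 0" if "u \<in> {s..t}" for u using den'_nonzero_between[OF q same' that] .
  \<comment> \<open>\<open>X u\<close> is the point at which the osculating transformation at \<open>u\<close> takes the value \<open>y\<close>.\<close>
  define X where "X = (\<lambda>u. u + (y - f u) / (f1 u * den' u y))"
  have "X s < X t"
  proof (rule strict_increase[OF st, where G' = "\<lambda>u. - q u * ((y - f u) / (f1 u * den' u y))\<^sup>2"])
    fix u assume u: "u \<in> {s..t}"
    define A B where "A = y - f u" and "B = f1 u * den' u y"
    have B: "B \<noteq> 0" using nz'[OF u] nz[of u] by (simp add: B_def)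
    have Bf: "f1 u * den' u y = f1 u + m u * (y - f u)" for u
      using nz[of u] by (simp add: den'_def field_simps)
    have f2: "f2 u = 2 * m u * f1 u" using nz[of u] by (simp add: m_def)
    have "((\<lambda>u. f1 u + m u * (y - f u)) has_real_derivative
        f2 u + ((q u + (m u)\<^sup>2) * (y - f u) + (0 - f1 u) * m u)) (at u)"
      by (intro DERIV_add DERIV_mult DERIV_diff DERIV_const m_deriv derivs)
    hence D: "((\<lambda>u. f1 u * den' u y) has_real_derivative m u * f1 u + (q u + (m u)\<^sup>2) * A) (at u)"
      unfolding Bf f2 A_def by (simp add: algebra_simps)
    have "(X has_real_derivative 1 + ((0 - f1 u) * B - A * (m u * f1 u + (q u + (m u)\<^sup>2) * A)) / (B * B)) (at u)"
      unfolding X_def A_def B_def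
      by (intro DERIV_add DERIV_divide DERIV_diff DERIV_const DERIV_ident derivs D[unfolded A_def]) (use B in \<open>simp add: B_def\<close>)
    moreover have "1 + ((0 - f1 u) * B - A * (m u * f1 u + (q u + (m u)\<^sup>2) * A)) / (B * B) = - q u * (A / B)\<^sup>2"
    proof -
      have "B = f1 u + m u * A" by (simp add: B_def A_def Bf)
      hence "B * B + ((0 - f1 u) * B - A * (m u * f1 u + (q u + (m u)\<^sup>2) * A)) = - q u * A\<^sup>2"
        by algebra
      thus ?thesis using B by (simp add: power_divide power2_eq_square[of B] add_divide_eq_iff mult_ac)
    qed
    ultimately show "(X has_real_derivative - q u * ((y - f u) / (f1 u * den' u y))\<^sup>2) (at u)"
      by (simp add: A_def B_def)
    show "- q u * ((y - f u) / (f1 u * den' u y))\<^sup>2 \<ge> 0"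
      using q[OF u] by (intro mult_nonneg_nonneg) auto
  next
    fix u v assume uv: "u \<in> {s..t}" "v \<in> {s..t}" "- q u * ((y - f u) / (f1 u * den' u y))\<^sup>2 = 0"
      "- q v * ((y - f v) / (f1 v * den' v y))\<^sup>2 = 0"
    have fw: "f w = y" if "w \<in> {s..t}" "- q w * ((y - f w) / (f1 w * den' w y))\<^sup>2 = 0" for w
      using that q[of w] nz'[of w] nz[of w] by auto
    have "f u = f v" using fw[OF uv(1,3)] fw[OF uv(2,4)] by simp
    show "u = v"
    proof (rule ccontr)
      assume "u \<noteq> v"
      hence "\<exists>z. f1 z = 0"
      proof (cases "u < v")
        case True
        obtain z where "f v - f u = (v - u) * f1 z" using MVT2[OF True derivs(1)] by blast
        thus ?thesis using \<open>f u = f v\<close> True by auto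
      next
        case False
        hence "v < u" using \<open>u \<noteq> v\<close> by simp
        obtain z where "f u - f v = (u - v) * f1 z" using MVT2[OF \<open>v < u\<close> derivs(1)] by blast
        thus ?thesis using \<open>f u = f v\<close> \<open>v < u\<close> by auto
      qed
      thus False using nz by blast
    qed
  qed
  moreover have "X w = x" if "hyp w x = y" "den w x \<noteq> 0" for w
  proof -
    have "den' w y = 1 / den w x" using den'_eq[OF that(2)] that(1) by simp
    moreover have "y - f w = f1 w * (x - w) / den w x" using that(1) by (simp add: hyp_def)
    ultimately show ?thesis using that(2) nz[of w] by (simp add: X_def)
  qed
  ultimately show False using d0 eq by (simp add: y_def)
qed

lemma branches:
  assumes "osculating_hyperbola f t H"
  shows "(x, y) \<in> contact_branch f t H \<longleftrightarrow> den t x > 0 \<and> y = hyp t x"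
    and "(x, y) \<in> remote_branch f t H \<longleftrightarrow> den t x < 0 \<and> y = hyp t x"
proof -
  obtain a b c d where o: "osculating_frac_linear f t a b c d"
    and H: "H = {(x, frac_linear a b c d x) | x. c * x + d \<noteq> 0}"
    using assms unfolding osculating_hyperbola_def by blast
  have mem: "(x, y) \<in> H \<longleftrightarrow> den t x \<noteq> 0 \<and> y = hyp t x" for x y
  proof -
    have "(x, y) \<in> H \<longleftrightarrow> c * x + d \<noteq> 0 \<and> y = frac_linear a b c d x" unfolding H by blast
    thus ?thesis using osculating(1)[OF o, of x] osculating(2)[OF o] osculating(3)[OF o, of x] by (metis mult_eq_0_iff)
  qed
  have t: "(t, f t) \<in> H" by (simp add: mem den_def hyp_def)
  have contact: "(x, y) \<in> contact_branch f t H \<longleftrightarrow> den t x > 0 \<and> y = hyp t x" for x y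
  proof
    assume "(x, y) \<in> contact_branch f t H"
    then obtain T where T: "connected T" "T \<subseteq> H" "(t, f t) \<in> T" "(x, y) \<in> T"
      by (auto simp: contact_branch_def connected_component_def)
    have "connected ((\<lambda>z. den t (fst z)) ` T)"
      unfolding den_def by (intro connected_continuous_image T continuous_intros)
    hence "is_interval ((\<lambda>z. den t (fst z)) ` T)" by (simp add: is_interval_connected_1)
    moreover have "den t x \<in> (\<lambda>z. den t (fst z)) ` T" "den t t \<in> (\<lambda>z. den t (fst z)) ` T"
      using T(3,4) by (force)+
    moreover have "0 \<notin> (\<lambda>z. den t (fst z)) ` T" using T(2) mem by force
    moreover have "den t t = 1" by (simp add: den_def)
    ultimately have "\<not> den t x \<le> 0" using mem_is_interval_1_I[of _ "den t x" "den t t" 0] by auto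
    moreover have "(x, y) \<in> H" using T by blast
    ultimately show "den t x > 0 \<and> y = hyp t x" using mem by simp
  next
    assume xy: "den t x > 0 \<and> y = hyp t x"
    define T where "T = (\<lambda>z. (z, hyp t z)) ` closed_segment t x"
    have pos: "den t z > 0" if z: "z \<in> closed_segment t x" for z
    proof -
      obtain u where u: "0 \<le> u" "u \<le> 1" "z = (1 - u) *\<^sub>R t + u *\<^sub>R x" using z by (auto simp: closed_segment_def)
      have "den t z = (1 - u) * 1 + u * den t x" unfolding u(3) den_def by (simp add: algebra_simps)
      moreover have "(1 - u) * 1 + u * den t x > 0"
        using u xy by (cases "u = 0") (auto intro: add_nonneg_pos)
      ultimately show ?thesis by simp
    qed
    have cont: "continuous_on (closed_segment t x) (\<lambda>z. (z, hyp t z))"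
      unfolding hyp_def den_def using pos[unfolded den_def] by (intro continuous_intros) force
    have "connected T" unfolding T_def by (intro connected_continuous_image cont) simp
    moreover have "T \<subseteq> H" using pos mem by (force simp: T_def)
    moreover have "(t, f t) \<in> T" unfolding T_def by (rule image_eqI[of _ _ t]) (auto simp: hyp_def)
    moreover have "(x, y) \<in> T" unfolding T_def using xy by auto
    ultimately show "(x, y) \<in> contact_branch f t H"
      by (auto simp: contact_branch_def connected_component_def)
  qed
  show "(x, y) \<in> contact_branch f t H \<longleftrightarrow> den t x > 0 \<and> y = hyp t x" by (rule contact)
  show "(x, y) \<in> remote_branch f t H \<longleftrightarrow> den t x < 0 \<and> y = hyp t x"
    unfolding remote_branch_def Diff_iff mem contact by auto
qed

end

theorem osculating_hyperbolas_disjoint: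
  assumes "smooth_fun f" "\<And>t. deriv f t \<noteq> 0" and I: "is_interval I"
    and nh: "\<And>t. t \<in> I \<Longrightarrow> \<not> hyperbola_hyper_osculates f t"
    and st: "s \<in> I" "t \<in> I" "s \<noteq> t" and H: "osculating_hyperbola f s H" and K: "osculating_hyperbola f t K"
  shows "contact_branch f s H \<inter> contact_branch f t K = {}" "remote_branch f s H \<inter> remote_branch f t K = {}"
proof -
  interpret nonvanishing_derivative f using assms by unfold_locales
  obtain \<epsilon> :: real where \<epsilon>: "\<epsilon> = 1 \<or> \<epsilon> = - 1" "\<And>t. t \<in> I \<Longrightarrow> \<epsilon> * q t > 0"
    using continuous_nonvanishing_same_sign[OF I continuous_q q_nonzero[OF nh]] by blast
  have distinct: "hyp s x \<noteq> hyp t x" if "s \<in> I" "t \<in> I" "s < t" "den s x * den t x > 0" for s t x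
  proof -
    have sub: "u \<in> I" if "u \<in> {s..t}" for u
      using mem_is_interval_1_I[OF I \<open>s \<in> I\<close> \<open>t \<in> I\<close>, of u] that by simp
    from \<epsilon>(1) show ?thesis
    proof
      assume "\<epsilon> = 1"
      hence "q u > 0" if "u \<in> {s..t}" for u using \<epsilon>(2)[OF sub[OF that]] by simp
      thus ?thesis using hyp_distinct_pos that by blast
    next
      assume "\<epsilon> = - 1"
      hence "q u < 0" if "u \<in> {s..t}" for u using \<epsilon>(2)[OF sub[OF that]] by simp
      thus ?thesis using hyp_distinct_neg that by blast
    qed
  qed
  have ne: "hyp s x \<noteq> hyp t x" if "den s x * den t x > 0" for x
    using distinct[of s t x] distinct[of t s x] st that by (metis linorder_neqE mult.commute)
  show "contact_branch f s H \<inter> contact_branch f t K = {}"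
    using ne branches(1)[OF H] branches(1)[OF K] by (force simp: zero_less_mult_iff)
  show "remote_branch f s H \<inter> remote_branch f t K = {}"
    using ne branches(2)[OF H] branches(2)[OF K] by (force simp: zero_less_mult_iff)
qed

section \<open>The three statements\<close>

theorem theorem4:
  "(\<forall>\<gamma> I.
      smooth_regular_curve I \<gamma> \<and>
      (\<forall>t\<in>I. \<not> extactic 2 I \<gamma> t) \<and>
      (\<forall>t\<in>I. \<forall>a. osculates 2 I \<gamma> t a \<longrightarrow> nonsingular_curve 2 a \<and> is_ellipse (alg_curve 2 a)) \<longrightarrow>
      (\<forall>s\<in>I. \<forall>t\<in>I. \<forall>a b. s \<noteq> t \<and> osculates 2 I \<gamma> s a \<and> osculates 2 I \<gamma> t b \<longrightarrow>
         alg_curve 2 a \<inter> alg_curve 2 b = {})) \<and>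
   (\<forall>\<gamma> I.
      smooth_regular_curve I \<gamma> \<and>
      (\<forall>t\<in>I. \<not> extactic 3 I \<gamma> t) \<and>
      (\<forall>t\<in>I. \<forall>a. osculates 3 I \<gamma> t a \<longrightarrow> nonsingular_curve 3 a \<and>
         (\<exists>C B. components (alg_curve 3 a) = {C, B} \<and> is_oval C \<and> \<not> bounded B \<and> \<gamma> t \<in> C)) \<longrightarrow>
      (\<forall>s\<in>I. \<forall>t\<in>I. \<forall>a b C D. s \<noteq> t \<and> osculates 3 I \<gamma> s a \<and> osculates 3 I \<gamma> t b \<and>
         C \<in> components (alg_curve 3 a) \<and> is_oval C \<and>
         D \<in> components (alg_curve 3 b) \<and> is_oval D \<longrightarrow>
         C \<inter> D = {})) \<and>
   (\<forall>f I.
      smooth_fun f \<and> (\<forall>t. deriv f t \<noteq> 0) \<and> is_interval I \<and>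
      (\<forall>t\<in>I. \<not> hyperbola_hyper_osculates f t) \<longrightarrow>
      (\<forall>s\<in>I. \<forall>t\<in>I. \<forall>H K. s \<noteq> t \<and> osculating_hyperbola f s H \<and> osculating_hyperbola f t K \<longrightarrow>
         contact_branch f s H \<inter> contact_branch f t K = {} \<and>
         remote_branch f s H \<inter> remote_branch f t K = {}))"
proof (intro conjI, goal_cases)
  case 1
  show ?case
    by (intro allI impI ballI, elim conjE, rule osculating_conics_disjoint) simp_all
next
  case 2
  show ?case
    by (intro allI impI ballI, elim conjE, rule osculating_cubic_ovals_disjoint) (assumption | simp)+
next
  case 3
  show ?case
    by (intro allI impI ballI, elim conjE, intro conjI; rule osculating_hyperbolas_disjoint; (assumption | simp))
qed

end
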